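(* Assume $P$ satisfies SYM and BAL. Then $d_{\rm cond}\le d_{\rm KS}$.
   Context: Fix a finite set $\Omega$ with $q=|\Omega|$, an integer $k\ge2$, a finite set $\Psi$ of functions $\Omega^k\to[0,1]$ closed under permutations of coordinates ($\psi^\theta(\sigma)=\psi(\sigma_{\theta(1)},\dots,\sigma_{\theta(k)})$), and a probability distribution $P$ on $\Psi$ with $P(\psi)>0$ for all $\psi$ and $\min_{\psi,\sigma}\psi(\sigma)<\max_{\psi,\sigma}\psi(\sigma)$. $\boldsymbol\psi$ is a sample from $P$, $\xi=q^{-k}\sum_{\sigma\in\Omega^k}\mathbb E[\boldsymbol\psi(\sigma)]$. SYM: for all $i\in[k]$, $\omega\in\Omega$, $\psi\in\Psi$, $\sum_{\tau\in\Omega^k}\mathbf 1\{\tau_i=\omega\}\psi(\tau)=q^{k-1}\xi$, and $P(\psi)=P(\psi^\theta)$ for all permutations $\theta$. BAL: $\phi(\mu)=\sum_{\tau\in\Omega^k}\mathbb E[\boldsymbol\psi(\tau)]\prod_{i=1}^k\mu(\tau_i)$ is concave on the set of probability distributions $\mu$ on $\Omega$ and maximised at the uniform distribution. For $\psi\in\Psi$ let $\Phi_\psi\in\mathbb R^{\Omega\times\Omega}$, $\Phi_\psi(\omega,\omega')=q^{1-k}\xi^{-1}\sum_{\tau\in\Omega^k}\mathbf 1\{\tau_1=\omega,\tau_2=\omega'\}\psi(\tau)$, and $\Xi=\mathbb E[\Phi_{\boldsymbol\psi}\otimes\Phi_{\boldsymbol\psi}]$ acting on $\mathbb R^q\otimes\mathbb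 R^q$. With $\mathbf 1$ the all-ones vector, $\mathcal E=\{z\in\mathbb R^q\otimes\mathbb R^q:\langle z,\mathbf 1\otimes y\rangle=\langle z,y\otimes\mathbf 1\rangle=0\ \forall y\in\mathbb R^q\}$ and $d_{\rm KS}=\big((k-1)\max_{x\in\mathcal E,\|x\|=1}\langle\Xi x,x\rangle\big)^{-1}$ ($=\infty$ if the maximum is $0$). $d_{\rm cond}$: with $\Lambda(x)=x\ln x$, $\Lambda(0)=0$, $\mathcal P^2_*(\Omega)$ the probability measures $\pi$ on the simplex $\mathcal P(\Omega)$ with $\int\mu(\omega)d\pi(\mu)=1/q$ for all $\omega$, $\gamma\sim{\rm Po}(d)$, $\rho_1,\rho_2,\dots$ i.i.d. from $\pi$, $\psi_1,\psi_2,\dots$ i.i.d. from $P$, all independent, $\mathcal B(d,P,\pi)=\mathbb E\big[q^{-1}\xi^{-\gamma}\Lambda\big(\sum_{\sigma\in\Omega}\prod_{i=1}^{\gamma}\sum_{\tau\in\Omega^k}\mathbf 1\{\tau_k=\sigma\}\psi_i(\tau)\prod_{j=1}^{k-1}\rho_{ki+j}(\tau_j)\big)-\frac{d(k-1)}{k\xi}\Lambda\big(\sum_{\tau\in\Omega^k}\psi_1(\tau)\prod_{j=1}^k\rho_j(\tau_j)\big)\big]$ and $d_{\rm cond}=\inf\{d>0:\sup_{\pi\in\mathcal P^2_*(\Omega)}\mathcal B(d,P,\pi)>\ln q+\frac dk\ln\xi\}$. *)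

theory Defs
  imports "HOL-Probability.Probability" "HOL-Combinatorics.Permutations"
begin

text \<open>Omega is a finite type 'a, q = CARD('a). An assignment sigma in Omega^k is an
  extensional function nat => 'a on the index set {..<k}; coordinate i of the paper
  (1 <= i <= k) is the value at i - 1. A constraint function psi : Omega^k -> [0,1] is
  a function (nat => 'a) => real of which only the values on Omega^k matter.
  The distribution P on Psi is a pmf with support Psi = set_pmf P.\<close>

definition Sig :: "nat \<Rightarrow> (nat \<Rightarrow> 'a::finite) set" where
  "Sig k = PiE {..<k} (\<lambda>_. UNIV)"

definition perm_con :: "nat \<Rightarrow> (nat \<Rightarrow> nat) \<Rightarrow> ((nat \<Rightarrow> 'a::finite) \<Rightarrow> real) \<Rightarrow> ((nat \<Rightarrow> 'a) \<Rightarrow> real)" where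
  "perm_con k \<theta> \<psi> = (\<lambda>\<sigma>. if \<sigma> \<in> Sig k then \<psi> (\<sigma> \<circ> \<theta>) else \<psi> \<sigma>)"

definition xi :: "nat \<Rightarrow> ((nat \<Rightarrow> 'a::finite) \<Rightarrow> real) pmf \<Rightarrow> real" where
  "xi k P = (1 / real CARD('a) ^ k) *
     (\<Sum>\<sigma>\<in>Sig k. measure_pmf.expectation P (\<lambda>\<psi>. \<psi> \<sigma>))"

definition SYM :: "nat \<Rightarrow> ((nat \<Rightarrow> 'a::finite) \<Rightarrow> real) pmf \<Rightarrow> bool" where
  "SYM k P \<longleftrightarrow>
     (\<forall>i<k. \<forall>\<omega>::'a. \<forall>\<psi>\<in>set_pmf P.
        (\<Sum>\<tau>\<in>Sig k. if \<tau> i = \<omega> then \<psi> \<tau> else 0) = real CARD('a) ^ (k - 1) * xi k P) \<and>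
     (\<forall>\<theta>. \<theta> permutes {..<k} \<longrightarrow> (\<forall>\<psi>\<in>set_pmf P. pmf P \<psi> = pmf P (perm_con k \<theta> \<psi>)))"

definition prob_simplex :: "('a::finite \<Rightarrow> real) set" where
  "prob_simplex = {\<mu>. (\<forall>\<omega>. 0 \<le> \<mu> \<omega>) \<and> sum \<mu> UNIV = 1}"

definition phi :: "nat \<Rightarrow> ((nat \<Rightarrow> 'a::finite) \<Rightarrow> real) pmf \<Rightarrow> ('a \<Rightarrow> real) \<Rightarrow> real" where
  "phi k P \<mu> = (\<Sum>\<tau>\<in>Sig k. measure_pmf.expectation P (\<lambda>\<psi>. \<psi> \<tau>) * (\<Prod>i<k. \<mu> (\<tau> i)))"

text \<open>Concavity on the prob_simplex (the unfolding of concave_on, written out since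
  'a => real carries no real_vector instance).\<close>
definition BAL :: "nat \<Rightarrow> ((nat \<Rightarrow> 'a::finite) \<Rightarrow> real) pmf \<Rightarrow> bool" where
  "BAL k P \<longleftrightarrow>
     (\<forall>\<mu>\<in>prob_simplex. \<forall>\<nu>\<in>prob_simplex. \<forall>t::real. 0 \<le> t \<and> t \<le> 1 \<longrightarrow>
        t * phi k P \<mu> + (1 - t) * phi k P \<nu> \<le> phi k P (\<lambda>\<omega>. t * \<mu> \<omega> + (1 - t) * \<nu> \<omega>)) \<and>
     (\<forall>\<mu>\<in>prob_simplex. phi k P \<mu> \<le> phi k P (\<lambda>_. 1 / real CARD('a)))"

definition Phi :: "nat \<Rightarrow> ((nat \<Rightarrow> 'a::finite) \<Rightarrow> real) pmf \<Rightarrow> ((nat \<Rightarrow> 'a) \<Rightarrow> real) \<Rightarrow> 'a \<Rightarrow> 'a \<Rightarrow> real" where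
  "Phi k P \<psi> \<omega> \<omega>' = (1 / real CARD('a) ^ (k - 1)) / xi k P *
     (\<Sum>\<tau>\<in>Sig k. if \<tau> 0 = \<omega> \<and> \<tau> 1 = \<omega>' then \<psi> \<tau> else 0)"

text \<open>Xi = E[Phi_psi (x) Phi_psi] as a matrix indexed by Omega x Omega (Kronecker product).\<close>
definition Xi :: "nat \<Rightarrow> ((nat \<Rightarrow> 'a::finite) \<Rightarrow> real) pmf \<Rightarrow> ('a \<times> 'a) \<Rightarrow> ('a \<times> 'a) \<Rightarrow> real" where
  "Xi k P = (\<lambda>(a, b) (c, d). measure_pmf.expectation P (\<lambda>\<psi>. Phi k P \<psi> a c * Phi k P \<psi> b d))"

definition inner_t :: "('a::finite \<times> 'a \<Rightarrow> real) \<Rightarrow> ('a \<times> 'a \<Rightarrow> real) \<Rightarrow> real" where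
  "inner_t z w = (\<Sum>p\<in>UNIV. z p * w p)"

definition norm_t :: "('a::finite \<times> 'a \<Rightarrow> real) \<Rightarrow> real" where
  "norm_t z = sqrt (inner_t z z)"

definition apply_Xi :: "nat \<Rightarrow> ((nat \<Rightarrow> 'a::finite) \<Rightarrow> real) pmf \<Rightarrow> ('a \<times> 'a \<Rightarrow> real) \<Rightarrow> ('a \<times> 'a \<Rightarrow> real)" where
  "apply_Xi k P x = (\<lambda>p. \<Sum>p'\<in>UNIV. Xi k P p p' * x p')"

definition tensor :: "('a::finite \<Rightarrow> real) \<Rightarrow> ('a \<Rightarrow> real) \<Rightarrow> ('a \<times> 'a \<Rightarrow> real)" where
  "tensor u v = (\<lambda>(a, b). u a * v b)"

definition Espace :: "('a::finite \<times> 'a \<Rightarrow> real) set" where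
  "Espace = {z. \<forall>y. inner_t z (tensor (\<lambda>_. 1) y) = 0 \<and> inner_t z (tensor y (\<lambda>_. 1)) = 0}"

text \<open>The maximum over the (compact) unit sphere of Espace, written as a supremum.\<close>
definition d_KS :: "nat \<Rightarrow> ((nat \<Rightarrow> 'a::finite) \<Rightarrow> real) pmf \<Rightarrow> ereal" where
  "d_KS k P =
     (let M = Sup {inner_t (apply_Xi k P x) x | x. x \<in> (Espace :: ('a \<times> 'a \<Rightarrow> real) set) \<and> norm_t x = 1}
      in if M = 0 then \<infinity> else ereal (1 / ((real k - 1) * M)))"

definition Lam :: "real \<Rightarrow> real" where
  "Lam x = (if x = 0 then 0 else x * ln x)"

definition P2star :: "('a::finite \<Rightarrow> real) measure set" where
  "P2star = {\<pi>. prob_space \<pi> \<and>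
      sets \<pi> = sets (restrict_space (\<Pi>\<^sub>M \<omega>\<in>UNIV. (borel :: real measure)) prob_simplex) \<and>
      space \<pi> = prob_simplex \<and>
      (\<forall>\<omega>. (\<integral>\<mu>. \<mu> \<omega> \<partial>\<pi>) = 1 / real CARD('a))}"

text \<open>The joint law of gamma ~ Po(d), (psi_i)_i iid from P, (rho_i)_i iid from pi, independent.
  Sequences are indexed by nat; the paper's indices start at 1 (index 0 is unused).\<close>
definition joint :: "real \<Rightarrow> ((nat \<Rightarrow> 'a::finite) \<Rightarrow> real) pmf \<Rightarrow> ('a \<Rightarrow> real) measure
      \<Rightarrow> (nat \<times> (nat \<Rightarrow> (nat \<Rightarrow> 'a) \<Rightarrow> real) \<times> (nat \<Rightarrow> 'a \<Rightarrow> real)) measure" where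
  "joint d P \<pi> = measure_pmf (poisson_pmf d) \<Otimes>\<^sub>M
      ((\<Pi>\<^sub>M i\<in>UNIV. measure_pmf P) \<Otimes>\<^sub>M (\<Pi>\<^sub>M i\<in>UNIV. \<pi>))"

definition Bfun :: "nat \<Rightarrow> real \<Rightarrow> ((nat \<Rightarrow> 'a::finite) \<Rightarrow> real) pmf \<Rightarrow> ('a \<Rightarrow> real) measure \<Rightarrow> real" where
  "Bfun k d P \<pi> =
     (\<integral>(\<gamma>, \<psi>s, \<rho>s).
        (1 / real CARD('a)) * (1 / xi k P ^ \<gamma>) *
          Lam (\<Sum>\<sigma>\<in>(UNIV :: 'a set). \<Prod>i\<in>{1..\<gamma>}.
                 \<Sum>\<tau>\<in>Sig k. (if \<tau> (k - 1) = \<sigma> then \<psi>s i \<tau> else 0) *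
                    (\<Prod>j\<in>{1..k - 1}. \<rho>s (k * i + j) (\<tau> (j - 1))))
        - (d * (real k - 1) / (real k * xi k P)) *
          Lam (\<Sum>\<tau>\<in>Sig k. \<psi>s 1 \<tau> * (\<Prod>j\<in>{1..k}. \<rho>s j (\<tau> (j - 1))))
      \<partial>joint d P \<pi>)"

definition d_cond :: "nat \<Rightarrow> ((nat \<Rightarrow> 'a::finite) \<Rightarrow> real) pmf \<Rightarrow> ereal" where
  "d_cond k P = Inf (ereal ` {d. 0 < d \<and>
      (SUP \<pi>\<in>(P2star :: ('a \<Rightarrow> real) measure set). ereal (Bfun k d P \<pi>))
        > ereal (ln (real CARD('a)) + d / real k * ln (xi k P))})"

end

theory Submission
  imports Defs
begin

text \<open>Perturb the uniform atom: let \<open>\<pi>\<close> be the law of \<open>(1 + e X) / q\<close> for a centred, finitely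
  supported random vector \<open>X\<close> with coordinate sum \<open>0\<close> and covariance \<open>z\<close>. The constraint SYM makes
  all first-order terms vanish, and as \<open>e\<close> tends to \<open>0\<close> the Bethe functional exceeds
  \<open>ln q + d/k ln \<xi>\<close> by \<open>e^4 d (k-1) / (4 q^2) * (d (k-1) |\<Xi> z|^2 - <\<Xi> z, z>)\<close> to leading order.
  Covariances are positive semidefinite, whereas the maximiser of the Rayleigh quotient on \<open>\<E>\<close> need
  not be. Instead of an eigenvector take \<open>z = \<Xi>^n Z\<close> with \<open>Z\<close> the centering projection: if the
  bracket were nonpositive for every \<open>n\<close>, then \<open>|\<Xi>^n Z|\<close> would decay like \<open>(d (k-1))^(-n)\<close>. As
  \<open>\<Xi>\<close> is completely positive, \<open>\<Xi>^n Z\<close> dominates \<open>\<Xi>^n x\<close> for every unit vector \<open>x\<close> of \<open>\<E>\<close>, so this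
  forces \<open>d (k-1) <\<Xi> x, x> \<le> 1\<close>.\<close>

section \<open>The operator Xi and positivity\<close>

text \<open>\<open>Lam\<close> is only ever compared with its second-order Taylor polynomial, which
  after normalisation collapses to (x^2 - 1)/2. The bound therefore needs just first and second
  moments, and those factor exactly over independent edges. This suffices because the normalised
  arguments of \<open>Lam\<close> deviate from 1 by order e^2 and not e: cubic remainders are then
  of order e^6 and lose against a gain of order e^4. The obstacle is the unbounded degree. For a
  large degree the vertex value is not near 1, so the lower bound on x ln x has to hold on the whole
  half-line, and its remainder grows geometrically in the degree, which a Poisson average absorbs.
  If \<Xi> z = \<lambda> z, the bracket equals \<lambda> (d (k-1) \<lambda> - 1) |z|^2, whence the
  threshold. The iterates of Z replace the eigenvector because applying the matrix of a fresh random
  constraint to a random vector applies \<Xi> to its covariance; this realises every \<Xi>^n Z up to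
  a factor 1/q, and the bracket is homogeneous in z.\<close>

lemma sum_UNIV_prod:
  fixes f :: "'a::finite \<times> 'a \<Rightarrow> real"
  shows "(\<Sum>p\<in>UNIV. f p) = (\<Sum>a\<in>UNIV. \<Sum>b\<in>UNIV. f (a, b))"
  by (simp add: sum.cartesian_product flip: UNIV_Times_UNIV)

lemma sum_swap_pairs:
  fixes f :: "'a::finite \<Rightarrow> 'a \<Rightarrow> 'a \<Rightarrow> 'a \<Rightarrow> real"
  shows "(\<Sum>a\<in>UNIV. \<Sum>b\<in>UNIV. \<Sum>c\<in>UNIV. \<Sum>d\<in>UNIV. f a b c d) =
    (\<Sum>c\<in>UNIV. \<Sum>d\<in>UNIV. \<Sum>a\<in>UNIV. \<Sum>b\<in>UNIV. f a b c d)"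
proof -
  have "(\<Sum>p\<in>UNIV. \<Sum>r\<in>UNIV. f (fst p) (snd p) (fst r) (snd r)) =
      (\<Sum>r\<in>UNIV. \<Sum>p\<in>UNIV. f (fst p) (snd p) (fst r) (snd r))"
    by (rule sum.swap)
  then show ?thesis by (simp add: sum_UNIV_prod)
qed

section \<open>Inner product and rank-one tensors on pairs\<close>

lemma inner_t_nonneg: "0 \<le> inner_t x x"
  unfolding inner_t_def by (auto intro: sum_nonneg)

lemma norm_t_nonneg: "0 \<le> norm_t x"
  unfolding norm_t_def by (simp add: inner_t_nonneg)

lemma norm_t_sq: "(norm_t x)\<^sup>2 = inner_t x x"
  unfolding norm_t_def by (simp add: inner_t_nonneg)

lemma inner_t_commute: "inner_t x y = inner_t y x"
  unfolding inner_t_def by (simp add: mult.commute)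

lemma inner_t_Cauchy_Schwarz: "inner_t x y \<le> norm_t x * norm_t y"
proof -
  have "\<bar>inner_t x y\<bar> \<le> (\<Sum>p\<in>UNIV. \<bar>x p\<bar> * \<bar>y p\<bar>)"
    unfolding inner_t_def by (rule order_trans[OF sum_abs]) (simp add: abs_mult)
  also have "\<dots> \<le> L2_set x UNIV * L2_set y UNIV" by (rule L2_set_mult_ineq)
  finally show ?thesis
    by (simp add: norm_t_def inner_t_def L2_set_def power2_eq_square)
qed

lemma abs_le_norm_t: "\<bar>x p\<bar> \<le> norm_t x"
proof -
  have "(x p)\<^sup>2 \<le> (\<Sum>p\<in>UNIV. (x p)\<^sup>2)" by (rule member_le_sum) auto
  then show ?thesis
    unfolding norm_t_def inner_t_def by (simp add: real_le_rsqrt power2_eq_square[symmetric])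
qed

lemma inner_t_tensor:
  "inner_t x (tensor u v) = (\<Sum>a\<in>UNIV. \<Sum>b\<in>UNIV. x (a, b) * (u a * v b))"
  unfolding inner_t_def sum_UNIV_prod tensor_def by simp

lemma inner_t_tensor_diff_left:
  "inner_t x (tensor (\<lambda>a. u a - u' a) v) = inner_t x (tensor u v) - inner_t x (tensor u' v)"
  unfolding inner_t_tensor by (simp add: algebra_simps sum_subtractf)

lemma inner_t_tensor_diff_right:
  "inner_t x (tensor u (\<lambda>a. v a - v' a)) = inner_t x (tensor u v) - inner_t x (tensor u v')"
  unfolding inner_t_tensor by (simp add: algebra_simps sum_subtractf)

lemma inner_t_tensor_scale:
  "inner_t x (tensor (\<lambda>a. c * u a) (\<lambda>b. c' * v b)) = c * c' * inner_t x (tensor u v)"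
  unfolding inner_t_tensor sum_distrib_left by (intro sum.cong refl) (simp add: algebra_simps)

lemma norm_t_tensor: "norm_t (tensor u v) = sqrt (\<Sum>a\<in>UNIV. (u a)\<^sup>2) * sqrt (\<Sum>b\<in>UNIV. (v b)\<^sup>2)"
  unfolding norm_t_def inner_t_def sum_UNIV_prod tensor_def
  by (simp add: real_sqrt_mult[symmetric] sum_product power2_eq_square algebra_simps)

section \<open>The centering matrix and its domination of the unit vectors of E\<close>

definition unit_vec :: "'a \<Rightarrow> 'a \<Rightarrow> real" where "unit_vec a b = (if a = b then 1 else 0)"

lemma inner_t_unit_vec: "inner_t x (tensor (unit_vec a) (unit_vec b)) = x (a, b)"
  unfolding inner_t_tensor unit_vec_def
  by (simp add: if_distrib[where f = "\<lambda>y. _ * y"] if_distrib[where f = "\<lambda>y. y * _"] sum.delta cong: if_cong)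

definition centering :: "'a::finite \<times> 'a \<Rightarrow> real" where
  "centering = (\<lambda>(a, b). (if a = b then 1 else 0) - 1 / real CARD('a))"

lemma sum_centering [simp]:
  "(\<Sum>b\<in>UNIV. centering (a::'a::finite, b)) = 0" "(\<Sum>a\<in>UNIV. centering (a, b::'a::finite)) = 0"
  by (simp_all add: centering_def sum_subtractf)

lemma centering_Espace: "centering \<in> Espace"
  unfolding Espace_def mem_Collect_eq
proof (intro allI conjI)
  fix y :: "'a \<Rightarrow> real"
  have "inner_t centering (tensor (\<lambda>_. 1) y) = (\<Sum>b\<in>UNIV. y b * (\<Sum>a\<in>UNIV. centering (a, b)))"
    unfolding inner_t_tensor sum_distrib_left by (subst sum.swap) (simp add: mult.commute)
  then show "inner_t centering (tensor (\<lambda>_. 1) y) = 0" by simp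
  have "inner_t centering (tensor y (\<lambda>_. 1)) = (\<Sum>a\<in>UNIV. y a * (\<Sum>b\<in>UNIV. centering (a, b)))"
    unfolding inner_t_tensor sum_distrib_left by (simp add: mult.commute)
  then show "inner_t centering (tensor y (\<lambda>_. 1)) = 0" by simp
qed

text \<open>The quadratic form of an orthogonal projection is the squared length of the projected
  vector. Positivity enters the development through this identity.\<close>

lemma inner_t_centering:
  fixes u :: "'a::finite \<Rightarrow> real"
  shows "inner_t centering (tensor u u) = (\<Sum>a\<in>UNIV. (u a - (\<Sum>b\<in>UNIV. u b) / real CARD('a))\<^sup>2)"
proof -
  let ?q = "real CARD('a)" and ?s = "\<Sum>b\<in>UNIV. u b"
  have "inner_t centering (tensor u u) =
      (\<Sum>a\<in>UNIV. \<Sum>b\<in>UNIV. (if a = b then u a * u b else 0) - u a * u b / ?q)"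
    unfolding inner_t_tensor centering_def by (intro sum.cong refl) (simp add: algebra_simps)
  also have "\<dots> = (\<Sum>a\<in>UNIV. (u a)\<^sup>2) - ?s * ?s / ?q"
    by (simp add: sum_subtractf power2_eq_square sum_product flip: sum_divide_distrib)
  also have "\<dots> = (\<Sum>a\<in>UNIV. (u a - ?s / ?q)\<^sup>2)"
    by (simp add: power2_diff sum.distrib sum_subtractf flip: sum_distrib_left sum_distrib_right)
       (simp add: power2_eq_square field_simps flip: sum_distrib_left sum_distrib_right sum_divide_distrib)
  finally show ?thesis .
qed

lemma norm_centering_pos:
  assumes "CARD('a) \<ge> 2"
  shows "0 < norm_t (centering :: 'a::finite \<times> 'a \<Rightarrow> real)"
proof -
  obtain a :: 'a where True by simp
  have "centering (a, a) \<noteq> (0::real)" using assms by (auto simp: centering_def)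
  then show ?thesis using abs_le_norm_t[of centering "(a,a)"] by linarith
qed

text \<open>Stated with the quadratic forms of rank-one tensors because this form of domination is visibly
  preserved by \<open>\<Xi>\<close>, which needs no spectral theory.\<close>
lemma Espace_dominated:
  fixes x :: "'a::finite \<times> 'a \<Rightarrow> real"
  assumes x: "x \<in> Espace" and n: "norm_t x = 1"
  shows "2 * inner_t x (tensor u v) \<le> inner_t centering (tensor u u) + inner_t centering (tensor v v)"
proof -
  define cu where "cu = (\<lambda>a. u a - (\<Sum>b\<in>UNIV. u b) / real CARD('a))"
  define cv where "cv = (\<lambda>a. v a - (\<Sum>b\<in>UNIV. v b) / real CARD('a))"
  have E: "inner_t x (tensor (\<lambda>_. c) y) = 0" "inner_t x (tensor y (\<lambda>_. c)) = 0" for c y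
    using x inner_t_tensor_scale[of x c "\<lambda>_. 1" 1 y] inner_t_tensor_scale[of x 1 y c "\<lambda>_. 1"]
    by (auto simp: Espace_def)
  \<comment> \<open>Since \<open>x\<close> annihilates every tensor with a constant factor,
    \<open>u\<close> and \<open>v\<close> may be centred before Cauchy-Schwarz; without this the
    bound would involve the identity matrix instead of \<open>centering\<close>.\<close>
  have "inner_t x (tensor u v) = inner_t x (tensor cu cv)"
    unfolding cu_def cv_def inner_t_tensor_diff_left inner_t_tensor_diff_right E by simp
  also have "\<dots> \<le> norm_t (tensor cu cv)" using inner_t_Cauchy_Schwarz[of x "tensor cu cv"] n by simp
  also have "\<dots> = sqrt (\<Sum>a\<in>UNIV. (cu a)\<^sup>2) * sqrt (\<Sum>b\<in>UNIV. (cv b)\<^sup>2)" by (rule norm_t_tensor)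
  finally have "2 * inner_t x (tensor u v) \<le> 2 * (sqrt (\<Sum>a\<in>UNIV. (cu a)\<^sup>2) * sqrt (\<Sum>b\<in>UNIV. (cv b)\<^sup>2))"
    by simp
  also have "\<dots> \<le> (sqrt (\<Sum>a\<in>UNIV. (cu a)\<^sup>2))\<^sup>2 + (sqrt (\<Sum>b\<in>UNIV. (cv b)\<^sup>2))\<^sup>2"
    using sum_squares_bound[of "sqrt (\<Sum>a\<in>UNIV. (cu a)\<^sup>2)" "sqrt (\<Sum>b\<in>UNIV. (cv b)\<^sup>2)"] by simp
  also have "\<dots> = inner_t centering (tensor u u) + inner_t centering (tensor v v)"
    unfolding inner_t_centering by (simp add: sum_nonneg cu_def cv_def)
  finally show ?thesis .
qed

section \<open>Assignments and permutations of coordinates\<close>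

lemma finite_Sig [simp]: "finite (Sig k)"
  unfolding Sig_def by (intro finite_PiE) auto

lemma card_Sig: "card (Sig k :: (nat \<Rightarrow> 'a::finite) set) = CARD('a) ^ k"
  unfolding Sig_def by (simp add: card_PiE)

lemma Sig_comp_permutes:
  assumes "\<theta> permutes {..<k}" "\<sigma> \<in> Sig k"
  shows "\<sigma> \<circ> \<theta> \<in> Sig k"
  using assms unfolding Sig_def
  by (auto simp: PiE_def extensional_def permutes_not_in)

lemma bij_betw_Sig_comp:
  assumes t: "\<theta> permutes {..<k}"
  shows "bij_betw (\<lambda>\<sigma>. \<sigma> \<circ> \<theta>) (Sig k) (Sig k)"
  by (rule bij_betw_byWitness[where f' = "\<lambda>\<sigma>. \<sigma> \<circ> inv \<theta>"])
    (auto simp: Sig_comp_permutes t permutes_inv o_assoc[symmetric] permutes_inv_o[OF t])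

text \<open>Composition with \<open>inv \<theta>\<close> recovers the values on
  \<open>Sig k\<close>, and off \<open>Sig k\<close> nothing was changed. So no two constraints are
  merged, although they are functions on all of \<open>nat \<Rightarrow> 'a\<close>, and the action
  on the finite support is a bijection.\<close>

lemma inj_perm_con:
  assumes t: "\<theta> permutes {..<k}"
  shows "inj (perm_con k \<theta>)"
proof (rule injI, rule ext)
  fix \<psi> \<psi>' :: "(nat \<Rightarrow> 'a) \<Rightarrow> real" and \<sigma>
  assume e: "perm_con k \<theta> \<psi> = perm_con k \<theta> \<psi>'"
  show "\<psi> \<sigma> = \<psi>' \<sigma>"
  proof (cases "\<sigma> \<in> Sig k")
    case True
    then have "\<sigma> \<circ> inv \<theta> \<in> Sig k" by (simp add: Sig_comp_permutes t permutes_inv)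
    with fun_cong[OF e, of "\<sigma> \<circ> inv \<theta>"] show ?thesis
      by (simp add: perm_con_def o_assoc[symmetric] permutes_inv_o[OF t])
  next
    case False
    with fun_cong[OF e, of \<sigma>] show ?thesis by (simp add: perm_con_def)
  qed
qed

lemma sum_sigma_indicator:
  fixes g :: "'b::finite \<Rightarrow> real"
  shows "(\<Sum>a\<in>UNIV. (if x = a then c else 0) * g a) = c * g x"
proof -
  have "(\<Sum>a\<in>UNIV. (if x = a then c else 0) * g a) = (\<Sum>a\<in>UNIV. if x = a then c * g a else 0)"
    by (intro sum.cong) auto
  then show ?thesis by simp
qed

text \<open>\<open>xi_pos\<close> stands in for the non-constancy of the constraints: without it,
  SYM would force all of them to vanish on \<open>Sig k\<close>.\<close>

locale sym_model =
  fixes P :: "((nat \<Rightarrow> 'a::finite) \<Rightarrow> real) pmf" and k :: nat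
  assumes k2: "k \<ge> 2"
    and fin: "finite (set_pmf P)"
    and range01: "\<And>\<psi> \<sigma>. \<psi> \<in> set_pmf P \<Longrightarrow> \<sigma> \<in> Sig k \<Longrightarrow> 0 \<le> \<psi> \<sigma> \<and> \<psi> \<sigma> \<le> 1"
    and perm_closed: "\<And>\<psi> \<theta>. \<psi> \<in> set_pmf P \<Longrightarrow> \<theta> permutes {..<k} \<Longrightarrow> perm_con k \<theta> \<psi> \<in> set_pmf P"
    and sym: "SYM k P"
    and xi_pos: "0 < xi k P"
begin

text \<open>A finite sum in place of an integral, so that exchanging it with sums over assignments
  needs no integrability.\<close>

abbreviation EP :: "(((nat \<Rightarrow> 'a) \<Rightarrow> real) \<Rightarrow> real) \<Rightarrow> real" where
  "EP f \<equiv> (\<Sum>\<psi>\<in>set_pmf P. pmf P \<psi> * f \<psi>)"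

lemma expectation_P: "measure_pmf.expectation P f = EP f"
  using fin by (subst integral_measure_pmf_real[where A = "set_pmf P"]) (auto simp: mult.commute)

lemma EP_const: "EP (\<lambda>_. c) = c"
  using fin by (simp add: sum_pmf_eq_1 flip: sum_distrib_right)

text \<open>The action is a bijection of the support and SYM makes it preserve the weights, so
  coordinates may be relabelled inside any expectation.\<close>

lemma EP_perm:
  assumes t: "\<theta> permutes {..<k}"
  shows "EP (\<lambda>\<psi>. f (perm_con k \<theta> \<psi>)) = EP f"
proof -
  have inj: "inj_on (perm_con k \<theta>) (set_pmf P)" using inj_perm_con[OF t] by (rule inj_on_subset) simp
  have im: "perm_con k \<theta> ` set_pmf P = set_pmf P"
    using fin inj perm_closed[OF _ t] by (intro endo_inj_surj) auto
  have "EP f = (\<Sum>\<psi>\<in>perm_con k \<theta> ` set_pmf P. pmf P \<psi> * f \<psi>)" by (simp add: im)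
  also have "\<dots> = (\<Sum>\<psi>\<in>set_pmf P. pmf P (perm_con k \<theta> \<psi>) * f (perm_con k \<theta> \<psi>))"
    by (simp add: sum.reindex[OF inj])
  also have "\<dots> = EP (\<lambda>\<psi>. f (perm_con k \<theta> \<psi>))"
    using sym t unfolding SYM_def by (intro sum.cong refl) auto
  finally show ?thesis by simp
qed

lemma sum_perm_con:
  assumes t: "\<theta> permutes {..<k}"
  shows "(\<Sum>\<tau>\<in>Sig k. perm_con k \<theta> \<psi> \<tau> * g \<tau>) = (\<Sum>\<tau>\<in>Sig k. \<psi> \<tau> * g (\<tau> \<circ> inv \<theta>))"
proof -
  have "(\<Sum>\<tau>\<in>Sig k. perm_con k \<theta> \<psi> \<tau> * g \<tau>) = (\<Sum>\<tau>\<in>Sig k. \<psi> (\<tau> \<circ> \<theta>) * g ((\<tau> \<circ> \<theta>) \<circ> inv \<theta>))"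
    by (intro sum.cong refl) (simp add: perm_con_def o_assoc[symmetric] permutes_inv_o[OF t])
  also have "\<dots> = (\<Sum>\<tau>\<in>Sig k. \<psi> \<tau> * g (\<tau> \<circ> inv \<theta>))"
    by (rule sum.reindex_bij_betw[OF bij_betw_Sig_comp[OF t], of "\<lambda>\<tau>. \<psi> \<tau> * g (\<tau> \<circ> inv \<theta>)"])
  finally show ?thesis .
qed

lemma Phi_eq: "Phi k P \<psi> a c = (\<Sum>\<tau>\<in>Sig k. \<psi> \<tau> * (if \<tau> 0 = a \<and> \<tau> 1 = c then 1 else 0)) / (real CARD('a) ^ (k - 1) * xi k P)"
  unfolding Phi_def by (simp add: sum_divide_distrib sum_distrib_left) (intro sum.cong, auto simp: field_simps)

lemma Phi_transpose: "Phi k P (perm_con k (Transposition.transpose 0 1) \<psi>) a c = Phi k P \<psi> c a"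
proof -
  have t: "Transposition.transpose 0 1 permutes {..<k}" using k2 by (intro permutes_swap_id) auto
  show ?thesis unfolding Phi_eq sum_perm_con[OF t]
    by (intro arg_cong[where f = "\<lambda>x. x / _"] sum.cong refl) (auto simp: inv_transpose_eq)
qed

lemma sym_marginal:
  assumes "i < k" "\<psi> \<in> set_pmf P"
  shows "(\<Sum>\<tau>\<in>Sig k. \<psi> \<tau> * (if \<tau> i = \<omega> then 1 else 0)) = real CARD('a) ^ (k - 1) * xi k P"
proof -
  have "(\<Sum>\<tau>\<in>Sig k. if \<tau> i = \<omega> then \<psi> \<tau> else 0) = real CARD('a) ^ (k - 1) * xi k P"
    using sym assms unfolding SYM_def by blast
  then show ?thesis by (simp add: if_distrib cong: if_cong)
qed

text \<open>By SYM each coordinate of a weighted assignment is uniform. Hence a function of one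
  coordinate with sum 0 has weighted sum 0: this is the mechanism behind all cancellations of
  first-order terms.\<close>

lemma one_coordinate:
  assumes i: "i < k" and p: "\<psi> \<in> set_pmf P"
  shows "(\<Sum>\<tau>\<in>Sig k. \<psi> \<tau> * f (\<tau> i)) = real CARD('a) ^ (k - 1) * xi k P * (\<Sum>a\<in>UNIV. f a)"
proof -
  have "(\<Sum>\<tau>\<in>Sig k. \<psi> \<tau> * f (\<tau> i)) =
      (\<Sum>\<tau>\<in>Sig k. \<Sum>a\<in>UNIV. \<psi> \<tau> * (if \<tau> i = a then 1 else 0) * f a)"
    by (intro sum.cong refl) (simp add: sum_sigma_indicator mult.assoc flip: sum_distrib_left)
  also have "\<dots> = (\<Sum>a\<in>UNIV. (\<Sum>\<tau>\<in>Sig k. \<psi> \<tau> * (if \<tau> i = a then 1 else 0)) * f a)"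
    by (subst sum.swap) (simp add: sum_distrib_right)
  finally show ?thesis unfolding sym_marginal[OF i p] by (simp add: sum_distrib_left)
qed

text \<open>Keeps the coordinate sum of a vector unchanged under \<open>spread\<close>, so that
  perturbations stay tangent to the simplex.\<close>

lemma Phi_column_sum:
  assumes p: "\<psi> \<in> set_pmf P"
  shows "(\<Sum>a\<in>UNIV. Phi k P \<psi> a c) = 1"
proof -
  have "(\<Sum>a\<in>UNIV. Phi k P \<psi> a c) =
      (\<Sum>a\<in>UNIV. \<Sum>\<tau>\<in>Sig k. \<psi> \<tau> * (if \<tau> 0 = a \<and> \<tau> 1 = c then 1 else 0)) / (real CARD('a) ^ (k - 1) * xi k P)"
    unfolding Phi_eq sum_divide_distrib ..
  also have "(\<Sum>a\<in>UNIV. \<Sum>\<tau>\<in>Sig k. \<psi> \<tau> * (if \<tau> 0 = a \<and> \<tau> 1 = c then 1 else 0)) =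
      (\<Sum>\<tau>\<in>Sig k. \<psi> \<tau> * (\<Sum>a\<in>UNIV. if \<tau> 0 = a \<and> \<tau> 1 = c then 1 else 0))"
    unfolding sum_distrib_left by (rule sum.swap)
  also have "\<dots> = (\<Sum>\<tau>\<in>Sig k. \<psi> \<tau> * (if \<tau> 1 = c then 1 else 0))"
    by (intro sum.cong refl) auto
  also have "\<dots> = real CARD('a) ^ (k - 1) * xi k P" using k2 p by (intro sym_marginal) auto
  finally show ?thesis using xi_pos by simp
qed

lemma Xi_eq: "Xi k P (a, b) (c, d) = EP (\<lambda>\<psi>. Phi k P \<psi> a c * Phi k P \<psi> b d)"
  unfolding Xi_def by (simp add: expectation_P)

text \<open>A single matrix \<open>Phi k P \<psi>\<close> need not be symmetric. Swapping the first
  two coordinates transposes it, and P is invariant under the swap.\<close>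

lemma Xi_symmetric: "Xi k P p r = Xi k P r p"
proof -
  have t: "Transposition.transpose 0 1 permutes {..<k}" using k2 by (intro permutes_swap_id) auto
  obtain a b c d where [simp]: "p = (a, b)" "r = (c, d)" by (metis surj_pair)
  show ?thesis
    using EP_perm[OF t, of "\<lambda>\<psi>. Phi k P \<psi> a c * Phi k P \<psi> b d"]
    unfolding Phi_transpose by (simp add: Xi_eq)
qed

lemma apply_Xi_self_adjoint: "inner_t (apply_Xi k P x) y = inner_t x (apply_Xi k P y)"
proof -
  have "inner_t (apply_Xi k P x) y = (\<Sum>p\<in>UNIV. \<Sum>r\<in>UNIV. Xi k P p r * x r * y p)"
    unfolding inner_t_def apply_Xi_def sum_distrib_right ..
  also have "\<dots> = (\<Sum>r\<in>UNIV. \<Sum>p\<in>UNIV. Xi k P p r * x r * y p)" by (rule sum.swap)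
  also have "\<dots> = (\<Sum>r\<in>UNIV. \<Sum>p\<in>UNIV. x r * (Xi k P r p * y p))"
    by (intro sum.cong refl) (simp add: Xi_symmetric)
  also have "\<dots> = inner_t x (apply_Xi k P y)"
    unfolding inner_t_def apply_Xi_def sum_distrib_left ..
  finally show ?thesis .
qed

lemma apply_Xi_eq:
  "apply_Xi k P x (a, b) = EP (\<lambda>\<psi>. \<Sum>c\<in>UNIV. \<Sum>d\<in>UNIV. Phi k P \<psi> a c * Phi k P \<psi> b d * x (c, d))"
proof -
  have "apply_Xi k P x (a, b) = (\<Sum>c\<in>UNIV. \<Sum>d\<in>UNIV. \<Sum>\<psi>\<in>set_pmf P.
      pmf P \<psi> * (Phi k P \<psi> a c * Phi k P \<psi> b d * x (c, d)))"
    unfolding apply_Xi_def sum_UNIV_prod Xi_eq sum_distrib_right by (simp add: mult_ac)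
  also have "\<dots> = (\<Sum>c\<in>UNIV. \<Sum>\<psi>\<in>set_pmf P. \<Sum>d\<in>UNIV.
      pmf P \<psi> * (Phi k P \<psi> a c * Phi k P \<psi> b d * x (c, d)))"
    by (intro sum.cong refl sum.swap)
  also have "\<dots> = (\<Sum>\<psi>\<in>set_pmf P. \<Sum>c\<in>UNIV. \<Sum>d\<in>UNIV.
      pmf P \<psi> * (Phi k P \<psi> a c * Phi k P \<psi> b d * x (c, d)))"
    by (rule sum.swap)
  finally show ?thesis by (simp add: sum_distrib_left)
qed

text \<open>The dual of \<Xi> sends a rank-one tensor to an average of rank-one tensors, with the
  same transposed matrix acting on both factors. This is complete positivity in the form in which it
  is used.\<close>

lemma inner_apply_Xi_tensor:
  "inner_t (apply_Xi k P x) (tensor u v) = EP (\<lambda>\<psi>. inner_t x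
      (tensor (\<lambda>c. \<Sum>a\<in>UNIV. Phi k P \<psi> a c * u a) (\<lambda>d. \<Sum>b\<in>UNIV. Phi k P \<psi> b d * v b)))"
proof -
  have one: "(\<Sum>a\<in>UNIV. \<Sum>b\<in>UNIV. (\<Sum>c\<in>UNIV. \<Sum>d\<in>UNIV. Phi k P \<psi> a c * Phi k P \<psi> b d * x (c, d)) * (u a * v b)) =
      inner_t x (tensor (\<lambda>c. \<Sum>a\<in>UNIV. Phi k P \<psi> a c * u a) (\<lambda>d. \<Sum>b\<in>UNIV. Phi k P \<psi> b d * v b))" for \<psi>
  proof -
    have "inner_t x (tensor (\<lambda>c. \<Sum>a\<in>UNIV. Phi k P \<psi> a c * u a) (\<lambda>d. \<Sum>b\<in>UNIV. Phi k P \<psi> b d * v b)) =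
      (\<Sum>c\<in>UNIV. \<Sum>d\<in>UNIV. \<Sum>a\<in>UNIV. \<Sum>b\<in>UNIV. Phi k P \<psi> a c * Phi k P \<psi> b d * x (c, d) * (u a * v b))"
      unfolding inner_t_tensor sum_product unfolding sum_distrib_left by (intro sum.cong refl) (simp add: mult_ac)
    also have "\<dots> = (\<Sum>a\<in>UNIV. \<Sum>b\<in>UNIV. \<Sum>c\<in>UNIV. \<Sum>d\<in>UNIV. Phi k P \<psi> a c * Phi k P \<psi> b d * x (c, d) * (u a * v b))"
      by (rule sum_swap_pairs)
    finally show ?thesis by (simp add: sum_distrib_right)
  qed
  have "inner_t (apply_Xi k P x) (tensor u v) = (\<Sum>a\<in>UNIV. \<Sum>b\<in>UNIV. \<Sum>\<psi>\<in>set_pmf P.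
      pmf P \<psi> * ((\<Sum>c\<in>UNIV. \<Sum>d\<in>UNIV. Phi k P \<psi> a c * Phi k P \<psi> b d * x (c, d)) * (u a * v b)))"
    unfolding inner_t_tensor apply_Xi_eq by (intro sum.cong refl) (simp only: sum_distrib_left sum_distrib_right mult.assoc)
  also have "\<dots> = (\<Sum>a\<in>UNIV. \<Sum>\<psi>\<in>set_pmf P. \<Sum>b\<in>UNIV.
      pmf P \<psi> * ((\<Sum>c\<in>UNIV. \<Sum>d\<in>UNIV. Phi k P \<psi> a c * Phi k P \<psi> b d * x (c, d)) * (u a * v b)))"
    by (intro sum.cong refl sum.swap)
  also have "\<dots> = (\<Sum>\<psi>\<in>set_pmf P. \<Sum>a\<in>UNIV. \<Sum>b\<in>UNIV.
      pmf P \<psi> * ((\<Sum>c\<in>UNIV. \<Sum>d\<in>UNIV. Phi k P \<psi> a c * Phi k P \<psi> b d * x (c, d)) * (u a * v b)))"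
    by (rule sum.swap)
  also have "\<dots> = EP (\<lambda>\<psi>. \<Sum>a\<in>UNIV. \<Sum>b\<in>UNIV. (\<Sum>c\<in>UNIV. \<Sum>d\<in>UNIV. Phi k P \<psi> a c * Phi k P \<psi> b d * x (c, d)) * (u a * v b))"
    by (simp add: sum_distrib_left)
  finally show ?thesis unfolding one .
qed

text \<open>By duality one application of \<Xi> moves the inequality to transformed vectors
  \<open>u\<close>, \<open>v\<close>, and averages over \<psi> with nonnegative weights. The
  hypothesis must hold for all \<open>u\<close> and \<open>v\<close> because the transformed ones
  are arbitrary.\<close>

lemma domination_iterate:
  assumes "\<And>u v. 2 * inner_t x (tensor u v) \<le> inner_t z (tensor u u) + inner_t z (tensor v v)"
  shows "2 * inner_t ((apply_Xi k P ^^ n) x) (tensor u v) \<le>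
     inner_t ((apply_Xi k P ^^ n) z) (tensor u u) + inner_t ((apply_Xi k P ^^ n) z) (tensor v v)"
proof (induction n arbitrary: u v)
  case 0
  then show ?case using assms by simp
next
  case (Suc n)
  show ?case unfolding funpow.simps o_apply inner_apply_Xi_tensor
    unfolding sum.distrib[symmetric] sum_distrib_left
  proof (rule sum_mono, goal_cases)
    case (1 \<psi>)
    show ?case
      using mult_left_mono[OF Suc[of "\<lambda>c. \<Sum>a\<in>UNIV. Phi k P \<psi> a c * u a" "\<lambda>d. \<Sum>b\<in>UNIV. Phi k P \<psi> b d * v b"]
        pmf_nonneg[of P \<psi>]] by (simp add: algebra_simps)
  qed
qed

lemma iterate_self_adjoint:
  "inner_t ((apply_Xi k P ^^ n) x) y = inner_t x ((apply_Xi k P ^^ n) y)"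
proof (induction n arbitrary: y)
  case (Suc n)
  show ?case unfolding funpow.simps o_apply apply_Xi_self_adjoint Suc by (simp add: funpow_swap1)
qed simp

text \<open>Along powers of two, \<open><\<Xi>^(2n) x, x> = |\<Xi>^n x|^2\<close> is at least \<open><\<Xi>^n x, x>^2\<close>.\<close>
lemma iterate_lower:
  assumes n: "norm_t x = 1" and m: "0 \<le> m" "m \<le> inner_t (apply_Xi k P x) x"
  shows "m ^ (2 ^ j) \<le> inner_t ((apply_Xi k P ^^ (2 ^ j)) x) x"
proof (induction j)
  case 0
  then show ?case using m by simp
next
  case (Suc j)
  let ?y = "(apply_Xi k P ^^ (2 ^ j)) x"
  have "m ^ (2 ^ j) \<le> norm_t ?y" using Suc inner_t_Cauchy_Schwarz[of ?y x] n by simp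
  then have "(m ^ (2 ^ j))\<^sup>2 \<le> (norm_t ?y)\<^sup>2" using m by (intro power_mono) auto
  also have "\<dots> = inner_t ((apply_Xi k P ^^ (2 ^ j)) ?y) x"
    by (simp add: norm_t_sq iterate_self_adjoint inner_t_commute)
  also have "\<dots> = inner_t ((apply_Xi k P ^^ (2 ^ Suc j)) x) x"
    by (simp add: funpow_add mult_2)
  finally show ?case by (simp add: mult.commute flip: power_mult)
qed

lemma exists_good_iterate:
  assumes x: "x \<in> Espace" and n: "norm_t x = 1" and lam: "0 < t" "1 < t * inner_t (apply_Xi k P x) x"
  shows "\<exists>n. inner_t (apply_Xi k P ((apply_Xi k P ^^ n) centering)) ((apply_Xi k P ^^ n) centering) <
    t * (norm_t (apply_Xi k P ((apply_Xi k P ^^ n) centering)))\<^sup>2"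
proof (rule ccontr)
  let ?Z = "\<lambda>n. (apply_Xi k P ^^ n) (centering :: 'a \<times> 'a \<Rightarrow> real)"
  assume "\<not> ?thesis"
  then have le: "t * (norm_t (?Z (Suc n)))\<^sup>2 \<le> inner_t (?Z (Suc n)) (?Z n)" for n
    by (auto simp: not_less)
  \<comment> \<open>The failed inequality compares consecutive iterates, so Cauchy-Schwarz followed
    by division by the norm gives decay with ratio 1/t.\<close>
  have step: "t * norm_t (?Z (Suc n)) \<le> norm_t (?Z n)" for n
  proof (cases "norm_t (?Z (Suc n)) = 0")
    case True
    then show ?thesis by (simp only: mult_zero_right norm_t_nonneg)
  next
    case False
    then have p: "0 < norm_t (?Z (Suc n))" using norm_t_nonneg by (metis less_eq_real_def)
    have "norm_t (?Z (Suc n)) * (t * norm_t (?Z (Suc n))) \<le> norm_t (?Z (Suc n)) * norm_t (?Z n)"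
      using order_trans[OF le[of n] inner_t_Cauchy_Schwarz] by (simp add: power2_eq_square algebra_simps)
    then show ?thesis using p by (simp only: mult_le_cancel_left_pos)
  qed
  have decay: "t ^ n * norm_t (?Z n) \<le> norm_t (?Z 0)" for n
  proof (induction n)
    case (Suc n)
    have "t ^ Suc n * norm_t (?Z (Suc n)) = t ^ n * (t * norm_t (?Z (Suc n)))" by simp
    also have "\<dots> \<le> t ^ n * norm_t (?Z n)" using lam step[of n] by (intro mult_left_mono) auto
    finally show ?case using Suc by linarith
  qed simp
  \<comment> \<open>Testing the domination on unit vectors, with either sign, bounds every entry of
    the iterate of \<open>x\<close> by the mean of two diagonal entries of the iterate of Z.\<close>
  have entry: "\<bar>(apply_Xi k P ^^ n) x (a, b)\<bar> \<le> norm_t (?Z n)" for n a b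
  proof -
    have dom: "2 * inner_t ((apply_Xi k P ^^ n) x) (tensor u v) \<le>
       inner_t (?Z n) (tensor u u) + inner_t (?Z n) (tensor v v)" for u v
      by (rule domination_iterate) (rule Espace_dominated[OF x n])
    have neg: "inner_t w (tensor (\<lambda>c. - unit_vec a c) (unit_vec b)) = - w (a, b)"
      "inner_t w (tensor (\<lambda>c. - unit_vec a c) (\<lambda>c. - unit_vec a c)) = w (a, a)" for w :: "'a \<times> 'a \<Rightarrow> real"
      using inner_t_tensor_scale[of w "-1" "unit_vec a" 1 "unit_vec b"]
        inner_t_tensor_scale[of w "-1" "unit_vec a" "-1" "unit_vec a"]
      by (simp_all add: inner_t_unit_vec)
    have "2 * (apply_Xi k P ^^ n) x (a, b) \<le> ?Z n (a, a) + ?Z n (b, b)"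
      "2 * - ((apply_Xi k P ^^ n) x (a, b)) \<le> ?Z n (a, a) + ?Z n (b, b)"
      using dom[of "unit_vec a" "unit_vec b"] dom[of "\<lambda>c. - unit_vec a c" "unit_vec b"]
      unfolding neg inner_t_unit_vec by auto
    then show ?thesis using abs_le_norm_t[of "?Z n" "(a,a)"] abs_le_norm_t[of "?Z n" "(b,b)"] by linarith
  qed
  let ?m = "inner_t (apply_Xi k P x) x"
  define C where "C = norm_t (?Z 0) * (\<Sum>p\<in>(UNIV :: ('a \<times> 'a) set). 1)"
  have m0: "0 < ?m" using lam by (metis zero_less_mult_pos less_trans zero_less_one)
  have bound: "(t * ?m) ^ (2 ^ j) \<le> C" for j
  proof -
    have "?m ^ (2 ^ j) \<le> inner_t ((apply_Xi k P ^^ (2 ^ j)) x) x"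
      using m0 by (intro iterate_lower n) auto
    also have "\<dots> \<le> (\<Sum>p\<in>(UNIV :: ('a \<times> 'a) set). norm_t (?Z (2 ^ j)) * 1)"
      unfolding inner_t_def
    proof (rule sum_mono)
      fix p :: "'a \<times> 'a"
      have "\<bar>(apply_Xi k P ^^ (2 ^ j)) x p * x p\<bar> \<le> norm_t (?Z (2 ^ j)) * 1"
        unfolding abs_mult using entry[of "2 ^ j" "fst p" "snd p"] abs_le_norm_t[of x p] n
        by (intro mult_mono) (auto simp: norm_t_nonneg)
      then show "(apply_Xi k P ^^ (2 ^ j)) x p * x p \<le> norm_t (?Z (2 ^ j)) * 1" by linarith
    qed
    finally have "(t * ?m) ^ (2 ^ j) \<le> t ^ (2 ^ j) * (\<Sum>p\<in>(UNIV :: ('a \<times> 'a) set). norm_t (?Z (2 ^ j)) * 1)"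
      using lam unfolding power_mult_distrib by (intro mult_left_mono) auto
    also have "\<dots> = (t ^ (2 ^ j) * norm_t (?Z (2 ^ j))) * (\<Sum>p\<in>(UNIV :: ('a \<times> 'a) set). 1)"
      by simp
    also have "\<dots> \<le> C" unfolding C_def by (intro mult_right_mono decay) auto
    finally show ?thesis .
  qed
  \<comment> \<open>The bound is available along powers of two only; since the base exceeds 1 and
    \<open>N \<le> 2 ^ N\<close>, that is enough for a contradiction.\<close>
  obtain N where N: "C < (t * ?m) ^ N" using real_arch_pow[OF lam(2)] by blast
  have "(t * ?m) ^ N \<le> (t * ?m) ^ (2 ^ N)"
    using lam by (intro power_increasing) (auto simp: less_imp_le)
  with N bound[of N] show False by linarith
qed

end

section \<open>Expansion around the uniform distribution\<close>

text \<open>The Lagrange remainder after an odd degree is a nonnegative multiple of an even power,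
  so no assumption on the sign or size of x is needed.\<close>

lemma exp_ge_cubic: "1 + x + x\<^sup>2 / 2 + x ^ 3 / 6 \<le> exp (x::real)"
proof -
  obtain t where "exp x = (\<Sum>m<4. x ^ m / fact m) + exp t / fact 4 * x ^ 4"
    using Maclaurin_exp_le[of x 4] by blast
  moreover have "0 \<le> exp t / fact 4 * x ^ 4" by simp
  ultimately show ?thesis by (simp add: eval_nat_numeral)
qed

lemma nonneg_from_deriv_sign:
  fixes f f' :: "real \<Rightarrow> real"
  assumes x: "0 < x" and d: "\<And>y. 0 < y \<Longrightarrow> (f has_real_derivative f' y) (at y)"
    and one: "f 1 = 0" and up: "\<And>y. 1 \<le> y \<Longrightarrow> 0 \<le> f' y" and dn: "\<And>y. 0 < y \<Longrightarrow> y \<le> 1 \<Longrightarrow> f' y \<le> 0"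
  shows "0 \<le> f x"
proof (cases "1 \<le> x")
  case True
  have "f 1 \<le> f x" using d up by (intro DERIV_nonneg_imp_nondecreasing[OF True]) (meson less_le_trans zero_less_one)
  then show ?thesis using one by simp
next
  case False
  then have "x \<le> 1" by simp
  have "f 1 \<le> f x" using d dn x by (intro DERIV_nonpos_imp_nonincreasing[OF \<open>x \<le> 1\<close>]) (meson less_le_trans)
  then show ?thesis using one by simp
qed

text \<open>The difference of the two sides has derivative (y-1)^2 / y, so it increases through its
  zero at 1 and the inequality changes direction there.\<close>

lemma ln_bounds_from_one:
  fixes x :: real
  assumes "0 < x"
  shows "1 \<le> x \<Longrightarrow> (x - 1) - (x - 1)\<^sup>2 / 2 \<le> ln x"
    and "x \<le> 1 \<Longrightarrow> ln x \<le> (x - 1) - (x - 1)\<^sup>2 / 2"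
proof -
  let ?g = "\<lambda>y::real. ln y - (y - 1) + (y - 1)\<^sup>2 / 2"
  have d: "(?g has_real_derivative (y - 1)\<^sup>2 / y) (at y)" if "0 < y" for y
    using that by (auto intro!: derivative_eq_intros simp: field_simps power2_eq_square)
  have mono: "?g u \<le> ?g v" if "0 < u" "u \<le> v" for u v
  proof (rule DERIV_nonneg_imp_nondecreasing[OF that(2)])
    fix w assume "u \<le> w"
    then have "0 < w" using that by simp
    then show "\<exists>D. (?g has_real_derivative D) (at w) \<and> 0 \<le> D"
      by (intro exI[of _ "(w - 1)\<^sup>2 / w"] conjI d) auto
  qed
  show "1 \<le> x \<Longrightarrow> (x - 1) - (x - 1)\<^sup>2 / 2 \<le> ln x" using mono[of 1 x] by simp
  show "x \<le> 1 \<Longrightarrow> ln x \<le> (x - 1) - (x - 1)\<^sup>2 / 2" using mono[of x 1] assms by simp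
qed

text \<open>The right order of Taylor expansion at 1: the fourth derivative 2/x^3 is positive, so
  the cubic polynomial lies below on the whole half-line. Vertex values of large degree are not
  close to 1 and need this range.\<close>

lemma xlnx_ge_cubic:
  fixes x :: real
  assumes "0 < x"
  shows "(x - 1) + (x - 1)\<^sup>2 / 2 - (x - 1) ^ 3 / 6 \<le> x * ln x"
proof -
  have "0 \<le> x * ln x - (x - 1) - (x - 1)\<^sup>2 / 2 + (x - 1) ^ 3 / 6"
  proof (rule nonneg_from_deriv_sign[OF assms,
        where f = "\<lambda>x. x * ln x - (x - 1) - (x - 1)\<^sup>2 / 2 + (x - 1) ^ 3 / 6"
          and f' = "\<lambda>x. ln x - (x - 1) + (x - 1)\<^sup>2 / 2"])
    show "((\<lambda>x. x * ln x - (x - 1) - (x - 1)\<^sup>2 / 2 + (x - 1) ^ 3 / 6) has_real_derivative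
        ln y - (y - 1) + (y - 1)\<^sup>2 / 2) (at y)" if "0 < y" for y :: real
      using that by (auto intro!: derivative_eq_intros simp: field_simps power2_eq_square)
    show "0 \<le> ln y - (y - 1) + (y - 1)\<^sup>2 / 2" if "1 \<le> y" for y :: real
      using ln_bounds_from_one(1)[of y] that by simp
    show "ln y - (y - 1) + (y - 1)\<^sup>2 / 2 \<le> 0" if "0 < y" "y \<le> 1" for y :: real
      using ln_bounds_from_one(2)[of y] that by simp
  qed simp
  then show ?thesis by simp
qed

text \<open>A bound near 1 is enough here, since it is applied to clause values, whose distance from
  \<xi> does not depend on the degree.\<close>

lemma xlnx_le_cubic:
  fixes x :: real
  assumes "\<bar>x - 1\<bar> \<le> 1/2"
  shows "x * ln x \<le> (x - 1) + (x - 1)\<^sup>2 / 2 + \<bar>x - 1\<bar> ^ 3"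
proof -
  have x: "0 < x" using assms by linarith
  define t where "t = x - 1"
  have "0 \<le> (x - 1) - (x - 1)\<^sup>2 / 2 + (x - 1) ^ 3 / 3 - ln x"
  proof (rule nonneg_from_deriv_sign[OF x,
          where f = "\<lambda>x. (x - 1) - (x - 1)\<^sup>2 / 2 + (x - 1) ^ 3 / 3 - ln x"
            and f' = "\<lambda>x. (x - 1) ^ 3 / x"])
    show "((\<lambda>x. (x - 1) - (x - 1)\<^sup>2 / 2 + (x - 1) ^ 3 / 3 - ln x) has_real_derivative (y - 1) ^ 3 / y) (at y)"
      if "0 < y" for y :: real using that
      by (auto intro!: derivative_eq_intros simp: field_simps power2_eq_square power3_eq_cube)
    show "(y - 1) ^ 3 / y \<le> 0" if "0 < y" "y \<le> 1" for y :: real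
      using that by (intro divide_nonpos_pos) (auto simp: power_le_zero_eq)
  qed auto
  then have "x * ln x \<le> x * ((x - 1) - (x - 1)\<^sup>2 / 2 + (x - 1) ^ 3 / 3)"
    using x by (intro mult_left_mono) auto
  also have "\<dots> = (x - 1) + (x - 1)\<^sup>2 / 2 + t ^ 3 * (t / 3 - 1 / 6)"
    unfolding t_def by (simp add: field_simps power2_eq_square power3_eq_cube)
  also have "t ^ 3 * (t / 3 - 1 / 6) \<le> \<bar>t ^ 3 * (t / 3 - 1 / 6)\<bar>" by simp
  also have "\<dots> \<le> \<bar>t\<bar> ^ 3 * 1"
  proof -
    have "- (1 / 2) \<le> t" "t \<le> 1 / 2" using assms unfolding t_def abs_le_iff by linarith+
    then have "\<bar>t / 3 - 1 / 6\<bar> \<le> 1" unfolding abs_le_iff by linarith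
    then show ?thesis unfolding abs_mult power_abs[symmetric] by (intro mult_left_mono) auto
  qed
  finally show ?thesis unfolding t_def by simp
qed

text \<open>For e in [0,1], convexity gives (1 + c e)^n - 1 \<le> e ((1 + c)^n - 1). The smallness e
  is kept as a separate factor, and the number of factors appears only as an exponent, so that it
  can later be averaged over a Poisson degree.\<close>

lemma abs_prod_minus_one_le:
  fixes y :: "'b \<Rightarrow> real"
  assumes "finite I" "\<And>i. i \<in> I \<Longrightarrow> \<bar>y i\<bar> \<le> c * e" "0 \<le> e" "e \<le> 1" "0 \<le> c"
  shows "\<bar>(\<Prod>i\<in>I. 1 + y i) - 1\<bar> \<le> e * ((1 + c) ^ card I - 1)"
  using assms(1,2)
proof (induction rule: finite_induct)
  case (insert a F)
  let ?p = "\<Prod>i\<in>F. 1 + y i"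
  have "(\<Prod>i\<in>insert a F. 1 + y i) - 1 = (?p - 1) + y a * (?p - 1) + y a"
    using insert by (simp add: algebra_simps)
  also have "\<bar>\<dots>\<bar> \<le> \<bar>?p - 1\<bar> + \<bar>y a\<bar> * \<bar>?p - 1\<bar> + \<bar>y a\<bar>"
    unfolding abs_mult[symmetric] by linarith
  also have "\<dots> \<le> e * ((1 + c) ^ card F - 1) + c * (e * ((1 + c) ^ card F - 1)) + c * e"
  proof (intro add_mono mult_mono)
    show "\<bar>?p - 1\<bar> \<le> e * ((1 + c) ^ card F - 1)" "\<bar>?p - 1\<bar> \<le> e * ((1 + c) ^ card F - 1)"
      using insert by auto
    show "\<bar>y a\<bar> \<le> c * e" using insert by simp
    have "c * e \<le> c * 1" using assms by (intro mult_left_mono) auto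
    then show "\<bar>y a\<bar> \<le> c" using insert.prems[of a] by simp
  qed (use assms in auto)
  also have "\<dots> = e * ((1 + c) ^ card (insert a F) - 1)"
    using insert by (simp add: algebra_simps)
  finally show ?case .
qed simp

lemma abs_prod_minus_linear_le:
  fixes y :: "'b \<Rightarrow> real"
  assumes "finite I" "\<And>i. i \<in> I \<Longrightarrow> \<bar>y i\<bar> \<le> c * e" "0 \<le> e" "e \<le> 1" "0 \<le> c"
  shows "\<bar>(\<Prod>i\<in>I. 1 + y i) - 1 - (\<Sum>i\<in>I. y i)\<bar> \<le> e\<^sup>2 * (1 + c) ^ card I"
  using assms(1,2)
proof (induction rule: finite_induct)
  case (insert a F)
  let ?p = "\<Prod>i\<in>F. 1 + y i"
  have "(\<Prod>i\<in>insert a F. 1 + y i) - 1 - (\<Sum>i\<in>insert a F. y i) = (?p - 1 - (\<Sum>i\<in>F. y i)) + y a * (?p - 1)"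
    using insert by (simp add: algebra_simps)
  also have "\<bar>\<dots>\<bar> \<le> \<bar>?p - 1 - (\<Sum>i\<in>F. y i)\<bar> + \<bar>y a\<bar> * \<bar>?p - 1\<bar>"
    unfolding abs_mult[symmetric] by linarith
  also have "\<dots> \<le> e\<^sup>2 * (1 + c) ^ card F + (c * e) * (e * ((1 + c) ^ card F - 1))"
    using insert abs_prod_minus_one_le[of F y c e] assms
    by (intro add_mono mult_mono) auto
  also have "\<dots> \<le> e\<^sup>2 * (1 + c) ^ card F + (c * e) * (e * (1 + c) ^ card F)"
    using assms by (intro add_left_mono mult_left_mono) auto
  also have "\<dots> = e\<^sup>2 * (1 + c) ^ card (insert a F)"
    using insert by (simp add: algebra_simps power2_eq_square)
  finally show ?case .
qed (use assms in simp)

lemma tendsto_prod_minus_one: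
  fixes w :: "nat \<Rightarrow> real"
  shows "((\<lambda>h. ((\<Prod>j<m. 1 + h * w j) - 1) / h) \<longlongrightarrow> (\<Sum>j<m. w j)) (at_right 0)"
proof (induction m)
  case (Suc m)
  have "((\<lambda>h. ((\<Prod>j<m. 1 + h * w j) - 1) / h + w m * (\<Prod>j<m. 1 + h * w j)) \<longlongrightarrow>
      (\<Sum>j<m. w j) + w m * (\<Prod>j<m. 1 + 0 * w j)) (at_right 0)"
    by (intro tendsto_intros Suc)
  then have *: "((\<lambda>h. ((\<Prod>j<m. 1 + h * w j) - 1) / h + w m * (\<Prod>j<m. 1 + h * w j)) \<longlongrightarrow>
      (\<Sum>j<Suc m. w j)) (at_right 0)"
    by simp
  show ?case
    by (rule Lim_transform_eventually[OF *], rule eventually_at_right_less[THEN eventually_mono])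
      (simp add: field_simps)
qed simp

text \<open>The limit is the second elementary symmetric polynomial, summed in the order in which
  the induction peels off the last factor.\<close>

lemma tendsto_prod_minus_linear:
  fixes w :: "nat \<Rightarrow> real"
  shows "((\<lambda>h. ((\<Prod>j<m. 1 + h * w j) - 1 - h * (\<Sum>j<m. w j)) / h\<^sup>2) \<longlongrightarrow>
    (\<Sum>j<m. \<Sum>i<j. w i * w j)) (at_right 0)"
proof (induction m)
  case (Suc m)
  have "((\<lambda>h. ((\<Prod>j<m. 1 + h * w j) - 1 - h * (\<Sum>j<m. w j)) / h\<^sup>2 + w m * (((\<Prod>j<m. 1 + h * w j) - 1) / h)) \<longlongrightarrow>
      (\<Sum>j<m. \<Sum>i<j. w i * w j) + w m * (\<Sum>j<m. w j)) (at_right 0)"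
    by (intro tendsto_intros Suc tendsto_prod_minus_one)
  then have *: "((\<lambda>h. ((\<Prod>j<m. 1 + h * w j) - 1 - h * (\<Sum>j<m. w j)) / h\<^sup>2 + w m * (((\<Prod>j<m. 1 + h * w j) - 1) / h)) \<longlongrightarrow>
      (\<Sum>j<Suc m. \<Sum>i<j. w i * w j)) (at_right 0)"
    by (simp add: sum_distrib_left mult.commute)
  show ?case
    by (rule Lim_transform_eventually[OF *], rule eventually_at_right_less[THEN eventually_mono])
      (simp add: field_simps power2_eq_square)
qed simp

text \<open>First move 0 to \<open>j\<close>, then the image of 1 to \<open>l\<close>; the second
  transposition fixes \<open>j\<close>, which is neither \<open>l\<close> nor that image. Any pair
  of coordinates thereby reduces to the pair 0, 1 in terms of which \<open>Phi\<close> is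
  defined.\<close>

lemma exists_permutes_two:
  fixes j l k :: nat
  assumes "j < k" "l < k" "j \<noteq> l" "2 \<le> k"
  shows "\<exists>\<theta>. \<theta> permutes {..<k} \<and> \<theta> 0 = j \<and> \<theta> 1 = l"
proof -
  let ?t = "Transposition.transpose 0 j"
  have t: "?t permutes {..<k}" using assms by (intro permutes_swap_id) auto
  have t1: "?t 1 < k" using permutes_in_image[OF t, of 1] assms by simp
  have s: "Transposition.transpose (?t 1) l permutes {..<k}" using t1 assms by (intro permutes_swap_id) auto
  have "(Transposition.transpose (?t 1) l \<circ> ?t) permutes {..<k}" by (rule permutes_compose[OF t s])
  moreover have "(Transposition.transpose (?t 1) l \<circ> ?t) 1 = l" by simp
  moreover have "(Transposition.transpose (?t 1) l \<circ> ?t) 0 = j"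
    using assms by (auto simp: Transposition.transpose_def)
  ultimately show ?thesis by blast
qed

section \<open>Second moments: two assignments weighted by the same constraint\<close>

context sym_model
begin

text \<open>By SYM the weight of each slice obtained by fixing one coordinate, for every constraint;
  \<open>W\<close> times \<open>Phi\<close> is the unnormalised marginal of coordinates 0 and
  1.\<close>

definition W :: real where W_eq: "W = real CARD('a) ^ (k - 1) * xi k P"

lemma W_pos: "0 < W" unfolding W_eq using xi_pos by simp

lemma pow_q_eq: "real CARD('a) ^ k = real CARD('a) * real CARD('a) ^ (k - 1)"
  using k2 by (cases k) auto

lemma sum_psi: "\<psi> \<in> set_pmf P \<Longrightarrow> (\<Sum>\<tau>\<in>Sig k. \<psi> \<tau>) = real CARD('a) * W"
  using one_coordinate[of 0 \<psi> "\<lambda>_. 1"] k2 by (simp add: W_eq)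

lemma pair_one_coordinate:
  assumes "i < k" "\<psi> \<in> set_pmf P"
  shows "(\<Sum>\<tau>\<in>Sig k. \<Sum>\<tau>'\<in>Sig k. \<psi> \<tau> * \<psi> \<tau>' * f (\<tau> i) (\<tau>' i)) = W\<^sup>2 * (\<Sum>a\<in>UNIV. \<Sum>b\<in>UNIV. f a b)"
proof -
  have "(\<Sum>\<tau>\<in>Sig k. \<Sum>\<tau>'\<in>Sig k. \<psi> \<tau> * \<psi> \<tau>' * f (\<tau> i) (\<tau>' i)) =
      (\<Sum>\<tau>\<in>Sig k. \<psi> \<tau> * (\<Sum>\<tau>'\<in>Sig k. \<psi> \<tau>' * f (\<tau> i) (\<tau>' i)))"
    by (simp add: sum_distrib_left mult.assoc)
  also have "\<dots> = (\<Sum>\<tau>\<in>Sig k. \<psi> \<tau> * (W * (\<Sum>b\<in>UNIV. f (\<tau> i) b)))"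
    using assms by (simp add: one_coordinate W_eq)
  also have "\<dots> = W * (W * (\<Sum>a\<in>UNIV. \<Sum>b\<in>UNIV. f a b))"
    using one_coordinate[OF assms, of "\<lambda>a. W * (\<Sum>b\<in>UNIV. f a b)"] by (simp add: W_eq sum_distrib_left)
  finally show ?thesis by (simp add: power2_eq_square)
qed

text \<open>Given \<psi>, the two assignments are weighted independently, so the pair of values at 0
  and the pair of values at 1 are coupled by the Kronecker square of \<open>Phi\<close>. Averaging
  over the shared \<psi> produces \<Xi>.\<close>

lemma pair_base:
  "EP (\<lambda>\<psi>. \<Sum>\<tau>\<in>Sig k. \<Sum>\<tau>'\<in>Sig k. \<psi> \<tau> * \<psi> \<tau>' * f (\<tau> 0) (\<tau>' 0) (\<tau> 1) (\<tau>' 1)) =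
   W\<^sup>2 * (\<Sum>a\<in>UNIV. \<Sum>b\<in>UNIV. \<Sum>c\<in>UNIV. \<Sum>d\<in>UNIV. Xi k P (a, b) (c, d) * f a b c d)"
proof -
  have ind: "(\<Sum>a\<in>UNIV. \<Sum>c\<in>UNIV. (\<Sum>\<tau>\<in>Sig k. \<psi> \<tau> * (if \<tau> 0 = a \<and> \<tau> 1 = c then 1 else 0)) * g a c) =
      (\<Sum>\<tau>\<in>Sig k. \<psi> \<tau> * g (\<tau> 0) (\<tau> 1))" for \<psi> :: "(nat \<Rightarrow> 'a) \<Rightarrow> real" and g :: "'a \<Rightarrow> 'a \<Rightarrow> real"
  proof -
    have "(\<Sum>a\<in>UNIV. \<Sum>c\<in>UNIV. (\<Sum>\<tau>\<in>Sig k. \<psi> \<tau> * (if \<tau> 0 = a \<and> \<tau> 1 = c then 1 else 0)) * g a c) =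
      (\<Sum>p\<in>UNIV. \<Sum>\<tau>\<in>Sig k. \<psi> \<tau> * (if \<tau> 0 = fst p \<and> \<tau> 1 = snd p then 1 else 0) * g (fst p) (snd p))"
      by (simp add: sum_UNIV_prod sum_distrib_right)
    also have "\<dots> = (\<Sum>\<tau>\<in>Sig k. \<Sum>p\<in>UNIV. \<psi> \<tau> * (if \<tau> 0 = fst p \<and> \<tau> 1 = snd p then 1 else 0) * g (fst p) (snd p))"
      by (rule sum.swap)
    also have "\<dots> = (\<Sum>\<tau>\<in>Sig k. \<Sum>p\<in>UNIV. if p = (\<tau> 0, \<tau> 1) then \<psi> \<tau> * g (\<tau> 0) (\<tau> 1) else 0)"
      by (intro sum.cong refl) auto
    finally show ?thesis by simp
  qed
  have P1: "Phi k P \<psi> a c * W = (\<Sum>\<tau>\<in>Sig k. \<psi> \<tau> * (if \<tau> 0 = a \<and> \<tau> 1 = c then 1 else 0))" for \<psi> a c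
    using xi_pos unfolding Phi_eq W_eq by simp
  have one: "(\<Sum>a\<in>UNIV. \<Sum>b\<in>UNIV. \<Sum>c\<in>UNIV. \<Sum>d\<in>UNIV. W\<^sup>2 * (Phi k P \<psi> a c * Phi k P \<psi> b d) * f a b c d) =
     (\<Sum>\<tau>\<in>Sig k. \<Sum>\<tau>'\<in>Sig k. \<psi> \<tau> * \<psi> \<tau>' * f (\<tau> 0) (\<tau>' 0) (\<tau> 1) (\<tau>' 1))" for \<psi>
  proof -
    have "(\<Sum>a\<in>UNIV. \<Sum>b\<in>UNIV. \<Sum>c\<in>UNIV. \<Sum>d\<in>UNIV. W\<^sup>2 * (Phi k P \<psi> a c * Phi k P \<psi> b d) * f a b c d) =
      (\<Sum>a\<in>UNIV. \<Sum>b\<in>UNIV. \<Sum>c\<in>UNIV. (Phi k P \<psi> a c * W) * (\<Sum>d\<in>UNIV. (Phi k P \<psi> b d * W) * f a b c d))"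
      by (intro sum.cong refl) (simp add: sum_distrib_left power2_eq_square mult_ac)
    also have "\<dots> = (\<Sum>a\<in>UNIV. \<Sum>c\<in>UNIV. (Phi k P \<psi> a c * W) * (\<Sum>b\<in>UNIV. \<Sum>d\<in>UNIV. (Phi k P \<psi> b d * W) * f a b c d))"
      unfolding sum_distrib_left by (intro sum.cong refl sum.swap)
    also have "\<dots> = (\<Sum>\<tau>\<in>Sig k. \<psi> \<tau> * (\<Sum>\<tau>'\<in>Sig k. \<psi> \<tau>' * f (\<tau> 0) (\<tau>' 0) (\<tau> 1) (\<tau>' 1)))"
      unfolding P1 ind ..
    finally show ?thesis by (simp add: sum_distrib_left mult.assoc)
  qed
  have "W\<^sup>2 * (\<Sum>a\<in>UNIV. \<Sum>b\<in>UNIV. \<Sum>c\<in>UNIV. \<Sum>d\<in>UNIV. Xi k P (a, b) (c, d) * f a b c d) =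
     (\<Sum>p\<in>UNIV. \<Sum>r\<in>UNIV. \<Sum>\<psi>\<in>set_pmf P. pmf P \<psi> *
        (W\<^sup>2 * (Phi k P \<psi> (fst p) (fst r) * Phi k P \<psi> (snd p) (snd r)) * f (fst p) (snd p) (fst r) (snd r)))"
    unfolding sum_UNIV_prod fst_conv snd_conv Xi_eq sum_distrib_left sum_distrib_right
    by (intro sum.cong refl) (simp add: mult_ac)
  also have "\<dots> = (\<Sum>p\<in>UNIV. \<Sum>\<psi>\<in>set_pmf P. \<Sum>r\<in>UNIV. pmf P \<psi> *
        (W\<^sup>2 * (Phi k P \<psi> (fst p) (fst r) * Phi k P \<psi> (snd p) (snd r)) * f (fst p) (snd p) (fst r) (snd r)))"
    by (intro sum.cong refl sum.swap)
  also have "\<dots> = (\<Sum>\<psi>\<in>set_pmf P. \<Sum>p\<in>UNIV. \<Sum>r\<in>UNIV. pmf P \<psi> *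
        (W\<^sup>2 * (Phi k P \<psi> (fst p) (fst r) * Phi k P \<psi> (snd p) (snd r)) * f (fst p) (snd p) (fst r) (snd r)))"
    by (rule sum.swap)
  also have "\<dots> = EP (\<lambda>\<psi>. \<Sum>\<tau>\<in>Sig k. \<Sum>\<tau>'\<in>Sig k. \<psi> \<tau> * \<psi> \<tau>' * f (\<tau> 0) (\<tau>' 0) (\<tau> 1) (\<tau>' 1))"
    unfolding sum_UNIV_prod fst_conv snd_conv one[symmetric] by (simp only: sum_distrib_left)
  finally show ?thesis by simp
qed

text \<open>In expectation every ordered pair of distinct coordinates behaves like the pair 0, 1.
  The relabelling is by \<open>inv \<theta>\<close> because \<open>sum_perm_con\<close> inverts once
  more.\<close>

lemma pair_marginal:
  assumes "j < k" "l < k" "j \<noteq> l"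
  shows "EP (\<lambda>\<psi>. \<Sum>\<tau>\<in>Sig k. \<Sum>\<tau>'\<in>Sig k. \<psi> \<tau> * \<psi> \<tau>' * f (\<tau> j) (\<tau>' j) (\<tau> l) (\<tau>' l)) =
   W\<^sup>2 * (\<Sum>a\<in>UNIV. \<Sum>b\<in>UNIV. \<Sum>c\<in>UNIV. \<Sum>d\<in>UNIV. Xi k P (a, b) (c, d) * f a b c d)"
proof -
  obtain \<theta> where t: "\<theta> permutes {..<k}" "\<theta> 0 = j" "\<theta> 1 = l" using exists_permutes_two[OF assms k2] by blast
  define F where "F = (\<lambda>\<psi>. \<Sum>\<tau>\<in>Sig k. \<Sum>\<tau>'\<in>Sig k. \<psi> \<tau> * \<psi> \<tau>' * f (\<tau> 0) (\<tau>' 0) (\<tau> 1) (\<tau>' 1))"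
  have i: "inv \<theta> permutes {..<k}" by (rule permutes_inv[OF t(1)])
  have ii: "inv (inv \<theta>) = \<theta>" by (rule permutes_inv_inv[OF t(1)])
  have "F (perm_con k (inv \<theta>) \<psi>) =
     (\<Sum>\<tau>\<in>Sig k. \<Sum>\<tau>'\<in>Sig k. \<psi> \<tau> * \<psi> \<tau>' * f (\<tau> j) (\<tau>' j) (\<tau> l) (\<tau>' l))" for \<psi>
  proof -
    have "F (perm_con k (inv \<theta>) \<psi>) = (\<Sum>\<tau>\<in>Sig k. perm_con k (inv \<theta>) \<psi> \<tau> *
        (\<Sum>\<tau>'\<in>Sig k. perm_con k (inv \<theta>) \<psi> \<tau>' * f (\<tau> 0) (\<tau>' 0) (\<tau> 1) (\<tau>' 1)))"
      unfolding F_def by (simp add: sum_distrib_left mult.assoc)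
    also have "\<dots> = (\<Sum>\<tau>\<in>Sig k. \<psi> \<tau> * (\<Sum>\<tau>'\<in>Sig k. \<psi> \<tau>' * f (\<tau> j) (\<tau>' j) (\<tau> l) (\<tau>' l)))"
      unfolding sum_perm_con[OF i] ii o_apply t ..
    finally show ?thesis by (simp add: sum_distrib_left mult.assoc)
  qed
  then show ?thesis using EP_perm[OF i, of F] pair_base[of f] unfolding F_def by simp
qed

text \<open>With \<open>h = e^2\<close> these are normalised second moments: \<open>pair_moment k h z / q^2\<close> is the one of a
  clause value, and \<open>1 + message_cov h z s s'\<close> is the mixed one of the entries \<open>s\<close> and \<open>s'\<close> of a message.\<close>
definition pair_weight :: "nat \<Rightarrow> real \<Rightarrow> ('a \<times> 'a \<Rightarrow> real) \<Rightarrow> (nat \<Rightarrow> 'a) \<Rightarrow> (nat \<Rightarrow> 'a) \<Rightarrow> real" where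
  "pair_weight m h z \<tau> \<tau>' = (\<Prod>j<m. 1 + h * z (\<tau> j, \<tau>' j))"

definition pair_moment :: "nat \<Rightarrow> real \<Rightarrow> ('a \<times> 'a \<Rightarrow> real) \<Rightarrow> real" where
  "pair_moment m h z = EP (\<lambda>\<psi>. \<Sum>\<tau>\<in>Sig k. \<Sum>\<tau>'\<in>Sig k. \<psi> \<tau> * \<psi> \<tau>' * pair_weight m h z \<tau> \<tau>') / W\<^sup>2"

definition message_cov :: "real \<Rightarrow> ('a \<times> 'a \<Rightarrow> real) \<Rightarrow> 'a \<Rightarrow> 'a \<Rightarrow> real" where
  "message_cov h z s s' = EP (\<lambda>\<psi>. \<Sum>\<tau>\<in>Sig k. \<Sum>\<tau>'\<in>Sig k. \<psi> \<tau> * \<psi> \<tau>' *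
     ((if \<tau> (k - 1) = s \<and> \<tau>' (k - 1) = s' then 1 else 0) * pair_weight (k - 1) h z \<tau> \<tau>')) / W\<^sup>2 - 1"

lemma EP_sum: "EP (\<lambda>\<psi>. \<Sum>i\<in>I. g i \<psi>) = (\<Sum>i\<in>I. EP (g i))"
proof -
  have "EP (\<lambda>\<psi>. \<Sum>i\<in>I. g i \<psi>) = (\<Sum>\<psi>\<in>set_pmf P. \<Sum>i\<in>I. pmf P \<psi> * g i \<psi>)"
    by (simp add: sum_distrib_left)
  then show ?thesis by (subst (asm) sum.swap) simp
qed

lemma inner_apply_Xi:
  "inner_t (apply_Xi k P z) z = (\<Sum>a\<in>UNIV. \<Sum>b\<in>UNIV. \<Sum>c\<in>UNIV. \<Sum>d\<in>UNIV. Xi k P (a, b) (c, d) * (z (a, b) * z (c, d)))"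
  unfolding inner_t_def apply_Xi_def sum_UNIV_prod sum_distrib_right
  by (simp add: mult_ac)

lemma sum_pairs_const: "(\<Sum>j<m. \<Sum>i<j. c) = real m * (real m - 1) / 2 * (c::real)"
  by (induction m) (auto simp: field_simps)

text \<open>The order-h term involves single coordinates and vanishes as \<open>z\<close> sums to 0.
  At order h^2 each of the m(m-1)/2 pairs of coordinates contributes <\<Xi> z, z>.\<close>

lemma pair_moment_tendsto:
  assumes m: "m \<le> k" and z: "(\<Sum>a\<in>UNIV. \<Sum>b\<in>UNIV. z (a, b)) = 0"
  shows "((\<lambda>h. (pair_moment m h z - (real CARD('a))\<^sup>2) / h\<^sup>2) \<longlongrightarrow>
     real m * (real m - 1) / 2 * inner_t (apply_Xi k P z) z) (at_right 0)"
proof -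
  let ?w = "\<lambda>\<tau> \<tau>' j. z (\<tau> j :: 'a, \<tau>' j)"
  let ?g = "\<lambda>h \<tau> \<tau>'. (pair_weight m h z \<tau> \<tau>' - 1 - h * (\<Sum>j<m. ?w \<tau> \<tau>' j)) / h\<^sup>2"
  let ?G = "\<lambda>h. EP (\<lambda>\<psi>. \<Sum>\<tau>\<in>Sig k. \<Sum>\<tau>'\<in>Sig k. \<psi> \<tau> * \<psi> \<tau>' * ?g h \<tau> \<tau>') / W\<^sup>2"
  have "(?G \<longlongrightarrow> EP (\<lambda>\<psi>. \<Sum>\<tau>\<in>Sig k. \<Sum>\<tau>'\<in>Sig k. \<psi> \<tau> * \<psi> \<tau>' * (\<Sum>j<m. \<Sum>i<j. ?w \<tau> \<tau>' i * ?w \<tau> \<tau>' j)) / W\<^sup>2) (at_right 0)"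
    unfolding pair_weight_def using W_pos
    by (intro tendsto_intros tendsto_prod_minus_linear) auto
  also have "EP (\<lambda>\<psi>. \<Sum>\<tau>\<in>Sig k. \<Sum>\<tau>'\<in>Sig k. \<psi> \<tau> * \<psi> \<tau>' * (\<Sum>j<m. \<Sum>i<j. ?w \<tau> \<tau>' i * ?w \<tau> \<tau>' j)) =
     (\<Sum>j<m. \<Sum>i<j. EP (\<lambda>\<psi>. \<Sum>\<tau>\<in>Sig k. \<Sum>\<tau>'\<in>Sig k. \<psi> \<tau> * \<psi> \<tau>' * (?w \<tau> \<tau>' i * ?w \<tau> \<tau>' j)))"
  proof -
    have "(\<Sum>\<tau>\<in>Sig k. \<Sum>\<tau>'\<in>Sig k. \<psi> \<tau> * \<psi> \<tau>' * (\<Sum>j<m. \<Sum>i<j. ?w \<tau> \<tau>' i * ?w \<tau> \<tau>' j)) =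
       (\<Sum>j<m. \<Sum>i<j. \<Sum>\<tau>\<in>Sig k. \<Sum>\<tau>'\<in>Sig k. \<psi> \<tau> * \<psi> \<tau>' * (?w \<tau> \<tau>' i * ?w \<tau> \<tau>' j))" for \<psi> :: "(nat \<Rightarrow> 'a) \<Rightarrow> real"
      unfolding sum_distrib_left
      \<comment> \<open>Fixing both index sets orients the exchange of sums, so that rewriting
        terminates.\<close>
      by (simp only: sum.swap[where A = "Sig k" and B = "{..<_}"])
    then show ?thesis by (simp only: EP_sum)
  qed
  also have "\<dots> = (\<Sum>j<m. \<Sum>i<j. W\<^sup>2 * inner_t (apply_Xi k P z) z)"
    unfolding inner_apply_Xi using m
    by (intro sum.cong refl pair_marginal[where f = "\<lambda>a b c d. z (a, b) * z (c, d)"]) auto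
  also have "\<dots> / W\<^sup>2 = real m * (real m - 1) / 2 * inner_t (apply_Xi k P z) z"
    unfolding sum_pairs_const using W_pos by simp
  finally have *: "(?G \<longlongrightarrow> real m * (real m - 1) / 2 * inner_t (apply_Xi k P z) z) (at_right 0)" .
  have eq: "?G h = (pair_moment m h z - (real CARD('a))\<^sup>2) / h\<^sup>2" for h
  proof -
    have lin: "(\<Sum>\<tau>\<in>Sig k. \<Sum>\<tau>'\<in>Sig k. \<psi> \<tau> * \<psi> \<tau>' * (\<Sum>j<m. ?w \<tau> \<tau>' j)) = 0" if p: "\<psi> \<in> set_pmf P" for \<psi>
    proof -
      have "(\<Sum>\<tau>\<in>Sig k. \<Sum>\<tau>'\<in>Sig k. \<psi> \<tau> * \<psi> \<tau>' * (\<Sum>j<m. ?w \<tau> \<tau>' j)) =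
         (\<Sum>j<m. \<Sum>\<tau>\<in>Sig k. \<Sum>\<tau>'\<in>Sig k. \<psi> \<tau> * \<psi> \<tau>' * ?w \<tau> \<tau>' j)"
        unfolding sum_distrib_left by (simp only: sum.swap[where A = "Sig k" and B = "{..<_}"])
      also have "\<dots> = (\<Sum>j<m. W\<^sup>2 * 0)" unfolding z[symmetric] using m p
        by (intro sum.cong refl pair_one_coordinate[where f = "\<lambda>a b. z (a, b)"]) auto
      finally show ?thesis by simp
    qed
    have const: "(\<Sum>\<tau>\<in>Sig k. \<Sum>\<tau>'\<in>Sig k. \<psi> \<tau> * \<psi> \<tau>') = (real CARD('a))\<^sup>2 * W\<^sup>2" if "\<psi> \<in> set_pmf P" for \<psi>
      using sum_psi[OF that] by (simp add: power2_eq_square mult_ac flip: sum_product)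
    have "EP (\<lambda>\<psi>. \<Sum>\<tau>\<in>Sig k. \<Sum>\<tau>'\<in>Sig k. \<psi> \<tau> * \<psi> \<tau>' * ?g h \<tau> \<tau>') =
       EP (\<lambda>\<psi>. ((\<Sum>\<tau>\<in>Sig k. \<Sum>\<tau>'\<in>Sig k. \<psi> \<tau> * \<psi> \<tau>' * pair_weight m h z \<tau> \<tau>') - (real CARD('a))\<^sup>2 * W\<^sup>2) / h\<^sup>2)"
    proof (intro sum.cong refl arg_cong2[where f = "(*)"])
      fix \<psi> assume p: "\<psi> \<in> set_pmf P"
      have "(\<Sum>\<tau>\<in>Sig k. \<Sum>\<tau>'\<in>Sig k. \<psi> \<tau> * \<psi> \<tau>' * ?g h \<tau> \<tau>') =
        ((\<Sum>\<tau>\<in>Sig k. \<Sum>\<tau>'\<in>Sig k. \<psi> \<tau> * \<psi> \<tau>' * pair_weight m h z \<tau> \<tau>') - (\<Sum>\<tau>\<in>Sig k. \<Sum>\<tau>'\<in>Sig k. \<psi> \<tau> * \<psi> \<tau>') -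
          h * (\<Sum>\<tau>\<in>Sig k. \<Sum>\<tau>'\<in>Sig k. \<psi> \<tau> * \<psi> \<tau>' * (\<Sum>j<m. ?w \<tau> \<tau>' j))) / h\<^sup>2"
        unfolding sum_distrib_left[of h _ "Sig k"] sum_subtractf[symmetric] sum_divide_distrib
        by (intro sum.cong refl) (simp add: algebra_simps del: sum_distrib_left sum_distrib_right)
      then show "(\<Sum>\<tau>\<in>Sig k. \<Sum>\<tau>'\<in>Sig k. \<psi> \<tau> * \<psi> \<tau>' * ?g h \<tau> \<tau>') =
        ((\<Sum>\<tau>\<in>Sig k. \<Sum>\<tau>'\<in>Sig k. \<psi> \<tau> * \<psi> \<tau>' * pair_weight m h z \<tau> \<tau>') - (real CARD('a))\<^sup>2 * W\<^sup>2) / h\<^sup>2"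
        unfolding lin[OF p] const[OF p] by simp
    qed
    also have "\<dots> = (EP (\<lambda>\<psi>. \<Sum>\<tau>\<in>Sig k. \<Sum>\<tau>'\<in>Sig k. \<psi> \<tau> * \<psi> \<tau>' * pair_weight m h z \<tau> \<tau>') - EP (\<lambda>_. (real CARD('a))\<^sup>2 * W\<^sup>2)) / h\<^sup>2"
      unfolding sum_subtractf[symmetric] sum_divide_distrib by (intro sum.cong refl) (simp add: algebra_simps)
    finally show ?thesis unfolding EP_const pair_moment_def using W_pos by (simp add: field_simps)
  qed
  show ?thesis using * unfolding eq .
qed

text \<open>In contrast to \<open>pair_moment\<close>, the first order survives: the indicator pins
  the last coordinate at the pair (s, s'), and each of the k-1 remaining coordinates, paired with
  it, contributes the entry of \<Xi> z there.\<close>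

lemma message_cov_tendsto:
  "((\<lambda>h. message_cov h z s s' / h) \<longlongrightarrow> (real k - 1) * apply_Xi k P z (s, s')) (at_right 0)"
proof -
  let ?I = "\<lambda>\<tau> \<tau>'. (if \<tau> (k - 1) = s \<and> \<tau>' (k - 1) = s' then 1 else 0) :: real"
  let ?w = "\<lambda>\<tau> \<tau>' j. z (\<tau> j :: 'a, \<tau>' j)"
  let ?g = "\<lambda>h \<tau> \<tau>'. (pair_weight (k - 1) h z \<tau> \<tau>' - 1) / h"
  let ?G = "\<lambda>h. EP (\<lambda>\<psi>. \<Sum>\<tau>\<in>Sig k. \<Sum>\<tau>'\<in>Sig k. \<psi> \<tau> * \<psi> \<tau>' * (?I \<tau> \<tau>' * ?g h \<tau> \<tau>')) / W\<^sup>2"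
  have "(?G \<longlongrightarrow> EP (\<lambda>\<psi>. \<Sum>\<tau>\<in>Sig k. \<Sum>\<tau>'\<in>Sig k. \<psi> \<tau> * \<psi> \<tau>' * (?I \<tau> \<tau>' * (\<Sum>j<k - 1. ?w \<tau> \<tau>' j))) / W\<^sup>2) (at_right 0)"
    unfolding pair_weight_def using W_pos
    by (intro tendsto_intros tendsto_prod_minus_one) auto
  also have "EP (\<lambda>\<psi>. \<Sum>\<tau>\<in>Sig k. \<Sum>\<tau>'\<in>Sig k. \<psi> \<tau> * \<psi> \<tau>' * (?I \<tau> \<tau>' * (\<Sum>j<k - 1. ?w \<tau> \<tau>' j))) =
     (\<Sum>j<k - 1. EP (\<lambda>\<psi>. \<Sum>\<tau>\<in>Sig k. \<Sum>\<tau>'\<in>Sig k. \<psi> \<tau> * \<psi> \<tau>' * (?I \<tau> \<tau>' * ?w \<tau> \<tau>' j)))"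
  proof -
    have "(\<Sum>\<tau>\<in>Sig k. \<Sum>\<tau>'\<in>Sig k. \<psi> \<tau> * \<psi> \<tau>' * (?I \<tau> \<tau>' * (\<Sum>j<k - 1. ?w \<tau> \<tau>' j))) =
       (\<Sum>j<k - 1. \<Sum>\<tau>\<in>Sig k. \<Sum>\<tau>'\<in>Sig k. \<psi> \<tau> * \<psi> \<tau>' * (?I \<tau> \<tau>' * ?w \<tau> \<tau>' j))" for \<psi> :: "(nat \<Rightarrow> 'a) \<Rightarrow> real"
      unfolding sum_distrib_left
      by (simp only: sum.swap[where A = "Sig k" and B = "{..<_}"])
    then show ?thesis by (simp only: EP_sum)
  qed
  also have "\<dots> = (\<Sum>j<k - 1. W\<^sup>2 * (\<Sum>a\<in>UNIV. \<Sum>b\<in>UNIV. \<Sum>c\<in>UNIV. \<Sum>d\<in>UNIV.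
        Xi k P (a, b) (c, d) * ((if a = s \<and> b = s' then 1 else 0) * z (c, d))))"
    by (intro sum.cong refl pair_marginal[where f = "\<lambda>a b c d. (if a = s \<and> b = s' then 1 else 0) * z (c, d)"]) auto
  also have "(\<Sum>a\<in>UNIV. \<Sum>b\<in>UNIV. \<Sum>c\<in>UNIV. \<Sum>d\<in>UNIV.
        Xi k P (a, b) (c, d) * ((if a = s \<and> b = s' then 1 else 0) * z (c, d))) = apply_Xi k P z (s, s')"
  proof -
    have "(\<Sum>a\<in>UNIV. \<Sum>b\<in>UNIV. \<Sum>c\<in>UNIV. \<Sum>d\<in>UNIV.
        Xi k P (a, b) (c, d) * ((if a = s \<and> b = s' then 1 else 0) * z (c, d))) =
       (\<Sum>p\<in>UNIV. \<Sum>r\<in>UNIV. Xi k P p r * ((if p = (s, s') then 1 else 0) * z r))"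
      by (simp add: sum_UNIV_prod)
    also have "\<dots> = (\<Sum>p\<in>UNIV. if p = (s, s') then (\<Sum>r\<in>UNIV. Xi k P p r * z r) else 0)"
      by (intro sum.cong refl) auto
    finally show ?thesis by (simp add: apply_Xi_def)
  qed
  also have "(\<Sum>j<k - 1. W\<^sup>2 * apply_Xi k P z (s, s')) / W\<^sup>2 = (real k - 1) * apply_Xi k P z (s, s')"
    using W_pos k2 by (simp add: of_nat_diff)
  finally have *: "(?G \<longlongrightarrow> (real k - 1) * apply_Xi k P z (s, s')) (at_right 0)" .
  have "?G h = message_cov h z s s' / h" for h
  proof -
    have const: "(\<Sum>\<tau>\<in>Sig k. \<Sum>\<tau>'\<in>Sig k. \<psi> \<tau> * \<psi> \<tau>' * ?I \<tau> \<tau>') = W\<^sup>2" if "\<psi> \<in> set_pmf P" for \<psi>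
    proof -
      have "(\<Sum>\<tau>\<in>Sig k. \<Sum>\<tau>'\<in>Sig k. \<psi> \<tau> * \<psi> \<tau>' * ?I \<tau> \<tau>') =
         W\<^sup>2 * (\<Sum>a\<in>UNIV. \<Sum>b\<in>UNIV. if a = s \<and> b = s' then 1 else 0)"
        using k2 that by (intro pair_one_coordinate[where f = "\<lambda>a b. if a = s \<and> b = s' then 1 else 0"]) auto
      also have "(\<Sum>a\<in>UNIV. \<Sum>b\<in>UNIV. if a = s \<and> b = s' then 1 else 0 :: real) =
         (\<Sum>p\<in>UNIV. if p = (s, s') then 1 else 0)" by (simp add: sum_UNIV_prod)
      finally show ?thesis by simp
    qed
    have "EP (\<lambda>\<psi>. \<Sum>\<tau>\<in>Sig k. \<Sum>\<tau>'\<in>Sig k. \<psi> \<tau> * \<psi> \<tau>' * (?I \<tau> \<tau>' * ?g h \<tau> \<tau>')) =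
       EP (\<lambda>\<psi>. ((\<Sum>\<tau>\<in>Sig k. \<Sum>\<tau>'\<in>Sig k. \<psi> \<tau> * \<psi> \<tau>' * (?I \<tau> \<tau>' * pair_weight (k - 1) h z \<tau> \<tau>')) -
         (\<Sum>\<tau>\<in>Sig k. \<Sum>\<tau>'\<in>Sig k. \<psi> \<tau> * \<psi> \<tau>' * ?I \<tau> \<tau>')) / h)"
      unfolding sum_subtractf[symmetric] sum_divide_distrib
      by (intro sum.cong refl arg_cong2[where f = "(*)"]) (simp add: algebra_simps diff_divide_distrib)
    also have "\<dots> = EP (\<lambda>\<psi>. ((\<Sum>\<tau>\<in>Sig k. \<Sum>\<tau>'\<in>Sig k. \<psi> \<tau> * \<psi> \<tau>' * (?I \<tau> \<tau>' * pair_weight (k - 1) h z \<tau> \<tau>')) - W\<^sup>2) / h)"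
      by (intro sum.cong refl) (simp only: const)
    also have "\<dots> = (EP (\<lambda>\<psi>. \<Sum>\<tau>\<in>Sig k. \<Sum>\<tau>'\<in>Sig k. \<psi> \<tau> * \<psi> \<tau>' * (?I \<tau> \<tau>' * pair_weight (k - 1) h z \<tau> \<tau>')) - EP (\<lambda>_. W\<^sup>2)) / h"
      unfolding sum_subtractf[symmetric] sum_divide_distrib by (intro sum.cong refl) (simp add: algebra_simps)
    finally show ?thesis unfolding EP_const message_cov_def using W_pos by (simp add: field_simps)
  qed
  with * show ?thesis by simp
qed

text \<open>Summation releases the pinned coordinate. For \<open>z\<close> of sum 0 the total is
  then only of order h^2 although each entry is of order h, which is why the linear and the
  quadratic terms of the exponential compete at the same order.\<close>

lemma sum_message_cov:
  "(\<Sum>s\<in>UNIV. \<Sum>s'\<in>UNIV. message_cov h z s s') = pair_moment (k - 1) h z - (real CARD('a))\<^sup>2"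
proof -
  have one: "(\<Sum>s\<in>UNIV. \<Sum>s'\<in>UNIV. \<Sum>\<tau>\<in>Sig k. \<Sum>\<tau>'\<in>Sig k. \<psi> \<tau> * \<psi> \<tau>' *
     ((if \<tau> (k - 1) = s \<and> \<tau>' (k - 1) = s' then 1 else 0) * g \<tau> \<tau>')) =
     (\<Sum>\<tau>\<in>Sig k. \<Sum>\<tau>'\<in>Sig k. \<psi> \<tau> * \<psi> \<tau>' * g \<tau> \<tau>')" for \<psi> :: "(nat \<Rightarrow> 'a) \<Rightarrow> real" and g
  proof -
    have "(\<Sum>s\<in>UNIV. \<Sum>s'\<in>UNIV. \<Sum>\<tau>\<in>Sig k. \<Sum>\<tau>'\<in>Sig k. \<psi> \<tau> * \<psi> \<tau>' *
      ((if \<tau> (k - 1) = s \<and> \<tau>' (k - 1) = s' then 1 else 0) * g \<tau> \<tau>')) =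
      (\<Sum>\<tau>\<in>Sig k. \<Sum>\<tau>'\<in>Sig k. \<Sum>s\<in>UNIV. \<Sum>s'\<in>UNIV. \<psi> \<tau> * \<psi> \<tau>' *
      ((if \<tau> (k - 1) = s \<and> \<tau>' (k - 1) = s' then 1 else 0) * g \<tau> \<tau>'))"
      by (simp only: sum.swap[where A = "UNIV :: 'a set" and B = "Sig k"])
    also have "\<dots> = (\<Sum>\<tau>\<in>Sig k. \<Sum>\<tau>'\<in>Sig k. \<Sum>p\<in>UNIV. if p = (\<tau> (k - 1), \<tau>' (k - 1)) then \<psi> \<tau> * \<psi> \<tau>' * g \<tau> \<tau>' else 0)"
      unfolding sum_UNIV_prod by (intro sum.cong refl) auto
    finally show ?thesis by simp
  qed
  have "(\<Sum>s\<in>UNIV. \<Sum>s'\<in>UNIV. message_cov h z s s') =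
    EP (\<lambda>\<psi>. \<Sum>s\<in>UNIV. \<Sum>s'\<in>UNIV. \<Sum>\<tau>\<in>Sig k. \<Sum>\<tau>'\<in>Sig k. \<psi> \<tau> * \<psi> \<tau>' *
     ((if \<tau> (k - 1) = s \<and> \<tau>' (k - 1) = s' then 1 else 0) * pair_weight (k - 1) h z \<tau> \<tau>')) / W\<^sup>2 - (real CARD('a))\<^sup>2"
    unfolding message_cov_def EP_sum sum_subtractf by (simp add: sum_divide_distrib power2_eq_square)
  then show ?thesis unfolding one pair_moment_def .
qed

text \<open>\<open>K * h ^ 3\<close> leaves room for the cubic remainders; \<open>K\<close> is
  arbitrary but must be chosen before \<open>h\<close>.\<close>

lemma eventually_bethe_gain:
  assumes d: "0 < d" and z: "(\<Sum>a\<in>UNIV. \<Sum>b\<in>UNIV. z (a, b)) = 0"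
    and gain: "inner_t (apply_Xi k P z) z < d * (real k - 1) * (norm_t (apply_Xi k P z))\<^sup>2"
  shows "eventually (\<lambda>h. 0 < ((\<Sum>s\<in>UNIV. \<Sum>s'\<in>UNIV. exp (d * message_cov h z s s')) / (real CARD('a))\<^sup>2 - 1) / 2
     - d * (real k - 1) / (2 * real k) * (pair_moment k h z / (real CARD('a))\<^sup>2 - 1) - K * h ^ 3) (at_right 0)"
proof -
  let ?q = "real CARD('a)" and ?T = "apply_Xi k P z" and ?I = "inner_t (apply_Xi k P z) z"
  let ?m = "\<lambda>h s s'. message_cov h z s s'"
  let ?f = "\<lambda>h. (d * ((pair_moment (k - 1) h z - ?q\<^sup>2) / h\<^sup>2) +
      (\<Sum>s\<in>UNIV. \<Sum>s'\<in>UNIV. d\<^sup>2 / 2 * (?m h s s' / h)\<^sup>2 + d ^ 3 / 6 * h * (?m h s s' / h) ^ 3)) / (2 * ?q\<^sup>2)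
     - d * (real k - 1) / (2 * real k) * (((pair_moment k h z - ?q\<^sup>2) / h\<^sup>2) / ?q\<^sup>2) - K * h"
  let ?L = "(d * (real (k - 1) * (real (k - 1) - 1) / 2 * ?I) +
      (\<Sum>s\<in>UNIV. \<Sum>s'\<in>UNIV. d\<^sup>2 / 2 * ((real k - 1) * ?T (s, s'))\<^sup>2 + d ^ 3 / 6 * 0 * ((real k - 1) * ?T (s, s')) ^ 3)) / (2 * ?q\<^sup>2)
     - d * (real k - 1) / (2 * real k) * ((real k * (real k - 1) / 2 * ?I) / ?q\<^sup>2) - K * 0"
  have lim: "(?f \<longlongrightarrow> ?L) (at_right 0)"
    by (intro tendsto_intros pair_moment_tendsto z message_cov_tendsto) auto
  have sq: "(\<Sum>s\<in>UNIV. \<Sum>s'\<in>UNIV. d\<^sup>2 / 2 * ((real k - 1) * ?T (s, s'))\<^sup>2 + d ^ 3 / 6 * 0 * ((real k - 1) * ?T (s, s')) ^ 3)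
     = d\<^sup>2 / 2 * (real k - 1)\<^sup>2 * (norm_t ?T)\<^sup>2"
    unfolding norm_t_sq inner_t_def sum_UNIV_prod by (simp add: sum_distrib_left power2_eq_square mult_ac)
  have k1: "real (k - 1) = real k - 1" using k2 by simp
  \<comment> \<open>In units of the prefactor the vertex part contributes (k-2) <\<Xi> z, z> through
    \<open>sum_message_cov\<close> and the clause part -(k-1) <\<Xi> z, z>; the difference is the
    single negative term of the bracket.\<close>
  have "?L = d * (real k - 1) / (4 * ?q\<^sup>2) * (d * (real k - 1) * (norm_t ?T)\<^sup>2 - ?I)"
    unfolding sq k1 using k2 by (simp add: field_simps power2_eq_square)
  also have "0 < \<dots>" using d gain k2 by (intro mult_pos_pos divide_pos_pos) auto
  finally have ev: "eventually (\<lambda>h. 0 < ?f h) (at_right 0)" using lim by (intro order_tendstoD(1)) auto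
  show ?thesis using ev eventually_at_right_less[of "0::real"]
  proof eventually_elim
    case (elim h)
    have "(\<Sum>s\<in>UNIV. \<Sum>s'\<in>UNIV. 1 + d * ?m h s s' + (d * ?m h s s')\<^sup>2 / 2 + (d * ?m h s s') ^ 3 / 6) \<le>
      (\<Sum>s\<in>UNIV. \<Sum>s'\<in>UNIV. exp (d * ?m h s s'))"
      by (intro sum_mono exp_ge_cubic)
    also have "(\<Sum>s\<in>UNIV. \<Sum>s'\<in>UNIV. 1 + d * ?m h s s' + (d * ?m h s s')\<^sup>2 / 2 + (d * ?m h s s') ^ 3 / 6) =
      ?q\<^sup>2 + d * (\<Sum>s\<in>UNIV. \<Sum>s'\<in>UNIV. ?m h s s') + (\<Sum>s\<in>UNIV. \<Sum>s'\<in>UNIV. (d * ?m h s s')\<^sup>2 / 2 + (d * ?m h s s') ^ 3 / 6)"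
      by (simp add: sum.distrib sum_distrib_left power2_eq_square)
    also have "(\<Sum>s\<in>UNIV. \<Sum>s'\<in>UNIV. (d * ?m h s s')\<^sup>2 / 2 + (d * ?m h s s') ^ 3 / 6) =
      h\<^sup>2 * (\<Sum>s\<in>UNIV. \<Sum>s'\<in>UNIV. d\<^sup>2 / 2 * (?m h s s' / h)\<^sup>2 + d ^ 3 / 6 * h * (?m h s s' / h) ^ 3)"
      unfolding sum_distrib_left using elim(2)
      by (intro sum.cong refl) (simp add: field_simps power2_eq_square power3_eq_cube)
    finally have le: "?q\<^sup>2 + d * (pair_moment (k - 1) h z - ?q\<^sup>2) + h\<^sup>2 * (\<Sum>s\<in>UNIV. \<Sum>s'\<in>UNIV. d\<^sup>2 / 2 * (?m h s s' / h)\<^sup>2 + d ^ 3 / 6 * h * (?m h s s' / h) ^ 3)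
      \<le> (\<Sum>s\<in>UNIV. \<Sum>s'\<in>UNIV. exp (d * ?m h s s'))" (is "?lhs \<le> ?rhs") unfolding sum_message_cov .
    have "0 < h\<^sup>2 * ?f h" using elim by simp
    also have "h\<^sup>2 * ?f h = (?lhs / ?q\<^sup>2 - 1) / 2
       - d * (real k - 1) / (2 * real k) * (pair_moment k h z / ?q\<^sup>2 - 1) - K * h ^ 3"
      using elim(2) k2 by (simp add: field_simps power2_eq_square power3_eq_cube)
    also have "\<dots> \<le> (?rhs / ?q\<^sup>2 - 1) / 2
       - d * (real k - 1) / (2 * real k) * (pair_moment k h z / ?q\<^sup>2 - 1) - K * h ^ 3"
      using le by (intro diff_right_mono divide_right_mono) auto
    finally show ?case .
  qed
qed

end

section \<open>Product measures and covariance iterates\<close>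

lemma poisson_sums:
  fixes f :: "nat \<Rightarrow> real"
  assumes d: "0 < d" and abs: "summable (\<lambda>n. \<bar>pmf (poisson_pmf d) n * f n\<bar>)"
    and s: "(\<lambda>n. pmf (poisson_pmf d) n * f n) sums s"
  shows "integrable (measure_pmf (poisson_pmf d)) f" "measure_pmf.expectation (poisson_pmf d) f = s"
proof -
  have i: "integrable (count_space UNIV) (\<lambda>n. pmf (poisson_pmf d) n * f n)"
    unfolding integrable_count_space_nat_iff using abs by simp
  then show "integrable (measure_pmf (poisson_pmf d)) f"
    unfolding measure_pmf_eq_density by (subst integrable_density) auto
  have "measure_pmf.expectation (poisson_pmf d) f = integral\<^sup>L (count_space UNIV) (\<lambda>n. pmf (poisson_pmf d) n * f n)"
    unfolding measure_pmf_eq_density by (subst integral_density) auto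
  also have "\<dots> = (\<Sum>n. pmf (poisson_pmf d) n * f n)" by (rule integral_count_space_nat[OF i])
  also have "\<dots> = s" using s by (rule sums_unique[symmetric])
  finally show "measure_pmf.expectation (poisson_pmf d) f = s" .
qed

text \<open>The probability generating function, which is entire; absolute summability is read off
  from the series at \<open>\<bar>x\<bar>\<close>. It turns products over the incident clauses into
  exponentials.\<close>

lemma poisson_power:
  fixes x :: real
  assumes d: "0 < d"
  shows "integrable (measure_pmf (poisson_pmf d)) (\<lambda>n. x ^ n)"
    "measure_pmf.expectation (poisson_pmf d) (\<lambda>n. x ^ n) = exp (d * (x - 1))"
proof -
  have eq: "pmf (poisson_pmf d) n * y ^ n = exp (- d) * ((d * y) ^ n /\<^sub>R fact n)" for n and y :: real
    using d by (simp add: power_mult_distrib field_simps)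
  have s: "(\<lambda>n. pmf (poisson_pmf d) n * y ^ n) sums (exp (- d) * exp (d * y))" for y :: real
    unfolding eq by (intro sums_mult exp_converges)
  have a: "summable (\<lambda>n. \<bar>pmf (poisson_pmf d) n * x ^ n\<bar>)"
    using sums_summable[OF s[of "\<bar>x\<bar>"]] d by (simp add: abs_mult power_abs)
  show "integrable (measure_pmf (poisson_pmf d)) (\<lambda>n. x ^ n)" by (rule poisson_sums(1)[OF d a s])
  show "measure_pmf.expectation (poisson_pmf d) (\<lambda>n. x ^ n) = exp (d * (x - 1))"
    using poisson_sums(2)[OF d a s] by (simp add: exp_add[symmetric] algebra_simps)
qed

lemma poisson_mean:
  assumes d: "0 < d"
  shows "integrable (measure_pmf (poisson_pmf d)) real"
    "measure_pmf.expectation (poisson_pmf d) real = d"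
proof -
  have "(\<lambda>n. d * exp (- d) * (d ^ n /\<^sub>R fact n)) sums (d * exp (- d) * exp d)"
    by (intro sums_mult exp_converges)
  then have "(\<lambda>n. pmf (poisson_pmf d) (Suc n) * real (Suc n)) sums d"
    using d by (simp add: exp_minus field_simps del: of_nat_Suc)
  then have s: "(\<lambda>n. pmf (poisson_pmf d) n * real n) sums d"
    by (subst (asm) sums_Suc_iff) simp
  have a: "summable (\<lambda>n. \<bar>pmf (poisson_pmf d) n * real n\<bar>)"
    using sums_summable[OF s] d by (simp add: abs_mult)
  show "integrable (measure_pmf (poisson_pmf d)) real" "measure_pmf.expectation (poisson_pmf d) real = d"
    using poisson_sums[OF d a s] by auto
qed

section \<open>Independence of coordinates and of blocks of coordinates\<close>

lemma indep_vars_coordinates: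
  assumes M: "prob_space M"
  shows "prob_space.indep_vars (PiM (UNIV :: nat set) (\<lambda>_. M)) (\<lambda>_. M) (\<lambda>n \<omega>. \<omega> n) UNIV"
proof -
  interpret N: prob_space "PiM (UNIV :: nat set) (\<lambda>_. M)" using M by (intro prob_space_PiM)
  show ?thesis
  proof (subst N.indep_vars_iff_distr_eq_PiM')
    show "distr (PiM UNIV (\<lambda>_. M)) (PiM UNIV (\<lambda>_. M)) (\<lambda>x. \<lambda>i\<in>(UNIV :: nat set). x i) =
      PiM UNIV (\<lambda>i. distr (PiM UNIV (\<lambda>_. M)) M (\<lambda>\<omega>. \<omega> i))"
      using distr_PiM_component[of "UNIV :: nat set" "\<lambda>_. M"] M by (simp add: restrict_UNIV distr_id2)
  qed auto
qed

lemma integral_coordinate: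
  fixes f :: "'b \<Rightarrow> real"
  assumes M: "prob_space M" and f: "integrable M f"
  shows "integrable (PiM (UNIV :: nat set) (\<lambda>_. M)) (\<lambda>\<omega>. f (\<omega> n))"
    "(\<integral>\<omega>. f (\<omega> n) \<partial>PiM (UNIV :: nat set) (\<lambda>_. M)) = (\<integral>x. f x \<partial>M)"
proof -
  have d: "distr (PiM (UNIV :: nat set) (\<lambda>_. M)) M (\<lambda>\<omega>. \<omega> n) = M"
    using M by (intro distr_PiM_component) auto
  have m: "(\<lambda>\<omega>. \<omega> n) \<in> measurable (PiM (UNIV :: nat set) (\<lambda>_. M)) M" by simp
  show "integrable (PiM (UNIV :: nat set) (\<lambda>_. M)) (\<lambda>\<omega>. f (\<omega> n))"
    using f by (intro integrable_distr[OF m]) (simp add: d)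
  show "(\<integral>\<omega>. f (\<omega> n) \<partial>PiM (UNIV :: nat set) (\<lambda>_. M)) = (\<integral>x. f x \<partial>M)"
    using integral_distr[OF m, of f] f by (simp add: d)
qed

text \<open>The offset \<open>m\<close> is there for the i-th clause, which reads the coordinates
  following \<open>k * i\<close>.\<close>

lemma integral_prod_coordinates:
  fixes f :: "nat \<Rightarrow> 'b \<Rightarrow> real"
  assumes M: "prob_space M" and J: "finite J" and f: "\<And>n. n \<in> J \<Longrightarrow> integrable M (f n)"
  shows "(\<integral>\<omega>. (\<Prod>n\<in>J. f n (\<omega> (m + n))) \<partial>PiM UNIV (\<lambda>_. M)) = (\<Prod>n\<in>J. \<integral>x. f n x \<partial>M)"
    "integrable (PiM UNIV (\<lambda>_. M)) (\<lambda>\<omega>. \<Prod>n\<in>J. f n (\<omega> (m + n)))"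
proof -
  interpret N: prob_space "PiM (UNIV :: nat set) (\<lambda>_. M)" using M by (intro prob_space_PiM)
  have i: "N.indep_vars (\<lambda>_. borel) (\<lambda>n \<omega>. f (n - m) (\<omega> n)) ((+) m ` J)"
    using f by (intro N.indep_vars_compose2[OF N.indep_vars_subset[OF indep_vars_coordinates[OF M]]]) auto
  have e: "(\<Prod>n\<in>(+) m ` J. f (n - m) (\<omega> n)) = (\<Prod>n\<in>J. f n (\<omega> (m + n)))" for \<omega> :: "nat \<Rightarrow> 'b"
    by (subst prod.reindex) auto
  have "(\<integral>\<omega>. (\<Prod>n\<in>(+) m ` J. f (n - m) (\<omega> n)) \<partial>PiM UNIV (\<lambda>_. M)) =
      (\<Prod>n\<in>(+) m ` J. \<integral>\<omega>. f (n - m) (\<omega> n) \<partial>PiM UNIV (\<lambda>_. M))"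
    using J f by (intro N.indep_vars_lebesgue_integral i integral_coordinate(1) M) auto
  also have "\<dots> = (\<Prod>n\<in>J. \<integral>x. f n x \<partial>M)"
    using f by (subst prod.reindex) (auto simp: integral_coordinate(2)[OF M])
  finally show "(\<integral>\<omega>. (\<Prod>n\<in>J. f n (\<omega> (m + n))) \<partial>PiM UNIV (\<lambda>_. M)) = (\<Prod>n\<in>J. \<integral>x. f n x \<partial>M)"
    unfolding e .
  have "integrable (PiM UNIV (\<lambda>_. M)) (\<lambda>\<omega>. \<Prod>n\<in>(+) m ` J. f (n - m) (\<omega> n))"
    using J f by (intro N.indep_vars_integrable i integral_coordinate(1) M) auto
  then show "integrable (PiM UNIV (\<lambda>_. M)) (\<lambda>\<omega>. \<Prod>n\<in>J. f n (\<omega> (m + n)))" unfolding e .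
qed

text \<open>Block i occupies the positions k i + 1, ..., k i + k - 1; division by k recovers i, so
  the blocks are disjoint. By \<open>loc\<close> each factor is unchanged when the sequence is
  restricted to its block, which is the form that independence of restrictions requires.\<close>

lemma integral_prod_blocks:
  fixes g :: "nat \<Rightarrow> (nat \<Rightarrow> 'b) \<Rightarrow> real" and k :: nat
  assumes M: "prob_space M" and I: "finite I"
    and meas: "\<And>i. i \<in> I \<Longrightarrow> (\<lambda>r. g i (\<lambda>j. r (k * i + j))) \<in> borel_measurable (PiM ((+) (k * i) ` {1..k - 1}) (\<lambda>_. M))"
    and loc: "\<And>i r r'. i \<in> I \<Longrightarrow> (\<And>j. j \<in> {1..k - 1} \<Longrightarrow> r j = r' j) \<Longrightarrow> g i r = g i r'"
    and int: "\<And>i. i \<in> I \<Longrightarrow> integrable (PiM UNIV (\<lambda>_. M)) (\<lambda>\<omega>. g i (\<lambda>j. \<omega> (k * i + j)))"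
  shows "(\<integral>\<omega>. (\<Prod>i\<in>I. g i (\<lambda>j. \<omega> (k * i + j))) \<partial>PiM UNIV (\<lambda>_. M)) =
    (\<Prod>i\<in>I. \<integral>\<omega>. g i (\<lambda>j. \<omega> (k * i + j)) \<partial>PiM UNIV (\<lambda>_. M))"
proof -
  interpret N: prob_space "PiM (UNIV :: nat set) (\<lambda>_. M)" using M by (intro prob_space_PiM)
  let ?K = "\<lambda>i. (+) (k * i) ` {1..k - 1}"
  have disj: "disjoint_family_on ?K I"
    unfolding disjoint_family_on_def
  proof (intro ballI impI, rule ccontr)
    fix i i' assume "i \<noteq> i'" "?K i \<inter> ?K i' \<noteq> {}"
    then obtain j j' where "k * i + j = k * i' + j'" "j < k" "j' < k" by fastforce
    then have "(k * i + j) div k = (k * i' + j') div k" by simp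
    with \<open>j < k\<close> \<open>j' < k\<close> \<open>i \<noteq> i'\<close> show False by simp
  qed
  have "N.indep_vars (\<lambda>_. borel) (\<lambda>i \<omega>. (\<lambda>r. g i (\<lambda>j. r (k * i + j))) (restrict (\<lambda>n. \<omega> n) (?K i))) I"
    by (rule N.indep_vars_compose2[OF N.indep_vars_restrict[OF indep_vars_coordinates[OF M] _ disj]])
      (use meas in auto)
  moreover have "g i (\<lambda>j. restrict (\<lambda>n. \<omega> n) (?K i) (k * i + j)) = g i (\<lambda>j. \<omega> (k * i + j))" if "i \<in> I" for i \<omega>
    using that by (intro loc) auto
  ultimately have ind: "N.indep_vars (\<lambda>_. borel) (\<lambda>i \<omega>. g i (\<lambda>j. \<omega> (k * i + j))) I"
    by (subst N.indep_vars_cong[OF refl _ refl]) auto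
  show ?thesis by (rule N.indep_vars_lebesgue_integral[OF I ind int])
qed

text \<open>Z is symmetric and idempotent; hence a uniformly chosen row of Z has covariance Z/q, the
  starting point of the iteration.\<close>

lemma centering_idem:
  "(\<Sum>c\<in>UNIV. centering (c, a) * centering (c, b)) = centering (a, b :: 'a::finite)"
proof -
  have c: "centering (c, a) = (if c = a then 1 else 0) - 1 / real CARD('a)" for c
    by (simp add: centering_def)
  have "(\<Sum>c\<in>UNIV. centering (c, a) * centering (c, b)) =
     (\<Sum>c\<in>UNIV. (if c = a then centering (c, b) else 0) - 1 / real CARD('a) * centering (c, b))"
    unfolding c by (intro sum.cong refl) (auto simp: algebra_simps)
  then show ?thesis by (simp add: sum_subtractf flip: sum_divide_distrib)
qed

section \<open>Random vectors whose covariances are the iterates of Z\<close>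

context sym_model
begin

definition spread :: "((nat \<Rightarrow> 'a) \<Rightarrow> real) \<Rightarrow> ('a \<Rightarrow> real) \<Rightarrow> 'a \<Rightarrow> real" where
  "spread \<psi> x = (\<lambda>a. \<Sum>c\<in>UNIV. Phi k P \<psi> a c * x c)"

text \<open>The law is that of \<open>\<Phi>\<^sub>1 \<dots> \<Phi>\<^sub>n (e\<^sub>\<omega> - 1/q)\<close> with independent constraints and a uniform \<open>\<omega>\<close>.\<close>
lemma exists_vector_law:
  "\<exists>R :: ('a \<Rightarrow> real) pmf. finite (set_pmf R) \<and> (\<forall>x\<in>set_pmf R. (\<Sum>a\<in>UNIV. x a) = 0) \<and>
     (\<forall>a. measure_pmf.expectation R (\<lambda>x. x a) = 0) \<and>
     (\<forall>a b. measure_pmf.expectation R (\<lambda>x. x a * x b) = (apply_Xi k P ^^ n) centering (a, b) / real CARD('a))"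
proof (induction n)
  case 0
  let ?v = "\<lambda>c a. centering (c :: 'a, a)"
  let ?R = "map_pmf ?v (pmf_of_set (UNIV :: 'a set))"
  show ?case
    by (intro exI[of _ ?R] conjI allI ballI) (auto simp: integral_pmf_of_set centering_idem)
next
  case (Suc n)
  then obtain R :: "('a \<Rightarrow> real) pmf" where R: "finite (set_pmf R)" "\<And>x. x \<in> set_pmf R \<Longrightarrow> (\<Sum>a\<in>UNIV. x a) = 0"
    "\<And>a. measure_pmf.expectation R (\<lambda>x. x a) = 0"
    "\<And>a b. measure_pmf.expectation R (\<lambda>x. x a * x b) = (apply_Xi k P ^^ n) centering (a, b) / real CARD('a)"
    by blast
  let ?R = "bind_pmf P (\<lambda>\<psi>. map_pmf (spread \<psi>) R)"
  have ex: "measure_pmf.expectation ?R f = EP (\<lambda>\<psi>. measure_pmf.expectation R (\<lambda>x. f (spread \<psi> x)))" for f :: "('a \<Rightarrow> real) \<Rightarrow> real"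
    using R(1) by (subst pmf_expectation_bind[OF fin]) auto
  have int [simp]: "integrable (measure_pmf R) f" for f :: "('a \<Rightarrow> real) \<Rightarrow> real"
    by (rule integrable_measure_pmf_finite[OF R(1)])
  have s: "(\<Sum>a\<in>UNIV. spread \<psi> x a) = (\<Sum>c\<in>UNIV. x c)" if "\<psi> \<in> set_pmf P" for \<psi> x
    unfolding spread_def using Phi_column_sum[OF that]
    by (subst sum.swap) (simp flip: sum_distrib_right)
  have mean: "measure_pmf.expectation R (\<lambda>x. spread \<psi> x a) = 0" for \<psi> a
    unfolding spread_def by (simp add: R(3))
  have cov: "measure_pmf.expectation R (\<lambda>x. spread \<psi> x a * spread \<psi> x b) =
     (\<Sum>c\<in>UNIV. \<Sum>d\<in>UNIV. Phi k P \<psi> a c * Phi k P \<psi> b d * (apply_Xi k P ^^ n) centering (c, d)) / real CARD('a)" for \<psi> a b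
  proof -
    have "measure_pmf.expectation R (\<lambda>x. spread \<psi> x a * spread \<psi> x b) =
      measure_pmf.expectation R (\<lambda>x. \<Sum>c\<in>UNIV. \<Sum>d\<in>UNIV. Phi k P \<psi> a c * Phi k P \<psi> b d * (x c * x d))"
      unfolding spread_def sum_product by (simp add: mult_ac)
    then show ?thesis by (simp add: R(4) sum_divide_distrib)
  qed
  show ?case
  proof (intro exI[of _ ?R] conjI allI ballI)
    show "finite (set_pmf ?R)" using fin R(1) by simp
    show "(\<Sum>a\<in>UNIV. x a) = 0" if "x \<in> set_pmf ?R" for x using that s R(2) by auto
    show "measure_pmf.expectation ?R (\<lambda>x. x a) = 0" for a unfolding ex mean by simp
    show "measure_pmf.expectation ?R (\<lambda>x. x a * x b) = (apply_Xi k P ^^ Suc n) centering (a, b) / real CARD('a)" for a b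
      unfolding ex cov funpow.simps o_apply apply_Xi_eq
      by (simp only: times_divide_eq_right sum_divide_distrib[symmetric])
  qed
qed

text \<open>Z is the sum of the squares of its rows and \<Xi> Z is a nonnegative form. This yields a
  nonnegative Rayleigh quotient, so that the supremum defining \<open>d_KS\<close> cannot be
  negative.\<close>

lemma inner_apply_Xi_centering_nonneg: "0 \<le> inner_t (apply_Xi k P centering) centering"
proof -
  let ?v = "\<lambda>c a. centering (c :: 'a, a)"
  have "inner_t (apply_Xi k P centering) centering = (\<Sum>a\<in>UNIV. \<Sum>b\<in>UNIV. apply_Xi k P centering (a, b) * (\<Sum>c\<in>UNIV. ?v c a * ?v c b))"
    unfolding inner_t_def sum_UNIV_prod centering_idem ..
  also have "\<dots> = (\<Sum>a\<in>UNIV. \<Sum>c\<in>UNIV. \<Sum>b\<in>UNIV. apply_Xi k P centering (a, b) * (?v c a * ?v c b))"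
    unfolding sum_distrib_left by (intro sum.cong refl sum.swap)
  also have "\<dots> = (\<Sum>c\<in>UNIV. inner_t (apply_Xi k P centering) (tensor (?v c) (?v c)))"
    unfolding inner_t_tensor by (rule sum.swap)
  also have "0 \<le> \<dots>"
    unfolding inner_apply_Xi_tensor inner_t_centering by (intro sum_nonneg mult_nonneg_nonneg) auto
  finally show ?thesis .
qed

end

section \<open>Pointwise bounds on messages\<close>

text \<open>The unnormalised message of a clause to its last variable: the other k-1 variables are
  averaged out. The arguments \<open>r\<close> are numbered from 1, the coordinates of assignments
  from 0.\<close>

definition edge_message :: "nat \<Rightarrow> ((nat \<Rightarrow> 'a::finite) \<Rightarrow> real) \<Rightarrow> (nat \<Rightarrow> 'a \<Rightarrow> real) \<Rightarrow> 'a \<Rightarrow> real" where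
  "edge_message k \<psi> r s = (\<Sum>\<tau>\<in>Sig k. (if \<tau> (k - 1) = s then \<psi> \<tau> else 0) * (\<Prod>j\<in>{1..k - 1}. r j (\<tau> (j - 1))))"

definition clause_value :: "nat \<Rightarrow> ((nat \<Rightarrow> 'a::finite) \<Rightarrow> real) \<Rightarrow> (nat \<Rightarrow> 'a \<Rightarrow> real) \<Rightarrow> real" where
  "clause_value k \<psi> r = (\<Sum>\<tau>\<in>Sig k. \<psi> \<tau> * (\<Prod>j\<in>{1..k}. r j (\<tau> (j - 1))))"

text \<open>From 1 - 1/x \<le> ln x \<le> x - 1. A crude polynomial bound that serves to dominate
  the integrand.\<close>

lemma abs_Lam_le: "0 \<le> x \<Longrightarrow> \<bar>Lam x\<bar> \<le> 1 + x\<^sup>2"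
proof (cases "x = 0")
  case False
  assume "0 \<le> x"
  with False have x: "0 < x" by simp
  have "x * ln x \<le> x * (x - 1)" using x by (intro mult_left_mono ln_le_minus_one) auto
  moreover have "x * (1 - 1 / x) \<le> x * ln x"
    using x ln_le_minus_one[of "1 / x"] by (intro mult_left_mono) (auto simp: ln_div)
  moreover have "x * (1 - 1 / x) = x - 1" "x * (x - 1) = x\<^sup>2 - x" using x by (auto simp: field_simps power2_eq_square)
  ultimately have "x - 1 \<le> x * ln x" "x * ln x \<le> x\<^sup>2 - x" by auto
  then show ?thesis using x False unfolding Lam_def abs_le_iff
    by (auto intro: order_trans[of _ 1] add_increasing2) 
qed (simp add: Lam_def)

lemma Lam_measurable [measurable]: "Lam \<in> borel_measurable borel"
  unfolding Lam_def[abs_def] by measurable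

lemma abs_prod_le_one:
  fixes f :: "'b \<Rightarrow> real"
  assumes "\<And>i. i \<in> I \<Longrightarrow> \<bar>f i\<bar> \<le> 1"
  shows "\<bar>\<Prod>i\<in>I. f i\<bar> \<le> 1"
  unfolding abs_prod using assms by (intro prod_le_1) auto

lemma abs_edge_message_le:
  assumes "\<And>j a. \<bar>r j a\<bar> \<le> 1"
  shows "\<bar>edge_message k \<psi> r s\<bar> \<le> (\<Sum>\<tau>\<in>Sig k. \<bar>\<psi> \<tau>\<bar>)"
proof -
  have "\<bar>edge_message k \<psi> r s\<bar> \<le> (\<Sum>\<tau>\<in>Sig k. \<bar>(if \<tau> (k - 1) = s then \<psi> \<tau> else 0) * (\<Prod>j\<in>{1..k - 1}. r j (\<tau> (j - 1)))\<bar>)"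
    unfolding edge_message_def by (rule sum_abs)
  also have "\<dots> \<le> (\<Sum>\<tau>\<in>Sig k. \<bar>\<psi> \<tau>\<bar> * 1)"
    unfolding abs_mult using assms by (intro sum_mono mult_mono abs_prod_le_one) auto
  finally show ?thesis by simp
qed

lemma abs_clause_value_le:
  assumes "\<And>j a. \<bar>r j a\<bar> \<le> 1"
  shows "\<bar>clause_value k \<psi> r\<bar> \<le> (\<Sum>\<tau>\<in>Sig k. \<bar>\<psi> \<tau>\<bar>)"
proof -
  have "\<bar>clause_value k \<psi> r\<bar> \<le> (\<Sum>\<tau>\<in>Sig k. \<bar>\<psi> \<tau> * (\<Prod>j\<in>{1..k}. r j (\<tau> (j - 1)))\<bar>)"
    unfolding clause_value_def by (rule sum_abs)
  also have "\<dots> \<le> (\<Sum>\<tau>\<in>Sig k. \<bar>\<psi> \<tau>\<bar> * 1)"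
    unfolding abs_mult using assms by (intro sum_mono mult_mono abs_prod_le_one) auto
  finally show ?thesis by simp
qed

lemma prod_shift: "(\<Prod>j\<in>{1..m::nat}. f (j - 1)) = (\<Prod>j<m. f j)"
  using prod.atLeast1_atMost_eq[of "\<lambda>j. f (j - 1)" m] by simp

section \<open>Deterministic estimates near the uniform distribution\<close>

context sym_model
begin

context
  fixes r :: "nat \<Rightarrow> 'a \<Rightarrow> real" and b e :: real and \<psi>
  assumes p: "\<psi> \<in> set_pmf P"
    and r_sum: "\<And>j. (\<Sum>a\<in>UNIV. r j a) = 1"
    and r_near: "\<And>j a. \<bar>real CARD('a) * r j a - 1\<bar> \<le> b * e"
    and e: "0 \<le> e" "e \<le> 1" and b: "0 \<le> b"
begin

private abbreviation y where "y \<tau> j \<equiv> real CARD('a) * r j (\<tau> (j - 1)) - 1"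
private abbreviation pr where "pr m \<tau> \<equiv> (\<Prod>j\<in>{1..m}. 1 + y \<tau> j)"

private lemma prod_r: "(\<Prod>j\<in>{1..m}. r j (\<tau> (j - 1))) = pr m \<tau> / real CARD('a) ^ m"
  by (simp add: prod.distrib)

private lemma pr_near: "m \<le> k \<Longrightarrow> \<bar>pr m \<tau> - 1\<bar> \<le> e * (1 + b) ^ k"
proof -
  assume m: "m \<le> k"
  have "\<bar>pr m \<tau> - 1\<bar> \<le> e * ((1 + b) ^ card {1..m} - 1)"
    using r_near e b by (intro abs_prod_minus_one_le) auto
  also have "\<dots> \<le> e * (1 + b) ^ k" 
  proof (intro mult_left_mono e)
    have "(1 + b) ^ m \<le> (1 + b) ^ k" using m b by (intro power_increasing) auto
    then show "(1 + b) ^ card {1..m} - 1 \<le> (1 + b) ^ k" by simp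
  qed
  finally show ?thesis .
qed

private lemma pr_linear: "m \<le> k \<Longrightarrow> \<bar>pr m \<tau> - 1 - (\<Sum>j\<in>{1..m}. y \<tau> j)\<bar> \<le> e\<^sup>2 * (1 + b) ^ k"
proof -
  assume m: "m \<le> k"
  have "\<bar>pr m \<tau> - 1 - (\<Sum>j\<in>{1..m}. y \<tau> j)\<bar> \<le> e\<^sup>2 * (1 + b) ^ card {1..m}"
    using r_near e b by (intro abs_prod_minus_linear_le) auto
  also have "\<dots> \<le> e\<^sup>2 * (1 + b) ^ k" using m b by (intro mult_left_mono power_increasing) auto
  finally show ?thesis .
qed

text \<open>Pinning the last coordinate spoils the cancellation of linear terms, so a single entry
  of a message is controlled to order e only.\<close>

lemma edge_message_near:
  "\<bar>edge_message k \<psi> r s - xi k P\<bar> \<le> xi k P * (1 + b) ^ k * e"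
proof -
  let ?c = "\<lambda>\<tau>. \<psi> \<tau> * (if \<tau> (k - 1) = s then 1 else 0)" and ?Q = "real CARD('a) ^ (k - 1)"
  have sc: "(\<Sum>\<tau>\<in>Sig k. ?c \<tau>) = ?Q * xi k P" using k2 by (intro sym_marginal p) auto
  have "edge_message k \<psi> r s = (\<Sum>\<tau>\<in>Sig k. ?c \<tau> * pr (k - 1) \<tau>) / ?Q"
    unfolding edge_message_def prod_r sum_divide_distrib by (intro sum.cong) auto
  also have "\<dots> - xi k P = (\<Sum>\<tau>\<in>Sig k. ?c \<tau> * (pr (k - 1) \<tau> - 1)) / ?Q"
    using sc by (simp add: right_diff_distrib sum_subtractf diff_divide_distrib)
  also have "\<bar>\<dots>\<bar> \<le> (\<Sum>\<tau>\<in>Sig k. ?c \<tau> * (e * (1 + b) ^ k)) / ?Q"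
    unfolding abs_divide
  proof (intro frac_le)
    show "\<bar>\<Sum>\<tau>\<in>Sig k. ?c \<tau> * (pr (k - 1) \<tau> - 1)\<bar> \<le> (\<Sum>\<tau>\<in>Sig k. ?c \<tau> * (e * (1 + b) ^ k))"
    proof (rule order_trans[OF sum_abs], rule sum_mono)
      fix \<tau> :: "nat \<Rightarrow> 'a" assume "\<tau> \<in> Sig k"
      then have "0 \<le> ?c \<tau>" using range01[OF p] by auto
      then show "\<bar>?c \<tau> * (pr (k - 1) \<tau> - 1)\<bar> \<le> ?c \<tau> * (e * (1 + b) ^ k)"
        unfolding abs_mult[of "?c \<tau>"] using pr_near[of "k - 1" \<tau>] by (intro mult_mono) auto
    qed
  qed (use e b range01[OF p] in \<open>auto intro!: sum_nonneg mult_nonneg_nonneg\<close>)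
  also have "\<dots> = xi k P * (1 + b) ^ k * e"
    unfolding sum_distrib_right[symmetric] sc by simp
  finally show ?thesis .
qed

text \<open>Each linear term depends on one coordinate and sums to 0 over its values, because
  \<open>r j\<close> is a probability vector; SYM then removes it and only the quadratic error
  remains.\<close>

private lemma weighted_near:
  assumes m: "m \<le> k"
  shows "\<bar>(\<Sum>\<tau>\<in>Sig k. \<psi> \<tau> * pr m \<tau>) - real CARD('a) * W\<bar> \<le> real CARD('a) * W * (1 + b) ^ k * e\<^sup>2"
proof -
  have lin: "(\<Sum>\<tau>\<in>Sig k. \<psi> \<tau> * (\<Sum>j\<in>{1..m}. y \<tau> j)) = 0"
  proof -
    have "(\<Sum>\<tau>\<in>Sig k. \<psi> \<tau> * (\<Sum>j\<in>{1..m}. y \<tau> j)) = (\<Sum>j\<in>{1..m}. \<Sum>\<tau>\<in>Sig k. \<psi> \<tau> * y \<tau> j)"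
      unfolding sum_distrib_left by (rule sum.swap)
    also have "\<dots> = 0"
    proof (rule sum.neutral, rule ballI)
      fix j assume "j \<in> {1..m}"
      then have "(\<Sum>\<tau>\<in>Sig k. \<psi> \<tau> * y \<tau> j) = real CARD('a) ^ (k - 1) * xi k P * (\<Sum>a\<in>UNIV. real CARD('a) * r j a - 1)"
        using m by (intro one_coordinate p) auto
      also have "(\<Sum>a\<in>UNIV. real CARD('a) * r j a - 1) = 0"
        by (simp add: sum_subtractf r_sum flip: sum_distrib_left)
      finally show "(\<Sum>\<tau>\<in>Sig k. \<psi> \<tau> * y \<tau> j) = 0" by simp
    qed
    finally show ?thesis .
  qed
  have "(\<Sum>\<tau>\<in>Sig k. \<psi> \<tau> * pr m \<tau>) - real CARD('a) * W = (\<Sum>\<tau>\<in>Sig k. \<psi> \<tau> * pr m \<tau>) - (\<Sum>\<tau>\<in>Sig k. \<psi> \<tau>) -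
      (\<Sum>\<tau>\<in>Sig k. \<psi> \<tau> * (\<Sum>j\<in>{1..m}. y \<tau> j))"
    using sum_psi[OF p] lin by simp
  also have "\<dots> = (\<Sum>\<tau>\<in>Sig k. \<psi> \<tau> * (pr m \<tau> - 1 - (\<Sum>j\<in>{1..m}. y \<tau> j)))"
    unfolding sum_subtractf[symmetric] by (intro sum.cong refl) (simp only: right_diff_distrib mult_1_right)
  also have "\<bar>\<dots>\<bar> \<le> (\<Sum>\<tau>\<in>Sig k. \<psi> \<tau> * (e\<^sup>2 * (1 + b) ^ k))"
  proof (rule order_trans[OF sum_abs], rule sum_mono)
    fix \<tau> :: "nat \<Rightarrow> 'a" assume "\<tau> \<in> Sig k"
    then have "0 \<le> \<psi> \<tau>" using range01[OF p] by auto
    then show "\<bar>\<psi> \<tau> * (pr m \<tau> - 1 - (\<Sum>j\<in>{1..m}. y \<tau> j))\<bar> \<le> \<psi> \<tau> * (e\<^sup>2 * (1 + b) ^ k)"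
      unfolding abs_mult[of "\<psi> \<tau>"] using pr_linear[OF m, of \<tau>] by (intro mult_mono) auto
  qed
  also have "\<dots> = real CARD('a) * W * (1 + b) ^ k * e\<^sup>2"
    unfolding sum_distrib_right[symmetric] sum_psi[OF p] by simp
  finally show ?thesis .
qed

text \<open>Summing over \<open>s\<close> releases the pinned coordinate and the cancellation
  returns. This second-order control of the sum is what makes the vertex value deviate by e^2 and
  not e.\<close>

lemma sum_edge_message_near:
  "\<bar>(\<Sum>s\<in>UNIV. edge_message k \<psi> r s) - real CARD('a) * xi k P\<bar> \<le> real CARD('a) * xi k P * (1 + b) ^ k * e\<^sup>2"
proof -
  let ?Q = "real CARD('a) ^ (k - 1)"
  have "(\<Sum>s\<in>UNIV. edge_message k \<psi> r s) = (\<Sum>\<tau>\<in>Sig k. \<Sum>s\<in>UNIV. (if \<tau> (k - 1) = s then \<psi> \<tau> else 0) * (\<Prod>j\<in>{1..k - 1}. r j (\<tau> (j - 1))))"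
    unfolding edge_message_def by (rule sum.swap)
  also have "\<dots> = (\<Sum>\<tau>\<in>Sig k. \<psi> \<tau> * pr (k - 1) \<tau>) / ?Q"
    unfolding prod_r by (simp add: sum_divide_distrib flip: sum_distrib_right sum_divide_distrib)
  also have "\<dots> - real CARD('a) * xi k P = ((\<Sum>\<tau>\<in>Sig k. \<psi> \<tau> * pr (k - 1) \<tau>) - real CARD('a) * W) / ?Q"
    by (simp add: W_eq diff_divide_distrib)
  also have "\<bar>\<dots>\<bar> \<le> (real CARD('a) * W * (1 + b) ^ k * e\<^sup>2) / ?Q"
    unfolding abs_divide using weighted_near[of "k - 1"] by (simp add: divide_right_mono)
  also have "\<dots> = real CARD('a) * xi k P * (1 + b) ^ k * e\<^sup>2" by (simp add: W_eq)
  finally show ?thesis .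
qed

lemma clause_value_near:
  "\<bar>clause_value k \<psi> r - xi k P\<bar> \<le> xi k P * (1 + b) ^ k * e\<^sup>2"
proof -
  let ?Q = "real CARD('a) ^ k"
  have "clause_value k \<psi> r = (\<Sum>\<tau>\<in>Sig k. \<psi> \<tau> * pr k \<tau>) / ?Q"
    unfolding clause_value_def prod_r by (simp add: sum_divide_distrib)
  also have "\<dots> - xi k P = ((\<Sum>\<tau>\<in>Sig k. \<psi> \<tau> * pr k \<tau>) - real CARD('a) * W) / ?Q"
    by (simp add: W_eq diff_divide_distrib pow_q_eq)
  also have "\<bar>\<dots>\<bar> \<le> (real CARD('a) * W * (1 + b) ^ k * e\<^sup>2) / ?Q"
    unfolding abs_divide using weighted_near[of k] by (simp add: divide_right_mono)
  also have "\<dots> = xi k P * (1 + b) ^ k * e\<^sup>2" by (simp add: W_eq pow_q_eq)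
  finally show ?thesis .
qed

end

text \<open>The quadratic Taylor polynomial (x-1) + (x-1)^2/2 of x ln x at 1 equals (x^2-1)/2. Hence
  the bound is affine in the clause value and its square, whose means are computable.\<close>

lemma clause_term_upper:
  assumes near: "\<bar>c - xi k P\<bar> \<le> xi k P * B * e\<^sup>2" and small: "B * e\<^sup>2 \<le> 1 / 2"
  shows "Lam c / xi k P \<le> c / xi k P * ln (xi k P) + ((c / xi k P)\<^sup>2 - 1) / 2 + (B * e\<^sup>2) ^ 3"
proof -
  define x where "x = c / xi k P"
  have cx: "c = xi k P * x" using xi_pos by (simp add: x_def)
  have "c - xi k P = xi k P * (x - 1)" unfolding cx by (simp add: algebra_simps)
  then have "xi k P * \<bar>x - 1\<bar> = \<bar>c - xi k P\<bar>" using xi_pos by (simp add: abs_mult)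
  then have "xi k P * \<bar>x - 1\<bar> \<le> xi k P * (B * e\<^sup>2)" using near by (simp add: mult.assoc)
  then have x1: "\<bar>x - 1\<bar> \<le> B * e\<^sup>2" by (simp only: mult_le_cancel_left_pos[OF xi_pos])
  have x2: "\<bar>x - 1\<bar> \<le> 1 / 2" using x1 small by linarith
  then have x0: "0 < x" by linarith
  have "Lam c / xi k P = x * ln (xi k P) + x * ln x"
    using x0 xi_pos unfolding cx Lam_def by (simp add: ln_mult field_simps)
  also have "x * ln x \<le> (x - 1) + (x - 1)\<^sup>2 / 2 + \<bar>x - 1\<bar> ^ 3" by (rule xlnx_le_cubic[OF x2])
  also have "\<bar>x - 1\<bar> ^ 3 \<le> (B * e\<^sup>2) ^ 3" using x1 by (intro power_mono) auto
  finally show ?thesis unfolding x_def[symmetric] by (simp add: power2_eq_square field_simps)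
qed

text \<open>Expand the products over the clauses: the linear part, summed over \<open>s\<close>, is
  of order e^2 by \<open>near2\<close>, and the rest is of order e^2 by
  \<open>abs_prod_minus_linear_le\<close>. So the normalised value differs from 1 by at most 2 e^2
  (1+B)^n, where Bernoulli's inequality absorbs the factor n of the linear part; its cube is the
  error term.\<close>

lemma vertex_term_lower:
  fixes m :: "nat \<Rightarrow> 'a \<Rightarrow> real"
  assumes near: "\<And>i s. i \<in> {1..n} \<Longrightarrow> \<bar>m i s - xi k P\<bar> \<le> xi k P * B * e"
    and near2: "\<And>i. i \<in> {1..n} \<Longrightarrow> \<bar>(\<Sum>s\<in>UNIV. m i s) - real CARD('a) * xi k P\<bar> \<le> real CARD('a) * xi k P * B * e\<^sup>2"
    and e: "0 \<le> e" "e \<le> 1" and B: "0 \<le> B" and small: "B * e \<le> 1 / 2"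
  shows "(\<Sum>s\<in>UNIV. \<Prod>i\<in>{1..n}. m i s) / (real CARD('a) * xi k P ^ n) * (ln (real CARD('a)) + real n * ln (xi k P))
     + (((\<Sum>s\<in>UNIV. \<Prod>i\<in>{1..n}. m i s) / (real CARD('a) * xi k P ^ n))\<^sup>2 - 1) / 2 - 2 * e ^ 6 * ((1 + B) ^ 3) ^ n
    \<le> 1 / real CARD('a) * (1 / xi k P ^ n) * Lam (\<Sum>s\<in>UNIV. \<Prod>i\<in>{1..n}. m i s)"
proof -
  let ?q = "real CARD('a)" and ?x = "xi k P"
  define Y where "Y = (\<lambda>i s. m i s / ?x - 1)"
  have mY: "m i s = ?x * (1 + Y i s)" for i s using xi_pos by (simp add: Y_def)
  have Y1: "\<bar>Y i s\<bar> \<le> B * e" if "i \<in> {1..n}" for i s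
  proof -
    have "m i s - ?x = ?x * Y i s" unfolding mY by (simp add: algebra_simps)
    then have "?x * \<bar>Y i s\<bar> = \<bar>m i s - ?x\<bar>" using xi_pos by (simp add: abs_mult)
    then have "?x * \<bar>Y i s\<bar> \<le> ?x * (B * e)" using near[OF that, of s] by (simp add: mult.assoc)
    then show ?thesis by (simp only: mult_le_cancel_left_pos[OF xi_pos])
  qed
  have Y2: "\<bar>\<Sum>s\<in>UNIV. Y i s\<bar> \<le> ?q * B * e\<^sup>2" if "i \<in> {1..n}" for i
  proof -
    have "(\<Sum>s\<in>UNIV. m i s) - ?q * ?x = ?x * (\<Sum>s\<in>UNIV. Y i s)"
      unfolding mY by (simp add: sum_distrib_left algebra_simps sum.distrib)
    then have "?x * \<bar>\<Sum>s\<in>UNIV. Y i s\<bar> = \<bar>(\<Sum>s\<in>UNIV. m i s) - ?q * ?x\<bar>"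
      using xi_pos by (simp add: abs_mult)
    then have "?x * \<bar>\<Sum>s\<in>UNIV. Y i s\<bar> \<le> ?x * (?q * B * e\<^sup>2)" using near2[OF that] by (simp add: mult_ac)
    then show ?thesis using xi_pos by simp
  qed
  \<comment> \<open>The vertex value divided by its value q \<xi>^n at uniform messages.\<close>
  define A where "A = (\<Sum>s\<in>UNIV. \<Prod>i\<in>{1..n}. 1 + Y i s) / ?q"
  have S: "(\<Sum>s\<in>UNIV. \<Prod>i\<in>{1..n}. m i s) = ?q * ?x ^ n * A"
    unfolding mY A_def by (simp add: prod.distrib flip: sum_distrib_left)
  have A0: "0 < A" unfolding A_def
  proof (intro divide_pos_pos sum_pos prod_pos)
    fix i s assume "i \<in> {1..n}"
    with Y1[OF this, of s] small show "0 < 1 + Y i s" by linarith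
  qed auto
  have "?q * (A - 1) = (\<Sum>s\<in>UNIV. (\<Prod>i\<in>{1..n}. 1 + Y i s) - 1 - (\<Sum>i\<in>{1..n}. Y i s)) + (\<Sum>s\<in>UNIV. \<Sum>i\<in>{1..n}. Y i s)"
    unfolding A_def by (simp add: sum_subtractf right_diff_distrib)
  also have "(\<Sum>s\<in>UNIV. \<Sum>i\<in>{1..n}. Y i s) = (\<Sum>i\<in>{1..n}. \<Sum>s\<in>UNIV. Y i s)" by (rule sum.swap)
  finally have "\<bar>?q * (A - 1)\<bar> \<le> \<bar>\<Sum>s\<in>UNIV. (\<Prod>i\<in>{1..n}. 1 + Y i s) - 1 - (\<Sum>i\<in>{1..n}. Y i s)\<bar> + \<bar>\<Sum>i\<in>{1..n}. \<Sum>s\<in>UNIV. Y i s\<bar>"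
    by linarith
  also have "\<dots> \<le> (\<Sum>s\<in>(UNIV :: 'a set). e\<^sup>2 * (1 + B) ^ card {1..n}) + (\<Sum>i\<in>{1..n}. ?q * B * e\<^sup>2)"
  proof (rule add_mono)
    show "\<bar>\<Sum>s\<in>UNIV. (\<Prod>i\<in>{1..n}. 1 + Y i s) - 1 - (\<Sum>i\<in>{1..n}. Y i s)\<bar> \<le>
        (\<Sum>s\<in>(UNIV :: 'a set). e\<^sup>2 * (1 + B) ^ card {1..n})"
      using Y1 e B by (intro order_trans[OF sum_abs] sum_mono abs_prod_minus_linear_le) auto
    show "\<bar>\<Sum>i\<in>{1..n}. \<Sum>s\<in>UNIV. Y i s\<bar> \<le> (\<Sum>i\<in>{1..n}. ?q * B * e\<^sup>2)"
      by (rule order_trans[OF sum_abs], rule sum_mono, rule Y2)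
  qed
  also have "\<dots> = ?q * e\<^sup>2 * ((1 + B) ^ n + real n * B)" by (simp add: algebra_simps)
  also have "\<dots> \<le> ?q * e\<^sup>2 * ((1 + B) ^ n + (1 + B) ^ n)"
    using Bernoulli_inequality[of B n] B by (intro mult_left_mono add_left_mono) auto
  finally have "?q * \<bar>A - 1\<bar> \<le> ?q * (2 * e\<^sup>2 * (1 + B) ^ n)" unfolding abs_mult by (simp add: mult.assoc)
  then have A1: "\<bar>A - 1\<bar> \<le> 2 * e\<^sup>2 * (1 + B) ^ n" by (rule mult_left_le_imp_le) simp
  have "(A - 1) ^ 3 \<le> \<bar>A - 1\<bar> ^ 3" by (simp add: power_abs[symmetric])
  also have "\<dots> \<le> (2 * e\<^sup>2 * (1 + B) ^ n) ^ 3" using A1 by (intro power_mono) auto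
  also have "\<dots> = 8 * e ^ 6 * ((1 + B) ^ 3) ^ n"
    by (simp add: power_mult_distrib power_mult[symmetric] mult.commute)
  finally have "(A - 1) ^ 3 \<le> 8 * e ^ 6 * ((1 + B) ^ 3) ^ n" .
  \<comment> \<open>8/6 is rounded up to 2.\<close>
  then have cub: "(A - 1) ^ 3 / 6 \<le> 2 * e ^ 6 * ((1 + B) ^ 3) ^ n"
  proof -
    have "0 \<le> e ^ 6 * ((1 + B) ^ 3) ^ n" using e B by (intro mult_nonneg_nonneg zero_le_power) auto
    with \<open>(A - 1) ^ 3 \<le> 8 * e ^ 6 * ((1 + B) ^ 3) ^ n\<close> show ?thesis by linarith
  qed
  have "A * (ln ?q + real n * ln ?x) + (A\<^sup>2 - 1) / 2 - 2 * e ^ 6 * ((1 + B) ^ 3) ^ n \<le>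
     A * (ln ?q + real n * ln ?x) + ((A - 1) + (A - 1)\<^sup>2 / 2 - (A - 1) ^ 3 / 6)"
    using cub by (simp add: power2_eq_square field_simps)
  also have "\<dots> \<le> A * (ln ?q + real n * ln ?x) + A * ln A"
    using xlnx_ge_cubic[OF A0] by simp
  also have "\<dots> = 1 / ?q * (1 / ?x ^ n) * Lam (?q * ?x ^ n * A)"
    unfolding Lam_def using A0 xi_pos by (simp add: ln_mult ln_realpow algebra_simps)
  finally show ?thesis unfolding S using xi_pos by simp
qed

end

section \<open>Moments under the perturbed law\<close>

lemma AE_pair_fst:
  assumes "sigma_finite_measure M2" "AE x in M1. Q x"
  shows "AE w in M1 \<Otimes>\<^sub>M M2. Q (fst w)"
proof -
  interpret sigma_finite_measure M2 by fact
  obtain S where S: "{x \<in> space M1. \<not> Q x} \<subseteq> S" "emeasure M1 S = 0" "S \<in> sets M1"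
    using assms(2) by (rule AE_E)
  show ?thesis
    by (rule AE_I[where N = "S \<times> space M2"])
      (use S in \<open>auto simp: emeasure_pair_measure_Times space_pair_measure\<close>)
qed

lemma AE_pair_snd:
  assumes "sigma_finite_measure M2" "AE x in M2. Q x"
  shows "AE w in M1 \<Otimes>\<^sub>M M2. Q (snd w)"
proof -
  interpret sigma_finite_measure M2 by fact
  obtain S where S: "{x \<in> space M2. \<not> Q x} \<subseteq> S" "emeasure M2 S = 0" "S \<in> sets M2"
    using assms(2) by (rule AE_E)
  show ?thesis
    by (rule AE_I[where N = "space M1 \<times> S"])
      (use S in \<open>auto simp: emeasure_pair_measure_Times space_pair_measure\<close>)
qed

text \<open>Common form of \<open>edge_message\<close> and \<open>clause_value\<close>: they differ
  in the coefficients and in the number of averaged coordinates, so their moments are computed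
  once.\<close>

definition message_poly :: "nat \<Rightarrow> nat \<Rightarrow> ((nat \<Rightarrow> 'a::finite) \<Rightarrow> real) \<Rightarrow> (nat \<Rightarrow> 'a \<Rightarrow> real) \<Rightarrow> real" where
  "message_poly k n \<alpha> r = (\<Sum>\<tau>\<in>Sig k. \<alpha> \<tau> * (\<Prod>j\<in>{1..n}. r j (\<tau> (j - 1))))"

lemma edge_message_poly: "edge_message k \<psi> r s = message_poly k (k - 1) (\<lambda>\<tau>. if \<tau> (k - 1) = s then \<psi> \<tau> else 0) r"
  unfolding edge_message_def message_poly_def ..

lemma clause_value_poly: "clause_value k \<psi> r = message_poly k k \<psi> r"
  unfolding clause_value_def message_poly_def ..

text \<open>Of the perturbed atom only the mean, the covariance and an almost sure distance to the
  uniform vector enter. \<open>small\<close> makes the normalised messages positive and brings the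
  clause values into the range of the upper bound on x ln x.\<close>

locale message_law = sym_model P k
  for P :: "((nat \<Rightarrow> 'a::finite) \<Rightarrow> real) pmf" and k :: nat +
  fixes \<pi> :: "('a \<Rightarrow> real) measure" and z :: "'a \<times> 'a \<Rightarrow> real" and b e :: real
  assumes prob_pi: "prob_space \<pi>"
    and sets_pi: "sets \<pi> = sets (restrict_space (\<Pi>\<^sub>M \<omega>\<in>UNIV. (borel :: real measure)) prob_simplex)"
    and space_pi: "space \<pi> = prob_simplex"
    and mean_pi: "\<And>a. (\<integral>\<mu>. \<mu> a \<partial>\<pi>) = 1 / real CARD('a)"
    and cov_pi: "\<And>a c. (\<integral>\<mu>. \<mu> a * \<mu> c \<partial>\<pi>) = (1 + e\<^sup>2 * z (a, c)) / (real CARD('a))\<^sup>2"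
    and near_pi: "AE \<mu> in \<pi>. \<forall>a. \<bar>real CARD('a) * \<mu> a - 1\<bar> \<le> b * e"
    and e_pos: "0 < e" and b_nonneg: "0 \<le> b" and small: "(1 + b) ^ k * e \<le> 1 / 2"
begin

abbreviation N1 where "N1 \<equiv> \<Pi>\<^sub>M i\<in>(UNIV :: nat set). measure_pmf P"
abbreviation N2 where "N2 \<equiv> \<Pi>\<^sub>M i\<in>(UNIV :: nat set). \<pi>"
abbreviation NN where "NN \<equiv> N1 \<Otimes>\<^sub>M N2"

sublocale pi: prob_space \<pi> by (rule prob_pi)
sublocale N1: prob_space N1 by (intro prob_space_PiM measure_pmf.prob_space_axioms)
sublocale N2: prob_space N2 by (intro prob_space_PiM prob_pi)
sublocale NN: pair_prob_space N1 N2 ..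

lemma e_le_1: "e \<le> 1"
proof -
  have "1 * e \<le> (1 + b) ^ k * e" using b_nonneg e_pos by (intro mult_right_mono) auto
  with small show ?thesis by simp
qed

lemma eval_measurable [measurable]: "(\<lambda>\<mu>. \<mu> a) \<in> borel_measurable \<pi>"
  unfolding measurable_cong_sets[OF sets_pi refl]
  by (intro measurable_restrict_space1 measurable_component_singleton) auto

lemma simplex_bounds:
  assumes "\<mu> \<in> space \<pi>"
  shows "0 \<le> \<mu> a" "\<mu> a \<le> 1" "(\<Sum>a\<in>UNIV. \<mu> a) = 1"
proof -
  show n: "0 \<le> \<mu> a" for a using assms unfolding space_pi prob_simplex_def by auto
  show s: "(\<Sum>a\<in>UNIV. \<mu> a) = 1" using assms unfolding space_pi prob_simplex_def by auto
  show "\<mu> a \<le> 1" unfolding s[symmetric] using n by (intro member_le_sum) auto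
qed

lemma eval_integrable: "integrable \<pi> (\<lambda>\<mu>. \<mu> a)" "integrable \<pi> (\<lambda>\<mu>. \<mu> a * \<mu> c)"
proof -
  show "integrable \<pi> (\<lambda>\<mu>. \<mu> a)"
    by (rule pi.integrable_const_bound[where B = 1]) (auto simp: simplex_bounds intro!: AE_I2)
  show "integrable \<pi> (\<lambda>\<mu>. \<mu> a * \<mu> c)"
    by (rule pi.integrable_const_bound[where B = 1])
      (auto simp: simplex_bounds abs_mult intro!: AE_I2 mult_le_one)
qed

lemma message_poly_mean:
  "integrable N2 (\<lambda>\<rho>. message_poly k n \<alpha> (\<lambda>j. \<rho> (m + j)))"
  "(\<integral>\<rho>. message_poly k n \<alpha> (\<lambda>j. \<rho> (m + j)) \<partial>N2) = (\<Sum>\<tau>\<in>Sig k. \<alpha> \<tau>) / real CARD('a) ^ n"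
proof -
  have i: "integrable N2 (\<lambda>\<rho>. \<Prod>j\<in>{1..n}. \<rho> (m + j) (\<tau> (j - 1)))" for \<tau>
    by (rule integral_prod_coordinates(2)[OF prob_pi, where f = "\<lambda>j \<mu>. \<mu> (\<tau> (j - 1))"])
      (auto intro: eval_integrable)
  have v: "(\<integral>\<rho>. (\<Prod>j\<in>{1..n}. \<rho> (m + j) (\<tau> (j - 1))) \<partial>N2) = 1 / real CARD('a) ^ n" for \<tau>
    by (subst integral_prod_coordinates(1)[OF prob_pi, where f = "\<lambda>j \<mu>. \<mu> (\<tau> (j - 1))"])
      (auto intro: eval_integrable simp: mean_pi power_one_over)
  show "integrable N2 (\<lambda>\<rho>. message_poly k n \<alpha> (\<lambda>j. \<rho> (m + j)))"
    unfolding message_poly_def by (intro Bochner_Integration.integrable_sum integrable_mult_right i)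
  have "(\<integral>\<rho>. message_poly k n \<alpha> (\<lambda>j. \<rho> (m + j)) \<partial>N2) =
     (\<Sum>\<tau>\<in>Sig k. \<alpha> \<tau> * (\<integral>\<rho>. (\<Prod>j\<in>{1..n}. \<rho> (m + j) (\<tau> (j - 1))) \<partial>N2))"
    unfolding message_poly_def
    by (subst Bochner_Integration.integral_sum) (intro integrable_mult_right i, simp)
  then show "(\<integral>\<rho>. message_poly k n \<alpha> (\<lambda>j. \<rho> (m + j)) \<partial>N2) = (\<Sum>\<tau>\<in>Sig k. \<alpha> \<tau>) / real CARD('a) ^ n"
    unfolding v by (simp add: sum_divide_distrib)
qed

text \<open>A product of two polynomials is a sum over pairs of assignments, and the j-th
  coordinates of both are read by the same random vector. Independence over j leaves a product of
  mixed second moments, which is the origin of \<open>pair_weight\<close>.\<close>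

lemma message_poly_cov:
  "integrable N2 (\<lambda>\<rho>. message_poly k n \<alpha> (\<lambda>j. \<rho> (m + j)) * message_poly k n \<beta> (\<lambda>j. \<rho> (m + j)))"
  "(\<integral>\<rho>. message_poly k n \<alpha> (\<lambda>j. \<rho> (m + j)) * message_poly k n \<beta> (\<lambda>j. \<rho> (m + j)) \<partial>N2) =
     (\<Sum>\<tau>\<in>Sig k. \<Sum>\<tau>'\<in>Sig k. \<alpha> \<tau> * \<beta> \<tau>' * pair_weight n (e\<^sup>2) z \<tau> \<tau>') / (real CARD('a) ^ n)\<^sup>2"
proof -
  let ?p = "\<lambda>\<rho> \<tau> \<tau>'. \<Prod>j\<in>{1..n}. \<rho> (m + j) (\<tau> (j - 1) :: 'a) * \<rho> (m + j) (\<tau>' (j - 1)) :: real"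
  have i: "integrable N2 (\<lambda>\<rho>. ?p \<rho> \<tau> \<tau>')" for \<tau> \<tau>'
    by (rule integral_prod_coordinates(2)[OF prob_pi, where f = "\<lambda>j \<mu>. \<mu> (\<tau> (j - 1)) * \<mu> (\<tau>' (j - 1))"])
      (auto intro: eval_integrable)
  have v: "(\<integral>\<rho>. ?p \<rho> \<tau> \<tau>' \<partial>N2) = pair_weight n (e\<^sup>2) z \<tau> \<tau>' / (real CARD('a) ^ n)\<^sup>2" for \<tau> \<tau>'
  proof -
    have "(\<integral>\<rho>. ?p \<rho> \<tau> \<tau>' \<partial>N2) = (\<Prod>j\<in>{1..n}. (1 + e\<^sup>2 * z (\<tau> (j - 1), \<tau>' (j - 1))) / (real CARD('a))\<^sup>2)"
      by (subst integral_prod_coordinates(1)[OF prob_pi, where f = "\<lambda>j \<mu>. \<mu> (\<tau> (j - 1)) * \<mu> (\<tau>' (j - 1))"])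
        (auto intro: eval_integrable simp: cov_pi)
    also have "\<dots> = (\<Prod>j\<in>{1..n}. 1 + e\<^sup>2 * z (\<tau> (j - 1), \<tau>' (j - 1))) / (real CARD('a) ^ n)\<^sup>2"
      by (simp add: prod_dividef power_mult[symmetric] mult.commute)
    finally show ?thesis
      unfolding pair_weight_def prod_shift[of "\<lambda>j. 1 + e\<^sup>2 * z (\<tau> j, \<tau>' j)"] .
  qed
  have eq: "message_poly k n \<alpha> (\<lambda>j. \<rho> (m + j)) * message_poly k n \<beta> (\<lambda>j. \<rho> (m + j)) =
     (\<Sum>\<tau>\<in>Sig k. \<Sum>\<tau>'\<in>Sig k. \<alpha> \<tau> * \<beta> \<tau>' * ?p \<rho> \<tau> \<tau>')" for \<rho>
    unfolding message_poly_def sum_product prod.distrib by (simp add: mult_ac)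
  show "integrable N2 (\<lambda>\<rho>. message_poly k n \<alpha> (\<lambda>j. \<rho> (m + j)) * message_poly k n \<beta> (\<lambda>j. \<rho> (m + j)))"
    unfolding eq by (intro Bochner_Integration.integrable_sum integrable_mult_right i)
  have "(\<integral>\<rho>. message_poly k n \<alpha> (\<lambda>j. \<rho> (m + j)) * message_poly k n \<beta> (\<lambda>j. \<rho> (m + j)) \<partial>N2) =
     (\<Sum>\<tau>\<in>Sig k. \<integral>\<rho>. (\<Sum>\<tau>'\<in>Sig k. \<alpha> \<tau> * \<beta> \<tau>' * ?p \<rho> \<tau> \<tau>') \<partial>N2)"
    unfolding eq
    by (intro Bochner_Integration.integral_sum Bochner_Integration.integrable_sum integrable_mult_right i)
  also have "\<dots> = (\<Sum>\<tau>\<in>Sig k. \<Sum>\<tau>'\<in>Sig k. \<integral>\<rho>. \<alpha> \<tau> * \<beta> \<tau>' * ?p \<rho> \<tau> \<tau>' \<partial>N2)"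
    by (intro sum.cong refl Bochner_Integration.integral_sum integrable_mult_right i)
  also have "\<dots> = (\<Sum>\<tau>\<in>Sig k. \<Sum>\<tau>'\<in>Sig k. \<alpha> \<tau> * \<beta> \<tau>' * (\<integral>\<rho>. ?p \<rho> \<tau> \<tau>' \<partial>N2))"
    by (intro sum.cong refl integral_mult_right_zero)
  finally show "(\<integral>\<rho>. message_poly k n \<alpha> (\<lambda>j. \<rho> (m + j)) * message_poly k n \<beta> (\<lambda>j. \<rho> (m + j)) \<partial>N2) =
     (\<Sum>\<tau>\<in>Sig k. \<Sum>\<tau>'\<in>Sig k. \<alpha> \<tau> * \<beta> \<tau>' * pair_weight n (e\<^sup>2) z \<tau> \<tau>') / (real CARD('a) ^ n)\<^sup>2"
    unfolding v by (simp add: sum_divide_distrib)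
qed

lemma coordinates_measurable [measurable]:
  "(\<lambda>w. g (fst w i)) \<in> borel_measurable NN"
  "(\<lambda>w. snd w n a) \<in> borel_measurable NN"
proof -
  have g: "g \<in> borel_measurable (measure_pmf P)" by simp
  show "(\<lambda>w. g (fst w i)) \<in> borel_measurable NN" using g by measurable
  show "(\<lambda>w. snd w n a) \<in> borel_measurable NN"
    by (rule measurable_compose[OF _ eval_measurable]) measurable
qed

lemma edge_message_measurable [measurable]:
  "(\<lambda>w. edge_message k (fst w i) (\<lambda>j. snd w (m + j)) s) \<in> borel_measurable NN"
  unfolding edge_message_def
  by (intro borel_measurable_sum borel_measurable_times borel_measurable_prod coordinates_measurable)

lemma clause_value_measurable [measurable]:
  "(\<lambda>w. clause_value k (fst w i) (snd w)) \<in> borel_measurable NN"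
  unfolding clause_value_def
  by (intro borel_measurable_sum borel_measurable_times borel_measurable_prod coordinates_measurable)

lemma edge_message_block_measurable:
  "(\<lambda>r. edge_message k \<psi> (\<lambda>j. r (k * i + j)) s) \<in> borel_measurable (PiM ((+) (k * i) ` {1..k - 1}) (\<lambda>_. \<pi>))"
  unfolding edge_message_def
proof (intro borel_measurable_sum borel_measurable_times borel_measurable_prod)
  fix \<tau> :: "nat \<Rightarrow> 'a" and j assume "j \<in> {1..k - 1}"
  then show "(\<lambda>r. r (k * i + j) (\<tau> (j - 1))) \<in> borel_measurable (PiM ((+) (k * i) ` {1..k - 1}) (\<lambda>_. \<pi>))"
    by (intro measurable_compose[OF measurable_component_singleton[of "k * i + j"] eval_measurable[of "\<tau> (j - 1)"]]) auto
qed auto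

lemma edge_message_local:
  "(\<And>j. j \<in> {1..k - 1} \<Longrightarrow> r j = r' j) \<Longrightarrow> edge_message k \<psi> r s = edge_message k \<psi> r' s"
  unfolding edge_message_def by (intro sum.cong refl arg_cong2[where f = "(*)"] prod.cong) auto

lemma AE_typical:
  "AE w in NN. (\<forall>i. fst w i \<in> set_pmf P) \<and> (\<forall>n. snd w n \<in> space \<pi>) \<and>
     (\<forall>n a. \<bar>real CARD('a) * snd w n a - 1\<bar> \<le> b * e)"
proof -
  have "AE x in N1. \<forall>i. x i \<in> set_pmf P"
    unfolding AE_all_countable
    by (intro allI AE_PiM_component measure_pmf.prob_space_axioms) (auto simp: AE_measure_pmf)
  then have 1: "AE w in NN. \<forall>i. fst w i \<in> set_pmf P"
    by (intro AE_pair_fst N2.sigma_finite_measure_axioms)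
  have "AE x in N2. \<bar>real CARD('a) * x n a - 1\<bar> \<le> b * e" for n a
    by (rule AE_PiM_component[where P = "\<lambda>\<mu>. \<bar>real CARD('a) * \<mu> a - 1\<bar> \<le> b * e"])
      (use near_pi prob_pi in \<open>auto elim: eventually_mono\<close>)
  then have "AE x in N2. \<forall>n a. \<bar>real CARD('a) * x n a - 1\<bar> \<le> b * e" by (simp add: AE_all_countable)
  then have 2: "AE w in NN. \<forall>n a. \<bar>real CARD('a) * snd w n a - 1\<bar> \<le> b * e"
    by (intro AE_pair_snd N2.sigma_finite_measure_axioms)
  have 3: "AE w in NN. \<forall>n. snd w n \<in> space \<pi>"
    by (rule AE_I2) (auto simp: space_pair_measure space_PiM)
  show ?thesis using 1 2 3 by eventually_elim auto
qed

lemma abs_snd_le_1: "\<forall>n. snd w n \<in> space \<pi> \<Longrightarrow> \<bar>snd w n a\<bar> \<le> 1"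
  using simplex_bounds(1,2)[of "snd w n" a] by auto

lemma sum_abs_psi_le: "\<psi> \<in> set_pmf P \<Longrightarrow> (\<Sum>\<tau>\<in>Sig k. \<bar>\<psi> \<tau>\<bar>) \<le> real (card (Sig k :: (nat \<Rightarrow> 'a) set))"
  using sum_bounded_above[of "Sig k" "\<lambda>\<tau>. \<bar>\<psi> \<tau>\<bar>" "1::real"] range01[of \<psi>] by auto

text \<open>For fixed constraints the clauses read disjoint blocks of the second sequence, so
  integrating that sequence first leaves a product of functions of independent constraints. Almost
  sure boundedness licenses Fubini.\<close>

lemma block_expectation:
  fixes g :: "((nat \<Rightarrow> 'a) \<Rightarrow> real) \<Rightarrow> (nat \<Rightarrow> 'a \<Rightarrow> real) \<Rightarrow> real"
  assumes meas: "\<And>i. (\<lambda>w. g (fst w i) (\<lambda>j. snd w (k * i + j))) \<in> borel_measurable NN"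
    and mb: "\<And>i \<psi>. (\<lambda>r. g \<psi> (\<lambda>j. r (k * i + j))) \<in> borel_measurable (PiM ((+) (k * i) ` {1..k - 1}) (\<lambda>_. \<pi>))"
    and loc: "\<And>\<psi> r r'. (\<And>j. j \<in> {1..k - 1} \<Longrightarrow> r j = r' j) \<Longrightarrow> g \<psi> r = g \<psi> r'"
    and bnd: "\<And>\<psi> r. \<psi> \<in> set_pmf P \<Longrightarrow> (\<And>j a. \<bar>r j a\<bar> \<le> 1) \<Longrightarrow> \<bar>g \<psi> r\<bar> \<le> C"
    and int: "\<And>i \<psi>. integrable N2 (\<lambda>\<rho>. g \<psi> (\<lambda>j. \<rho> (k * i + j)))"
    and val: "\<And>i \<psi>. (\<integral>\<rho>. g \<psi> (\<lambda>j. \<rho> (k * i + j)) \<partial>N2) = v \<psi>"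
  shows "integrable NN (\<lambda>w. \<Prod>i\<in>{1..n}. g (fst w i) (\<lambda>j. snd w (k * i + j)))"
    "(\<integral>w. (\<Prod>i\<in>{1..n}. g (fst w i) (\<lambda>j. snd w (k * i + j))) \<partial>NN) = (EP v) ^ n"
proof -
  let ?X = "\<lambda>w. \<Prod>i\<in>{1..n}. g (fst w i) (\<lambda>j. snd w (k * i + j))"
  show i: "integrable NN ?X"
  proof (rule NN.integrable_const_bound[where B = "C ^ n"])
    show "AE w in NN. norm (?X w) \<le> C ^ n"
      using AE_typical
    proof eventually_elim
      case (elim w)
      have "norm (?X w) = (\<Prod>i\<in>{1..n}. \<bar>g (fst w i) (\<lambda>j. snd w (k * i + j))\<bar>)" by (simp add: abs_prod)
      also have "\<dots> \<le> (\<Prod>i\<in>{1..n}. C)"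
        using elim by (intro prod_mono conjI bnd abs_snd_le_1) auto
      finally show ?case by simp
    qed
    show "?X \<in> borel_measurable NN" by (intro borel_measurable_prod meas)
  qed
  have "(\<integral>w. ?X w \<partial>NN) = (\<integral>x. (\<integral>y. (\<Prod>i\<in>{1..n}. g (x i) (\<lambda>j. y (k * i + j))) \<partial>N2) \<partial>N1)"
    using NN.integral_fst'[OF i] by simp
  \<comment> \<open>The index \<open>0 + i\<close> matches the offset form of
    \<open>integral_prod_coordinates\<close>.\<close>
  also have "(\<lambda>x. \<integral>y. (\<Prod>i\<in>{1..n}. g (x i) (\<lambda>j. y (k * i + j))) \<partial>N2) = (\<lambda>x. \<Prod>i\<in>{1..n}. v (x (0 + i)))"
  proof
    fix x :: "nat \<Rightarrow> (nat \<Rightarrow> 'a) \<Rightarrow> real"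
    show "(\<integral>y. (\<Prod>i\<in>{1..n}. g (x i) (\<lambda>j. y (k * i + j))) \<partial>N2) = (\<Prod>i\<in>{1..n}. v (x (0 + i)))"
      using integral_prod_blocks[OF prob_pi, where g = "\<lambda>i. g (x i)" and I = "{1..n}", OF _ mb loc int]
      by (simp add: val)
  qed
  also have "(\<integral>x. (\<Prod>i\<in>{1..n}. v (x (0 + i))) \<partial>N1) = (\<Prod>i\<in>{1..n}. \<integral>\<psi>. v \<psi> \<partial>measure_pmf P)"
    by (intro integral_prod_coordinates measure_pmf.prob_space_axioms integrable_measure_pmf_finite fin) auto
  finally show "(\<integral>w. ?X w \<partial>NN) = (EP v) ^ n" by (simp add: expectation_P)
qed

abbreviation em where "em i s w \<equiv> edge_message k (fst w i) (\<lambda>j. snd w (k * i + j)) s"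

lemma edge_product_mean:
  "integrable NN (\<lambda>w. \<Prod>i\<in>{1..n}. em i s w)"
  "(\<integral>w. (\<Prod>i\<in>{1..n}. em i s w) \<partial>NN) = xi k P ^ n"
proof -
  let ?v = "\<lambda>\<psi>. (\<Sum>\<tau>\<in>Sig k. if \<tau> (k - 1) = s then \<psi> \<tau> else 0) / real CARD('a) ^ (k - 1)"
  have bnd: "\<bar>edge_message k \<psi> r s\<bar> \<le> real (card (Sig k :: (nat \<Rightarrow> 'a) set))"
    if "\<psi> \<in> set_pmf P" "\<And>j a. \<bar>r j a\<bar> \<le> 1" for \<psi> r
    using abs_edge_message_le[of r k \<psi> s] sum_abs_psi_le[of \<psi>] that by fastforce
  have int: "integrable N2 (\<lambda>\<rho>. edge_message k \<psi> (\<lambda>j. \<rho> (m + j)) s)"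
    and val: "(\<integral>\<rho>. edge_message k \<psi> (\<lambda>j. \<rho> (m + j)) s \<partial>N2) = ?v \<psi>" for \<psi> m
    unfolding edge_message_poly by (rule message_poly_mean)+
  note b = block_expectation[where g = "\<lambda>\<psi> r. edge_message k \<psi> r s" and v = ?v,
      OF edge_message_measurable edge_message_block_measurable edge_message_local bnd int val]
  show "integrable NN (\<lambda>w. \<Prod>i\<in>{1..n}. em i s w)" by (rule b(1)) assumption+
  have "?v \<psi> = xi k P" if "\<psi> \<in> set_pmf P" for \<psi>
    using sym_marginal[of "k - 1" \<psi> s] that k2 by (simp add: if_distrib cong: if_cong)
  then have "EP ?v = EP (\<lambda>_. xi k P)" by (intro sum.cong) auto
  moreover have "(\<integral>w. (\<Prod>i\<in>{1..n}. em i s w) \<partial>NN) = EP ?v ^ n" by (rule b(2)) assumption+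
  ultimately show "(\<integral>w. (\<Prod>i\<in>{1..n}. em i s w) \<partial>NN) = xi k P ^ n" by (simp only: EP_const)
qed

lemma edge_product_cov:
  "integrable NN (\<lambda>w. \<Prod>i\<in>{1..n}. em i s w * em i s' w)"
  "(\<integral>w. (\<Prod>i\<in>{1..n}. em i s w * em i s' w) \<partial>NN) = ((xi k P)\<^sup>2 * (1 + message_cov (e\<^sup>2) z s s')) ^ n"
proof -
  let ?v = "\<lambda>\<psi>. (\<Sum>\<tau>\<in>Sig k. \<Sum>\<tau>'\<in>Sig k. (if \<tau> (k - 1) = s then \<psi> \<tau> else 0) * (if \<tau>' (k - 1) = s' then \<psi> \<tau>' else 0) *
     pair_weight (k - 1) (e\<^sup>2) z \<tau> \<tau>') / (real CARD('a) ^ (k - 1))\<^sup>2"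
  have bnd: "\<bar>edge_message k \<psi> r s * edge_message k \<psi> r s'\<bar> \<le> (real (card (Sig k :: (nat \<Rightarrow> 'a) set)))\<^sup>2"
    if "\<psi> \<in> set_pmf P" "\<And>j a. \<bar>r j a\<bar> \<le> 1" for \<psi> r
    unfolding abs_mult power2_eq_square
    using order_trans[OF abs_edge_message_le sum_abs_psi_le] that by (intro mult_mono) auto
  have int: "integrable N2 (\<lambda>\<rho>. edge_message k \<psi> (\<lambda>j. \<rho> (m + j)) s * edge_message k \<psi> (\<lambda>j. \<rho> (m + j)) s')"
    and val: "(\<integral>\<rho>. edge_message k \<psi> (\<lambda>j. \<rho> (m + j)) s * edge_message k \<psi> (\<lambda>j. \<rho> (m + j)) s' \<partial>N2) = ?v \<psi>" for \<psi> m
    unfolding edge_message_poly by (rule message_poly_cov)+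
  have loc: "edge_message k \<psi> r s * edge_message k \<psi> r s' = edge_message k \<psi> r' s * edge_message k \<psi> r' s'"
    if "\<And>j. j \<in> {1..k - 1} \<Longrightarrow> r j = r' j" for \<psi> r r'
    using edge_message_local[of r r', OF that] by simp
  note b = block_expectation[where g = "\<lambda>\<psi> r. edge_message k \<psi> r s * edge_message k \<psi> r s'" and v = ?v,
      OF borel_measurable_times[OF edge_message_measurable edge_message_measurable]
      borel_measurable_times[OF edge_message_block_measurable edge_message_block_measurable] loc bnd int val]
  show "integrable NN (\<lambda>w. \<Prod>i\<in>{1..n}. em i s w * em i s' w)" by (rule b(1)) assumption+
  have v: "(\<integral>w. (\<Prod>i\<in>{1..n}. em i s w * em i s' w) \<partial>NN) = EP ?v ^ n" by (rule b(2)) assumption+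
  have "EP ?v = (xi k P)\<^sup>2 * (1 + message_cov (e\<^sup>2) z s s')"
  proof -
    have pt: "(if A then x else 0) * (if B then y else 0) * w = x * y * ((if A \<and> B then 1 else 0) * w)"
      for A B and x y w :: real by auto
    have "EP ?v = EP (\<lambda>\<psi>. \<Sum>\<tau>\<in>Sig k. \<Sum>\<tau>'\<in>Sig k. \<psi> \<tau> * \<psi> \<tau>' *
     ((if \<tau> (k - 1) = s \<and> \<tau>' (k - 1) = s' then 1 else 0) * pair_weight (k - 1) (e\<^sup>2) z \<tau> \<tau>')) / (real CARD('a) ^ (k - 1))\<^sup>2"
      unfolding times_divide_eq_right sum_divide_distrib[symmetric] pt ..
    also have "\<dots> = (1 + message_cov (e\<^sup>2) z s s') * W\<^sup>2 / (real CARD('a) ^ (k - 1))\<^sup>2"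
      unfolding message_cov_def using W_pos by simp
    also have "\<dots> = (xi k P)\<^sup>2 * (1 + message_cov (e\<^sup>2) z s s')"
      unfolding W_eq by (simp add: power_mult_distrib)
    finally show ?thesis .
  qed
  then show "(\<integral>w. (\<Prod>i\<in>{1..n}. em i s w * em i s' w) \<partial>NN) = ((xi k P)\<^sup>2 * (1 + message_cov (e\<^sup>2) z s s')) ^ n"
    unfolding v by simp
qed

lemma clause_value_moments:
  "integrable NN (\<lambda>w. clause_value k (fst w i) (snd w))"
  "(\<integral>w. clause_value k (fst w i) (snd w) \<partial>NN) = xi k P"
  "integrable NN (\<lambda>w. (clause_value k (fst w i) (snd w))\<^sup>2)"
  "(\<integral>w. (clause_value k (fst w i) (snd w))\<^sup>2 \<partial>NN) = (xi k P)\<^sup>2 * (pair_moment k (e\<^sup>2) z / (real CARD('a))\<^sup>2)"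
proof -
  have bnd: "AE w in NN. \<bar>clause_value k (fst w i) (snd w)\<bar> \<le> real (card (Sig k :: (nat \<Rightarrow> 'a) set))"
    using AE_typical
  proof eventually_elim
    case (elim w)
    then show ?case
      by (intro order_trans[OF abs_clause_value_le sum_abs_psi_le] abs_snd_le_1) auto
  qed
  show i1: "integrable NN (\<lambda>w. clause_value k (fst w i) (snd w))"
    by (rule NN.integrable_const_bound[OF _ clause_value_measurable]) (use bnd in auto)
  show i2: "integrable NN (\<lambda>w. (clause_value k (fst w i) (snd w))\<^sup>2)"
    by (rule NN.integrable_const_bound[where B = "(real (card (Sig k :: (nat \<Rightarrow> 'a) set)))\<^sup>2"])
      (use bnd in \<open>auto elim!: eventually_mono simp: power_abs[symmetric] power2_le_iff_abs_le abs_le_square_iff\<close>)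
  have coord: "(\<integral>x. f (x i) \<partial>N1) = EP f" for f
    using integral_coordinate(2)[OF measure_pmf.prob_space_axioms integrable_measure_pmf_finite[OF fin], of f i]
    by (simp add: expectation_P)
  have "(\<integral>w. clause_value k (fst w i) (snd w) \<partial>NN) = (\<integral>x. (\<integral>y. clause_value k (x i) y \<partial>N2) \<partial>N1)"
    using NN.integral_fst'[OF i1] by simp
  also have "\<dots> = EP (\<lambda>\<psi>. (\<Sum>\<tau>\<in>Sig k. \<psi> \<tau>) / real CARD('a) ^ k)"
    unfolding clause_value_poly coord[of "\<lambda>\<psi>. (\<Sum>\<tau>\<in>Sig k. \<psi> \<tau>) / real CARD('a) ^ k", symmetric]
    using message_poly_mean(2)[of k _ 0] by simp
  also have "\<dots> = EP (\<lambda>_. xi k P)"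
    by (intro sum.cong refl) (simp add: sum_psi W_eq pow_q_eq)
  finally show "(\<integral>w. clause_value k (fst w i) (snd w) \<partial>NN) = xi k P" unfolding EP_const .
  have "(\<integral>w. (clause_value k (fst w i) (snd w))\<^sup>2 \<partial>NN) = (\<integral>x. (\<integral>y. (clause_value k (x i) y)\<^sup>2 \<partial>N2) \<partial>N1)"
    using NN.integral_fst'[OF i2] by simp
  also have "\<dots> = EP (\<lambda>\<psi>. (\<Sum>\<tau>\<in>Sig k. \<Sum>\<tau>'\<in>Sig k. \<psi> \<tau> * \<psi> \<tau>' * pair_weight k (e\<^sup>2) z \<tau> \<tau>') / (real CARD('a) ^ k)\<^sup>2)"
    unfolding clause_value_poly power2_eq_square[of "message_poly _ _ _ _"]
      coord[of "\<lambda>\<psi>. (\<Sum>\<tau>\<in>Sig k. \<Sum>\<tau>'\<in>Sig k. \<psi> \<tau> * \<psi> \<tau>' * pair_weight k (e\<^sup>2) z \<tau> \<tau>') / (real CARD('a) ^ k)\<^sup>2", symmetric]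
    using message_poly_cov(2)[of k _ 0] by simp
  also have "\<dots> = EP (\<lambda>\<psi>. (\<Sum>\<tau>\<in>Sig k. \<Sum>\<tau>'\<in>Sig k. \<psi> \<tau> * \<psi> \<tau>' * pair_weight k (e\<^sup>2) z \<tau> \<tau>')) / (real CARD('a) ^ k)\<^sup>2"
    unfolding times_divide_eq_right sum_divide_distrib[symmetric] ..
  also have "\<dots> = pair_moment k (e\<^sup>2) z * W\<^sup>2 / (real CARD('a) ^ k)\<^sup>2"
    unfolding pair_moment_def using W_pos by simp
  also have "\<dots> = (xi k P)\<^sup>2 * (pair_moment k (e\<^sup>2) z / (real CARD('a))\<^sup>2)"
    unfolding W_eq pow_q_eq by (simp add: power_mult_distrib)
  finally show "(\<integral>w. (clause_value k (fst w i) (snd w))\<^sup>2 \<partial>NN) = (xi k P)\<^sup>2 * (pair_moment k (e\<^sup>2) z / (real CARD('a))\<^sup>2)" .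
qed

end

section \<open>Lower bound on the Bethe functional\<close>

lemma (in prob_space) integral_affine:
  fixes f1 f2 f3 f4 :: "'a \<Rightarrow> real"
  assumes "integrable M f1" "integrable M f2" "integrable M f3" "integrable M f4"
  shows "integrable M (\<lambda>w. u * f1 w + v * f2 w - x * f3 w - y * f4 w + t)"
    "(\<integral>w. u * f1 w + v * f2 w - x * f3 w - y * f4 w + t \<partial>M) =
      u * (\<integral>w. f1 w \<partial>M) + v * (\<integral>w. f2 w \<partial>M) - x * (\<integral>w. f3 w \<partial>M) - y * (\<integral>w. f4 w \<partial>M) + t"
  using assms by (simp_all add: prob_space)

section \<open>A quadratic minorant of the integrand and its mean\<close>

context message_law
begin

abbreviation B :: real where "B \<equiv> (1 + b) ^ k"

definition bethe_integrand :: "real \<Rightarrow> nat \<Rightarrow> (nat \<Rightarrow> (nat \<Rightarrow> 'a) \<Rightarrow> real) \<times> (nat \<Rightarrow> 'a \<Rightarrow> real) \<Rightarrow> real" where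
  "bethe_integrand d n w = 1 / real CARD('a) * (1 / xi k P ^ n) * Lam (\<Sum>s\<in>UNIV. \<Prod>i\<in>{1..n}. em i s w) -
     (d * (real k - 1) / (real k * xi k P)) * Lam (clause_value k (fst w 1) (snd w))"

text \<open>Both occurrences of \<open>Lam\<close> are replaced by quadratics, from below in the
  vertex term and from above in the subtracted clause term.\<close>

definition bethe_lower :: "real \<Rightarrow> nat \<Rightarrow> (nat \<Rightarrow> (nat \<Rightarrow> 'a) \<Rightarrow> real) \<times> (nat \<Rightarrow> 'a \<Rightarrow> real) \<Rightarrow> real" where
  "bethe_lower d n w =
     (\<Sum>s\<in>UNIV. \<Prod>i\<in>{1..n}. em i s w) / (real CARD('a) * xi k P ^ n) * (ln (real CARD('a)) + real n * ln (xi k P))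
     + (((\<Sum>s\<in>UNIV. \<Prod>i\<in>{1..n}. em i s w) / (real CARD('a) * xi k P ^ n))\<^sup>2 - 1) / 2 - 2 * e ^ 6 * ((1 + B) ^ 3) ^ n
     - d * (real k - 1) / real k * (clause_value k (fst w 1) (snd w) / xi k P * ln (xi k P)
       + ((clause_value k (fst w 1) (snd w) / xi k P)\<^sup>2 - 1) / 2 + (B * e\<^sup>2) ^ 3)"

lemma bethe_lower_le:
  assumes d: "0 < d" and w: "\<forall>i. fst w i \<in> set_pmf P" "\<forall>n. snd w n \<in> space \<pi>"
    "\<forall>n a. \<bar>real CARD('a) * snd w n a - 1\<bar> \<le> b * e"
  shows "bethe_lower d n w \<le> bethe_integrand d n w"
proof -
  let ?c = "clause_value k (fst w 1) (snd w)"
  have v: "(\<Sum>s\<in>UNIV. \<Prod>i\<in>{1..n}. em i s w) / (real CARD('a) * xi k P ^ n) * (ln (real CARD('a)) + real n * ln (xi k P))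
     + (((\<Sum>s\<in>UNIV. \<Prod>i\<in>{1..n}. em i s w) / (real CARD('a) * xi k P ^ n))\<^sup>2 - 1) / 2 - 2 * e ^ 6 * ((1 + B) ^ 3) ^ n
    \<le> 1 / real CARD('a) * (1 / xi k P ^ n) * Lam (\<Sum>s\<in>UNIV. \<Prod>i\<in>{1..n}. em i s w)"
    by (rule vertex_term_lower; (rule edge_message_near sum_edge_message_near)?)
      (use w e_pos e_le_1 b_nonneg small simplex_bounds(3) in auto)
  have "B * e\<^sup>2 \<le> B * e" using e_pos e_le_1 b_nonneg
    by (intro mult_left_mono) (auto simp: power2_eq_square mult_le_cancel_left1)
  with small have "B * e\<^sup>2 \<le> 1 / 2" by linarith
  then have "Lam ?c / xi k P \<le> ?c / xi k P * ln (xi k P) + ((?c / xi k P)\<^sup>2 - 1) / 2 + (B * e\<^sup>2) ^ 3"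
    using w e_pos e_le_1 b_nonneg simplex_bounds(3)
    by (intro clause_term_upper clause_value_near) auto
  then have "d * (real k - 1) / real k * (Lam ?c / xi k P) \<le>
      d * (real k - 1) / real k * (?c / xi k P * ln (xi k P) + ((?c / xi k P)\<^sup>2 - 1) / 2 + (B * e\<^sup>2) ^ 3)"
    using d k2 by (intro mult_left_mono) auto
  moreover have "d * (real k - 1) / real k * (Lam ?c / xi k P) = d * (real k - 1) / (real k * xi k P) * Lam ?c" by simp
  ultimately show ?thesis using v unfolding bethe_lower_def bethe_integrand_def by linarith
qed

lemma vertex_sum_moments:
  "integrable NN (\<lambda>w. \<Sum>s\<in>UNIV. \<Prod>i\<in>{1..n}. em i s w)"
  "(\<integral>w. (\<Sum>s\<in>UNIV. \<Prod>i\<in>{1..n}. em i s w) \<partial>NN) = real CARD('a) * xi k P ^ n"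
  "integrable NN (\<lambda>w. (\<Sum>s\<in>UNIV. \<Prod>i\<in>{1..n}. em i s w)\<^sup>2)"
  "(\<integral>w. (\<Sum>s\<in>UNIV. \<Prod>i\<in>{1..n}. em i s w)\<^sup>2 \<partial>NN) =
     (xi k P ^ n)\<^sup>2 * (\<Sum>s\<in>UNIV. \<Sum>s'\<in>UNIV. (1 + message_cov (e\<^sup>2) z s s') ^ n)"
proof -
  show "integrable NN (\<lambda>w. \<Sum>s\<in>UNIV. \<Prod>i\<in>{1..n}. em i s w)"
    by (intro Bochner_Integration.integrable_sum edge_product_mean)
  have "(\<integral>w. (\<Sum>s\<in>UNIV. \<Prod>i\<in>{1..n}. em i s w) \<partial>NN) = (\<Sum>s\<in>UNIV. \<integral>w. (\<Prod>i\<in>{1..n}. em i s w) \<partial>NN)"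
    by (intro Bochner_Integration.integral_sum edge_product_mean)
  then show "(\<integral>w. (\<Sum>s\<in>UNIV. \<Prod>i\<in>{1..n}. em i s w) \<partial>NN) = real CARD('a) * xi k P ^ n"
    unfolding edge_product_mean(2) by simp
  have sq: "(\<Sum>s\<in>UNIV. \<Prod>i\<in>{1..n}. em i s w)\<^sup>2 = (\<Sum>s\<in>UNIV. \<Sum>s'\<in>UNIV. \<Prod>i\<in>{1..n}. em i s w * em i s' w)" for w
    unfolding power2_eq_square sum_product prod.distrib ..
  show "integrable NN (\<lambda>w. (\<Sum>s\<in>UNIV. \<Prod>i\<in>{1..n}. em i s w)\<^sup>2)"
    unfolding sq by (intro Bochner_Integration.integrable_sum edge_product_cov)
  have "(\<integral>w. (\<Sum>s\<in>UNIV. \<Prod>i\<in>{1..n}. em i s w)\<^sup>2 \<partial>NN) =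
      (\<Sum>s\<in>UNIV. \<integral>w. (\<Sum>s'\<in>UNIV. \<Prod>i\<in>{1..n}. em i s w * em i s' w) \<partial>NN)"
    unfolding sq by (intro Bochner_Integration.integral_sum Bochner_Integration.integrable_sum edge_product_cov)
  also have "\<dots> = (\<Sum>s\<in>UNIV. \<Sum>s'\<in>UNIV. \<integral>w. (\<Prod>i\<in>{1..n}. em i s w * em i s' w) \<partial>NN)"
    by (intro sum.cong refl Bochner_Integration.integral_sum edge_product_cov)
  also have "\<dots> = (xi k P ^ n)\<^sup>2 * (\<Sum>s\<in>UNIV. \<Sum>s'\<in>UNIV. (1 + message_cov (e\<^sup>2) z s s') ^ n)"
    unfolding edge_product_cov(2) sum_distrib_left
    by (simp add: power_mult_distrib power_mult[symmetric] mult.commute)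
  finally show "(\<integral>w. (\<Sum>s\<in>UNIV. \<Prod>i\<in>{1..n}. em i s w)\<^sup>2 \<partial>NN) =
     (xi k P ^ n)\<^sup>2 * (\<Sum>s\<in>UNIV. \<Sum>s'\<in>UNIV. (1 + message_cov (e\<^sup>2) z s s') ^ n)" .
qed

definition bethe_mean :: "real \<Rightarrow> nat \<Rightarrow> real" where
  "bethe_mean d n = ln (real CARD('a)) + real n * ln (xi k P)
     + ((\<Sum>s\<in>UNIV. \<Sum>s'\<in>UNIV. (1 + message_cov (e\<^sup>2) z s s') ^ n) / (real CARD('a))\<^sup>2 - 1) / 2 - 2 * e ^ 6 * ((1 + B) ^ 3) ^ n
     - d * (real k - 1) / real k * (ln (xi k P) + (pair_moment k (e\<^sup>2) z / (real CARD('a))\<^sup>2 - 1) / 2 + (B * e\<^sup>2) ^ 3)"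

text \<open>The vertex and the clause term share the constraint with index 1 and are not
  independent, but the minorant has no mixed products, so linearity of the integral is
  enough.\<close>

lemma bethe_lower_mean:
  "integrable NN (bethe_lower d n)" "(\<integral>w. bethe_lower d n w \<partial>NN) = bethe_mean d n"
proof -
  let ?S = "\<lambda>w. \<Sum>s\<in>UNIV. \<Prod>i\<in>{1..n}. em i s w" and ?C = "\<lambda>w. clause_value k (fst w 1) (snd w)"
  let ?u = "(ln (real CARD('a)) + real n * ln (xi k P)) / (real CARD('a) * xi k P ^ n)"
  let ?v = "1 / (2 * (real CARD('a) * xi k P ^ n)\<^sup>2)" and ?D = "d * (real k - 1) / real k"
  let ?x = "?D * ln (xi k P) / xi k P" and ?y = "?D / (2 * (xi k P)\<^sup>2)"
  let ?t = "- 1 / 2 - 2 * e ^ 6 * ((1 + B) ^ 3) ^ n + ?D / 2 - ?D * (B * e\<^sup>2) ^ 3"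
  have eq: "bethe_lower d n = (\<lambda>w. ?u * ?S w + ?v * (?S w)\<^sup>2 - ?x * ?C w - ?y * (?C w)\<^sup>2 + ?t)"
    unfolding bethe_lower_def by (rule ext) (simp add: power_divide diff_divide_distrib algebra_simps)
  note i = vertex_sum_moments[of n] clause_value_moments[of 1]
  show "integrable NN (bethe_lower d n)"
    unfolding eq by (rule NN.integral_affine(1)[OF i(1,3,5,7)])
  have "(\<integral>w. bethe_lower d n w \<partial>NN) = ?u * (\<integral>w. ?S w \<partial>NN) + ?v * (\<integral>w. (?S w)\<^sup>2 \<partial>NN) - ?x * (\<integral>w. ?C w \<partial>NN) - ?y * (\<integral>w. (?C w)\<^sup>2 \<partial>NN) + ?t"
    unfolding eq by (rule NN.integral_affine(2)[OF i(1,3,5,7)])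
  also have "\<dots> = bethe_mean d n"
    unfolding i(2,4,6,8) bethe_mean_def using xi_pos k2
    by (simp add: power_mult_distrib field_simps)
  finally show "(\<integral>w. bethe_lower d n w \<partial>NN) = bethe_mean d n" .
qed

lemma bethe_integrand_measurable [measurable]: "bethe_integrand d n \<in> borel_measurable NN"
proof -
  have [measurable]: "(\<lambda>w. \<Sum>s\<in>UNIV. \<Prod>i\<in>{1..n}. em i s w) \<in> borel_measurable NN"
    using vertex_sum_moments(1) by (rule borel_measurable_integrable)
  show ?thesis unfolding bethe_integrand_def[abs_def] by measurable
qed

text \<open>Very crude, yet a combination of exponentials in \<open>n\<close>, hence integrable
  against the Poisson law; it comes from \<open>abs_Lam_le\<close> and the bound of each message by
  the number of assignments.\<close>

definition bethe_dominator :: "real \<Rightarrow> nat \<Rightarrow> real" where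
  "bethe_dominator d n = (1 / real CARD('a)) * (1 / xi k P) ^ n + real CARD('a) * ((real (card (Sig k :: (nat \<Rightarrow> 'a) set)))\<^sup>2 / xi k P) ^ n
     + \<bar>d * (real k - 1) / (real k * xi k P)\<bar> * (1 + (real (card (Sig k :: (nat \<Rightarrow> 'a) set)))\<^sup>2)"

lemma bethe_integrand_bound: "AE w in NN. \<bar>bethe_integrand d n w\<bar> \<le> bethe_dominator d n"
  using AE_typical
proof eventually_elim
  case (elim w)
  let ?N = "real (card (Sig k :: (nat \<Rightarrow> 'a) set))" and ?q = "real CARD('a)"
  let ?S = "\<Sum>s\<in>UNIV. \<Prod>i\<in>{1..n}. em i s w" and ?C = "clause_value k (fst w 1) (snd w)"
  have r: "0 \<le> snd w m a" for m a using elim simplex_bounds(1) by blast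
  have psi: "0 \<le> fst w i \<tau>" if "\<tau> \<in> Sig k" for i \<tau> using range01 that elim by blast
  have S0: "0 \<le> ?S" unfolding edge_message_def
    by (intro sum_nonneg prod_nonneg mult_nonneg_nonneg) (auto intro: r psi)
  have C0: "0 \<le> ?C" unfolding clause_value_def
    by (intro sum_nonneg prod_nonneg mult_nonneg_nonneg) (auto intro: r psi)
  have em: "\<bar>em i s w\<bar> \<le> ?N" for i s
    using elim by (intro order_trans[OF abs_edge_message_le sum_abs_psi_le] abs_snd_le_1) auto
  have C1: "\<bar>?C\<bar> \<le> ?N"
    using elim by (intro order_trans[OF abs_clause_value_le sum_abs_psi_le] abs_snd_le_1) auto
  have "?S \<le> (\<Sum>s\<in>(UNIV :: 'a set). ?N ^ n)"
  proof (rule sum_mono)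
    fix s
    have "\<bar>\<Prod>i\<in>{1..n}. em i s w\<bar> \<le> (\<Prod>i\<in>{1..n}. ?N)"
      unfolding abs_prod using em by (intro prod_mono) auto
    then show "(\<Prod>i\<in>{1..n}. em i s w) \<le> ?N ^ n" by simp
  qed
  then have S1: "?S\<^sup>2 \<le> (?q * ?N ^ n)\<^sup>2" using S0 by (intro power_mono) auto
  have "\<bar>bethe_integrand d n w\<bar> \<le> \<bar>1 / ?q * (1 / xi k P ^ n) * Lam ?S\<bar> + \<bar>d * (real k - 1) / (real k * xi k P) * Lam ?C\<bar>"
    unfolding bethe_integrand_def by (rule abs_triangle_ineq4)
  also have "\<dots> \<le> 1 / ?q * (1 / xi k P ^ n) * (1 + (?q * ?N ^ n)\<^sup>2) + \<bar>d * (real k - 1) / (real k * xi k P)\<bar> * (1 + ?N\<^sup>2)"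
  proof (rule add_mono)
    have "\<bar>1 / ?q * (1 / xi k P ^ n) * Lam ?S\<bar> = 1 / ?q * (1 / xi k P ^ n) * \<bar>Lam ?S\<bar>"
      using xi_pos by (simp add: abs_mult)
    also have "\<dots> \<le> 1 / ?q * (1 / xi k P ^ n) * (1 + (?q * ?N ^ n)\<^sup>2)"
      using xi_pos abs_Lam_le[OF S0] S1 by (intro mult_left_mono) auto
    finally show "\<bar>1 / ?q * (1 / xi k P ^ n) * Lam ?S\<bar> \<le> 1 / ?q * (1 / xi k P ^ n) * (1 + (?q * ?N ^ n)\<^sup>2)" .
    have "?C\<^sup>2 \<le> ?N\<^sup>2" using C0 C1 by (intro power_mono) auto
    then show "\<bar>d * (real k - 1) / (real k * xi k P) * Lam ?C\<bar> \<le> \<bar>d * (real k - 1) / (real k * xi k P)\<bar> * (1 + ?N\<^sup>2)"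
      unfolding abs_mult[of _ "Lam ?C"] using abs_Lam_le[OF C0] by (intro mult_left_mono) auto
  qed
  also have "1 / ?q * (1 / xi k P ^ n) * (1 + (?q * ?N ^ n)\<^sup>2) = (1 / ?q) * (1 / xi k P) ^ n + ?q * (?N\<^sup>2 / xi k P) ^ n"
    using xi_pos by (simp add: power_mult_distrib power_divide power2_eq_square field_simps)
  finally show ?case unfolding bethe_dominator_def by simp
qed

lemma bethe_dominator_integrable:
  assumes "0 < d"
  shows "integrable (measure_pmf (poisson_pmf d)) (bethe_dominator d)"
  unfolding bethe_dominator_def[abs_def]
  by (intro Bochner_Integration.integrable_add integrable_mult_right poisson_power(1) assms measure_pmf.integrable_const)

text \<open>The coefficient of ln \<xi> becomes d - d(k-1)/k = d/k, the generating function yields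
  the exponentials, and all remainders collect into a constant times (e^2)^3, which is the shape
  expected by \<open>eventually_bethe_gain\<close>.\<close>

lemma bethe_mean_integral:
  assumes d: "0 < d"
  shows "integrable (measure_pmf (poisson_pmf d)) (bethe_mean d)"
    "measure_pmf.expectation (poisson_pmf d) (bethe_mean d) =
      ln (real CARD('a)) + d / real k * ln (xi k P)
       + (((\<Sum>s\<in>UNIV. \<Sum>s'\<in>UNIV. exp (d * message_cov (e\<^sup>2) z s s')) / (real CARD('a))\<^sup>2 - 1) / 2
       - d * (real k - 1) / (2 * real k) * (pair_moment k (e\<^sup>2) z / (real CARD('a))\<^sup>2 - 1)
       - (2 * exp (d * ((1 + B) ^ 3 - 1)) + d * (real k - 1) / real k * B ^ 3) * (e\<^sup>2) ^ 3)"
proof -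
  let ?M = "measure_pmf (poisson_pmf d)" and ?D = "d * (real k - 1) / real k"
  let ?E = "\<lambda>n. \<Sum>s\<in>UNIV. \<Sum>s'\<in>UNIV. (1 + message_cov (e\<^sup>2) z s s') ^ n" and ?L = "(1 + B) ^ 3"
  let ?v = "1 / (2 * (real CARD('a))\<^sup>2)" 
  let ?t = "ln (real CARD('a)) - 1 / 2 - ?D * (ln (xi k P) + (pair_moment k (e\<^sup>2) z / (real CARD('a))\<^sup>2 - 1) / 2 + (B * e\<^sup>2) ^ 3)"
  \<comment> \<open>\<open>0 * 0\<close> fills the fourth slot of
    \<open>integral_affine\<close>.\<close>
  have eq: "bethe_mean d = (\<lambda>n. ln (xi k P) * real n + ?v * ?E n - 2 * e ^ 6 * ?L ^ n - 0 * 0 + ?t)"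
  proof -
    have "lq + n * lx + (E / Q - 1) / 2 - L - T = lx * n + 1 / (2 * Q) * E - L - 0 * 0 + (lq - 1 / 2 - T)"
      for lq n lx E Q L T :: real by (simp add: diff_divide_distrib)
    then show ?thesis unfolding bethe_mean_def by (intro ext)
  qed
  have iE: "integrable ?M ?E" by (intro Bochner_Integration.integrable_sum poisson_power(1) d)
  have vE: "integral\<^sup>L ?M ?E = (\<Sum>s\<in>UNIV. \<Sum>s'\<in>UNIV. exp (d * message_cov (e\<^sup>2) z s s'))"
    using poisson_power[OF d] by simp
  note i = measure_pmf.integral_affine[of "poisson_pmf d" real ?E "\<lambda>n. ?L ^ n" "\<lambda>_. 0",
      OF poisson_mean(1)[OF d] iE poisson_power(1)[OF d] integrable_zero]
  show "integrable ?M (bethe_mean d)" unfolding eq by (rule i(1))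
  have "integral\<^sup>L ?M (bethe_mean d) = ln (xi k P) * integral\<^sup>L ?M real + ?v * integral\<^sup>L ?M ?E - 2 * e ^ 6 * integral\<^sup>L ?M (\<lambda>n. ?L ^ n) + ?t"
    unfolding eq i(2) by simp
  also have "\<dots> = ln (xi k P) * d + ?v * (\<Sum>s\<in>UNIV. \<Sum>s'\<in>UNIV. exp (d * message_cov (e\<^sup>2) z s s')) - 2 * e ^ 6 * exp (d * (?L - 1)) + ?t"
    unfolding vE poisson_mean(2)[OF d] poisson_power(2)[OF d] ..
  also have "\<dots> = ln (real CARD('a)) + d / real k * ln (xi k P)
       + (((\<Sum>s\<in>UNIV. \<Sum>s'\<in>UNIV. exp (d * message_cov (e\<^sup>2) z s s')) / (real CARD('a))\<^sup>2 - 1) / 2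
       - d * (real k - 1) / (2 * real k) * (pair_moment k (e\<^sup>2) z / (real CARD('a))\<^sup>2 - 1)
       - (2 * exp (d * (?L - 1)) + d * (real k - 1) / real k * B ^ 3) * (e\<^sup>2) ^ 3)"
  proof -
    have alg: "lx * d + 1 / (2 * Q) * S - 2 * e ^ 6 * X + (lq - 1 / 2 - d * (K - 1) / K * (lx + (p / Q - 1) / 2 + (Bk * e\<^sup>2) ^ 3)) =
      lq + d / K * lx + ((S / Q - 1) / 2 - d * (K - 1) / (2 * K) * (p / Q - 1) - (2 * X + d * (K - 1) / K * Bk ^ 3) * (e\<^sup>2) ^ 3)"
      if "K > 0" "Q > 0" for lx lq S X p Q K Bk :: real
      using that by (simp add: field_simps power_mult_distrib power_mult[symmetric])
    show ?thesis using k2 by (intro alg) auto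
  qed
  finally show "integral\<^sup>L ?M (bethe_mean d) = ln (real CARD('a)) + d / real k * ln (xi k P)
       + (((\<Sum>s\<in>UNIV. \<Sum>s'\<in>UNIV. exp (d * message_cov (e\<^sup>2) z s s')) / (real CARD('a))\<^sup>2 - 1) / 2
       - d * (real k - 1) / (2 * real k) * (pair_moment k (e\<^sup>2) z / (real CARD('a))\<^sup>2 - 1)
       - (2 * exp (d * (?L - 1)) + d * (real k - 1) / real k * B ^ 3) * (e\<^sup>2) ^ 3)" .
qed

text \<open>The minorant holds almost surely for each fixed degree, so the degree is separated by
  Fubini before the comparison.\<close>

lemma Bfun_lower:
  assumes d: "0 < d"
  shows "measure_pmf.expectation (poisson_pmf d) (bethe_mean d) \<le> Bfun k d P \<pi>"
proof -
  let ?M = "measure_pmf (poisson_pmf d)" and ?F = "\<lambda>x. bethe_integrand d (fst x) (snd x)"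
  interpret J: pair_prob_space ?M NN ..
  have Beq: "Bfun k d P \<pi> = (\<integral>x. ?F x \<partial>(?M \<Otimes>\<^sub>M NN))"
    unfolding Bfun_def joint_def bethe_integrand_def edge_message_def clause_value_def case_prod_beta' by simp
  have meas: "?F \<in> borel_measurable (?M \<Otimes>\<^sub>M NN)"
  proof -
    \<comment> \<open>The degree is discrete, so measurability for each fixed degree
      suffices.\<close>
    have "?F \<in> borel_measurable (count_space UNIV \<Otimes>\<^sub>M NN)"
      by (rule measurable_pair_measure_countable1) auto
    then show ?thesis by (subst measurable_cong_sets[OF sets_pair_measure_cong refl]) auto
  qed
  have iN: "integrable NN (bethe_integrand d n)" for n
    by (rule NN.integrable_const_bound[where B = "bethe_dominator d n"]) (use bethe_integrand_bound in auto)
  have iF: "integrable (?M \<Otimes>\<^sub>M NN) ?F"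
  proof (rule J.Fubini_integrable[OF meas])
    have "(\<integral>w. norm (bethe_integrand d n w) \<partial>NN) \<le> bethe_dominator d n" for n
    proof -
      have "(\<integral>w. norm (bethe_integrand d n w) \<partial>NN) \<le> (\<integral>w. bethe_dominator d n \<partial>NN)"
        using iN bethe_integrand_bound by (intro integral_mono_AE) auto
      then show ?thesis by (simp add: NN.prob_space)
    qed
    then show "integrable ?M (\<lambda>n. \<integral>w. norm (?F (n, w)) \<partial>NN)"
      by (intro Bochner_Integration.integrable_bound[OF bethe_dominator_integrable[OF d]])
        (auto intro!: AE_I2 simp: abs_le_iff intro: order_trans[OF _ abs_ge_self])
    show "AE n in ?M. integrable NN (\<lambda>w. ?F (n, w))" using iN by simp
  qed
  have "Bfun k d P \<pi> = (\<integral>n. (\<integral>w. bethe_integrand d n w \<partial>NN) \<partial>?M)"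
    unfolding Beq using J.integral_fst'[OF iF] by simp
  also have "\<dots> \<ge> integral\<^sup>L ?M (bethe_mean d)"
  proof (rule integral_mono)
    show "integrable ?M (bethe_mean d)" by (rule bethe_mean_integral[OF d])
    show "integrable ?M (\<lambda>n. \<integral>w. bethe_integrand d n w \<partial>NN)" using J.integrable_fst'[OF iF] by simp
    fix n
    have "AE w in NN. bethe_lower d n w \<le> bethe_integrand d n w"
      using AE_typical by eventually_elim (auto intro: bethe_lower_le[OF d])
    then show "bethe_mean d n \<le> (\<integral>w. bethe_integrand d n w \<partial>NN)"
      unfolding bethe_lower_mean(2)[symmetric]
      by (intro integral_mono_AE iN bethe_lower_mean(1))
  qed
  finally show ?thesis .
qed

end

section \<open>Realising the perturbed law and comparing the thresholds\<close>

context sym_model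
begin

lemma exists_message_law:
  fixes R :: "('a \<Rightarrow> real) pmf"
  assumes fin_R: "finite (set_pmf R)" and sum0: "\<And>x. x \<in> set_pmf R \<Longrightarrow> (\<Sum>a\<in>UNIV. x a) = 0"
    and mean: "\<And>a. measure_pmf.expectation R (\<lambda>x. x a) = 0"
    and cov: "\<And>a c. measure_pmf.expectation R (\<lambda>x. x a * x c) = z (a, c)"
    and bnd: "\<And>x a. x \<in> set_pmf R \<Longrightarrow> \<bar>x a\<bar> \<le> b"
    and b: "0 \<le> b" and e: "0 < e" "(1 + b) ^ k * e \<le> 1 / 2"
  shows "\<exists>\<pi>\<in>P2star. message_law P k \<pi> z b e"
proof -
  let ?q = "real CARD('a)"
  \<comment> \<open>\<open>R\<close> charges only vectors with this property. Elsewhere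
    \<open>f\<close> takes the uniform vector as default, so that it maps every argument into the
    simplex and is measurable into the restricted space.\<close>
  define good where "good = (\<lambda>x :: 'a \<Rightarrow> real. (\<Sum>a\<in>UNIV. x a) = 0 \<and> (\<forall>a. \<bar>x a\<bar> \<le> b))"
  define f where "f = (\<lambda>x a. if good x then (1 + e * x a) / ?q else 1 / ?q)"
  define N where "N = restrict_space (\<Pi>\<^sub>M \<omega>\<in>(UNIV :: 'a set). (borel :: real measure)) prob_simplex"
  define \<pi> where "\<pi> = distr (measure_pmf R) N f"
  have be: "b * e \<le> 1"
  proof -
    have "(1 + b) ^ 1 \<le> (1 + b) ^ k" using b k2 by (intro power_increasing) auto
    then have "(1 + b) * e \<le> (1 + b) ^ k * e" using e by (intro mult_right_mono) auto
    then show ?thesis using e by (simp add: algebra_simps)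
  qed
  have near: "\<bar>?q * f x a - 1\<bar> \<le> b * e" for x a
  proof (cases "good x")
    case True
    then have "\<bar>x a\<bar> * e \<le> b * e" using e unfolding good_def by (intro mult_right_mono) auto
    then show ?thesis using True e by (simp add: f_def abs_mult mult.commute)
  qed (use b e in \<open>simp add: f_def\<close>)
  have simplex: "f x \<in> prob_simplex" for x
  proof -
    have "0 \<le> ?q * f x a" for a using near[of x a] be by linarith
    then have "0 \<le> f x a" for a by (simp add: zero_le_mult_iff)
    moreover have "sum (f x) UNIV = 1"
    proof (cases "good x")
      case True
      then have "(\<Sum>a\<in>UNIV. 1 + e * x a) = ?q"
        by (simp add: good_def sum.distrib flip: sum_distrib_left)
      then show ?thesis using True by (simp add: f_def flip: sum_divide_distrib)
    qed (simp add: f_def)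
    ultimately show ?thesis by (simp add: prob_simplex_def)
  qed
  have space_N: "space N = prob_simplex"
    unfolding N_def by (simp add: space_restrict_space space_PiM)
  have f_meas: "f \<in> measurable (measure_pmf R) N"
    by (simp add: simplex space_N)
  have ev: "(\<lambda>\<mu>. \<mu> a) \<in> borel_measurable N" for a
    unfolding N_def by (intro measurable_restrict_space1 measurable_component_singleton) auto
  have int: "(\<integral>\<mu>. g \<mu> \<partial>\<pi>) = measure_pmf.expectation R (\<lambda>x. g (\<lambda>a. (1 + e * x a) / ?q))"
    if "g \<in> borel_measurable N" for g :: "('a \<Rightarrow> real) \<Rightarrow> real"
  proof -
    have "(\<integral>\<mu>. g \<mu> \<partial>\<pi>) = measure_pmf.expectation R (\<lambda>x. g (f x))"
      unfolding \<pi>_def by (rule integral_distr[OF f_meas that])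
    also have "\<dots> = measure_pmf.expectation R (\<lambda>x. g (\<lambda>a. (1 + e * x a) / ?q))"
      by (intro integral_cong_AE)
        (auto simp: AE_measure_pmf_iff f_def good_def sum0 bnd)
    finally show ?thesis .
  qed
  have i: "integrable (measure_pmf R) g" for g :: "('a \<Rightarrow> real) \<Rightarrow> real"
    by (rule integrable_measure_pmf_finite[OF fin_R])
  have prob: "prob_space \<pi>" unfolding \<pi>_def by (rule measure_pmf.prob_space_distr[OF f_meas])
  have mean': "(\<integral>\<mu>. \<mu> a \<partial>\<pi>) = 1 / ?q" for a
    by (subst int[OF ev]) (simp add: i mean add_divide_distrib)
  have cov': "(\<integral>\<mu>. \<mu> a * \<mu> c \<partial>\<pi>) = (1 + e\<^sup>2 * z (a, c)) / ?q\<^sup>2" for a c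
  proof -
    have "(\<integral>\<mu>. \<mu> a * \<mu> c \<partial>\<pi>) = measure_pmf.expectation R (\<lambda>x. (1 + e * x a) / ?q * ((1 + e * x c) / ?q))"
      by (rule int) (intro borel_measurable_times ev)
    also have "\<dots> = measure_pmf.expectation R (\<lambda>x. (1 + e * x a + e * x c + e\<^sup>2 * (x a * x c)) / ?q\<^sup>2)"
      by (intro Bochner_Integration.integral_cong refl) (simp add: power2_eq_square algebra_simps add_divide_distrib)
    also have "\<dots> = (1 + e\<^sup>2 * z (a, c)) / ?q\<^sup>2" by (simp add: i mean cov)
    finally show ?thesis .
  qed
  have near': "AE \<mu> in \<pi>. \<forall>a. \<bar>?q * \<mu> a - 1\<bar> \<le> b * e"
  proof -
    have "{\<mu> \<in> space N. \<forall>a\<in>UNIV. \<bar>?q * \<mu> a - 1\<bar> \<le> b * e} \<in> sets N"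
      by (intro sets.sets_Collect_finite_All' borel_measurable_le borel_measurable_abs borel_measurable_diff borel_measurable_times ev) auto
    then show ?thesis unfolding \<pi>_def by (subst AE_distr_iff[OF f_meas]) (auto simp: near)
  qed
  have sets: "sets \<pi> = sets N" and space: "space \<pi> = prob_simplex" by (auto simp: \<pi>_def space_N)
  have "\<pi> \<in> P2star" unfolding P2star_def using prob sets space mean' N_def by auto
  moreover have "message_law P k \<pi> z b e"
    by (intro message_law.intro sym_model_axioms message_law_axioms.intro)
      (fact prob sets[unfolded N_def] space mean' cov' near' b e)+
  ultimately show ?thesis by blast
qed

lemma exists_Bfun_gt:
  assumes d: "0 < d" and R: "finite (set_pmf R)" "\<And>x. x \<in> set_pmf R \<Longrightarrow> (\<Sum>a\<in>UNIV. x a) = 0"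
    "\<And>a. measure_pmf.expectation R (\<lambda>x. x a) = 0"
    and cov: "\<And>a c. measure_pmf.expectation R (\<lambda>x. x a * x c) = z (a, c)"
    and gain: "inner_t (apply_Xi k P z) z < d * (real k - 1) * (norm_t (apply_Xi k P z))\<^sup>2"
  shows "\<exists>\<pi>\<in>P2star. ln (real CARD('a)) + d / real k * ln (xi k P) < Bfun k d P \<pi>"
proof -
  define b where "b = (\<Sum>x\<in>set_pmf R. \<Sum>a\<in>UNIV. \<bar>x a\<bar>)"
  have b0: "0 \<le> b" unfolding b_def by (intro sum_nonneg) auto
  have bnd: "\<bar>x a\<bar> \<le> b" if "x \<in> set_pmf R" for x a
  proof -
    have "\<bar>x a\<bar> \<le> (\<Sum>a\<in>UNIV. \<bar>x a\<bar>)" by (rule member_le_sum[of a]) auto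
    also have "\<dots> \<le> b" unfolding b_def using that R(1) by (intro member_le_sum) (auto intro: sum_nonneg)
    finally show ?thesis .
  qed
  \<comment> \<open>The error constant of \<open>bethe_mean_integral\<close>. It depends on
    \<open>d\<close>, \<open>k\<close> and the bound \<open>b\<close> of the random vector, but not
    on the amplitude, so it is available before \<open>h\<close> is chosen.\<close>
  let ?K = "2 * exp (d * ((1 + (1 + b) ^ k) ^ 3 - 1)) + d * (real k - 1) / real k * ((1 + b) ^ k) ^ 3"
  have z0: "(\<Sum>a\<in>UNIV. \<Sum>c\<in>UNIV. z (a, c)) = 0"
  proof -
    have i: "integrable (measure_pmf R) f" for f :: "('a \<Rightarrow> real) \<Rightarrow> real"
      by (rule integrable_measure_pmf_finite[OF R(1)])
    have "(\<Sum>a\<in>UNIV. \<Sum>c\<in>UNIV. z (a, c)) = measure_pmf.expectation R (\<lambda>x. (\<Sum>a\<in>UNIV. x a) * (\<Sum>c\<in>UNIV. x c))"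
      unfolding sum_product cov[symmetric] by (simp add: i)
    also have "\<dots> = measure_pmf.expectation R (\<lambda>x. 0)"
      by (intro integral_cong_AE) (auto simp: AE_measure_pmf_iff R(2))
    finally show ?thesis by simp
  qed
  \<comment> \<open>This threshold is the condition \<open>small\<close> for the amplitude e = sqrt
    h.\<close>
  have "eventually (\<lambda>h. h < (1 / (2 * (1 + b) ^ k))\<^sup>2) (at_right 0)"
    using b0 by (intro order_tendstoD(2)[OF tendsto_ident_at]) auto
  with eventually_bethe_gain[OF d z0 gain, of ?K] eventually_at_right_less[of "0::real"]
  have "eventually (\<lambda>h. 0 < h \<and> h < (1 / (2 * (1 + b) ^ k))\<^sup>2 \<and>
     0 < ((\<Sum>s\<in>UNIV. \<Sum>s'\<in>UNIV. exp (d * message_cov h z s s')) / (real CARD('a))\<^sup>2 - 1) / 2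
     - d * (real k - 1) / (2 * real k) * (pair_moment k h z / (real CARD('a))\<^sup>2 - 1) - ?K * h ^ 3) (at_right 0)"
    by eventually_elim auto
  then obtain h where h: "0 < h" "h < (1 / (2 * (1 + b) ^ k))\<^sup>2"
     "0 < ((\<Sum>s\<in>UNIV. \<Sum>s'\<in>UNIV. exp (d * message_cov h z s s')) / (real CARD('a))\<^sup>2 - 1) / 2
     - d * (real k - 1) / (2 * real k) * (pair_moment k h z / (real CARD('a))\<^sup>2 - 1) - ?K * h ^ 3"
    using eventually_happens[of _ "at_right (0::real)"] by (auto simp: trivial_limit_at_right_real)
  define e where "e = sqrt h"
  have e: "0 < e" "e\<^sup>2 = h" using h by (auto simp: e_def)
  have "e\<^sup>2 < (1 / (2 * (1 + b) ^ k))\<^sup>2" using h e by simp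
  then have "e < 1 / (2 * (1 + b) ^ k)" by (rule power2_less_imp_less) (use b0 in simp)
  then have small: "(1 + b) ^ k * e \<le> 1 / 2" using b0 by (simp add: field_simps)
  have "\<exists>\<pi>\<in>P2star. message_law P k \<pi> z b e"
    by (rule exists_message_law[of R z b e]) (fact R cov bnd b0 e small)+
  then obtain \<pi> where p: "\<pi> \<in> P2star" "message_law P k \<pi> z b e" by blast
  interpret L: message_law P k \<pi> z b e by (rule p(2))
  have "ln (real CARD('a)) + d / real k * ln (xi k P) < Bfun k d P \<pi>"
    using L.Bfun_lower[OF d] h(3) unfolding L.bethe_mean_integral(2)[OF d] e(2) by linarith
  then show ?thesis using p(1) by blast
qed

abbreviation rayleigh_set :: "real set" where
  "rayleigh_set \<equiv> {inner_t (apply_Xi k P x) x | x. x \<in> (Espace :: ('a \<times> 'a \<Rightarrow> real) set) \<and> norm_t x = 1}"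

lemma rayleigh_bdd_above: "bdd_above rayleigh_set"
proof (rule bdd_aboveI, safe)
  fix x :: "'a \<times> 'a \<Rightarrow> real" assume n: "norm_t x = 1"
  have le: "\<bar>x p\<bar> \<le> 1" for p using abs_le_norm_t[of x p] n by simp
  have "inner_t (apply_Xi k P x) x = (\<Sum>p\<in>UNIV. \<Sum>r\<in>UNIV. Xi k P p r * (x r * x p))"
    unfolding inner_t_def apply_Xi_def sum_distrib_right by (simp add: mult.assoc)
  also have "\<dots> \<le> (\<Sum>p\<in>UNIV. \<Sum>r\<in>UNIV. \<bar>Xi k P p r\<bar>)"
  proof (intro sum_mono)
    fix p r
    have "\<bar>Xi k P p r * (x r * x p)\<bar> \<le> \<bar>Xi k P p r\<bar> * (1 * 1)"
      unfolding abs_mult by (intro mult_left_mono mult_mono le) auto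
    then show "Xi k P p r * (x r * x p) \<le> \<bar>Xi k P p r\<bar>" by linarith
  qed
  finally show "inner_t (apply_Xi k P x) x \<le> (\<Sum>p\<in>UNIV. \<Sum>r\<in>UNIV. \<bar>Xi k P p r\<bar>)" .
qed

text \<open>The witness is Z scaled to norm 1, which is possible because Z is nonzero when there are
  at least two values. The supremum is thus over a nonempty set and nonnegative, so that being
  nonzero means being positive.\<close>

lemma exists_rayleigh_nonneg:
  assumes "2 \<le> CARD('a)"
  shows "\<exists>m\<in>rayleigh_set. 0 \<le> m"
proof -
  let ?Z = "centering :: 'a \<times> 'a \<Rightarrow> real"
  define c where "c = 1 / norm_t ?Z"
  have c: "0 < c" unfolding c_def using norm_centering_pos[OF assms] by simp
  define x where "x = (\<lambda>p. c * ?Z p)"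
  have sc: "inner_t x y = c * inner_t ?Z y" for y unfolding inner_t_def x_def by (simp add: sum_distrib_left mult.assoc)
  have "inner_t x x = c\<^sup>2 * inner_t ?Z ?Z" unfolding inner_t_def x_def by (simp add: sum_distrib_left power2_eq_square mult_ac)
  then have "norm_t x = 1" unfolding norm_t_def using c by (simp add: real_sqrt_mult c_def norm_t_def)
  moreover have "x \<in> Espace" using centering_Espace[where 'a = 'a] unfolding Espace_def by (auto simp: sc)
  moreover have "inner_t (apply_Xi k P x) x = c\<^sup>2 * inner_t (apply_Xi k P ?Z) ?Z"
    unfolding inner_t_def apply_Xi_def x_def by (simp add: sum_distrib_left sum_distrib_right power2_eq_square mult_ac)
  moreover from this have "0 \<le> inner_t (apply_Xi k P x) x" using inner_apply_Xi_centering_nonneg by simp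
  ultimately show ?thesis by blast
qed

lemma d_cond_le:
  assumes "x \<in> Espace" "norm_t x = 1" "0 < d" "1 < d * (real k - 1) * inner_t (apply_Xi k P x) x"
  shows "d_cond k P \<le> ereal d"
proof -
  have "0 < d * (real k - 1)" using assms k2 by simp
  then obtain n where n: "inner_t (apply_Xi k P ((apply_Xi k P ^^ n) centering)) ((apply_Xi k P ^^ n) centering) <
    d * (real k - 1) * (norm_t (apply_Xi k P ((apply_Xi k P ^^ n) centering)))\<^sup>2"
    using exists_good_iterate assms by blast
  obtain R :: "('a \<Rightarrow> real) pmf" where R: "finite (set_pmf R)" "\<And>x. x \<in> set_pmf R \<Longrightarrow> (\<Sum>a\<in>UNIV. x a) = 0"
    "\<And>a. measure_pmf.expectation R (\<lambda>x. x a) = 0"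
    "\<And>a b. measure_pmf.expectation R (\<lambda>x. x a * x b) = (apply_Xi k P ^^ n) centering (a, b) / real CARD('a)"
    using exists_vector_law[of n] by blast
  \<comment> \<open>The available law has covariance \<Xi>^n Z divided by q; both sides of the
    strict inequality scale by the square of that factor.\<close>
  let ?w = "(apply_Xi k P ^^ n) (centering :: 'a \<times> 'a \<Rightarrow> real)" and ?c = "1 / real CARD('a)"
  define z where "z = (\<lambda>p. ?c * ?w p)"
  have ap: "apply_Xi k P z = (\<lambda>p. ?c * apply_Xi k P ?w p)"
    unfolding apply_Xi_def z_def by (simp add: sum_distrib_left mult_ac)
  have "inner_t (apply_Xi k P z) z = ?c\<^sup>2 * inner_t (apply_Xi k P ?w) ?w"
    "(norm_t (apply_Xi k P z))\<^sup>2 = ?c\<^sup>2 * (norm_t (apply_Xi k P ?w))\<^sup>2"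
    unfolding norm_t_sq ap unfolding inner_t_def z_def sum_distrib_left
    by (simp_all add: power2_eq_square mult_ac)
  then have "inner_t (apply_Xi k P z) z < d * (real k - 1) * (norm_t (apply_Xi k P z))\<^sup>2"
    using mult_strict_left_mono[OF n, of "?c\<^sup>2"] by (simp add: mult_ac)
  then obtain \<pi> where "\<pi> \<in> P2star" "ln (real CARD('a)) + d / real k * ln (xi k P) < Bfun k d P \<pi>"
    using exists_Bfun_gt[OF assms(3) R(1,2,3), of z] R(4) by (auto simp: z_def)
  then have "ereal (ln (real CARD('a)) + d / real k * ln (xi k P)) < (SUP \<pi>\<in>(P2star :: ('a \<Rightarrow> real) measure set). ereal (Bfun k d P \<pi>))"
    by (auto simp: less_SUP_iff)
  then show ?thesis unfolding d_cond_def using assms(3) by (intro Inf_lower) auto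
qed

text \<open>No maximiser of the Rayleigh quotient is required: for each d above the threshold some
  unit vector already has a quotient exceeding 1/(d(k-1)), and d then tends to the threshold from
  above.\<close>

lemma d_cond_le_d_KS:
  assumes "2 \<le> CARD('a)"
  shows "d_cond k P \<le> d_KS k P"
proof -
  define M where "M = Sup rayleigh_set"
  obtain m where m: "m \<in> rayleigh_set" "0 \<le> m" using exists_rayleigh_nonneg[OF assms] by blast
  have M0: "0 \<le> M" using cSup_upper[OF m(1) rayleigh_bdd_above] m(2) unfolding M_def by simp
  have KS: "d_KS k P = (if M = 0 then \<infinity> else ereal (1 / ((real k - 1) * M)))"
    unfolding d_KS_def M_def Let_def ..
  show ?thesis
  proof (cases "M = 0")
    case False
    with M0 have M: "0 < M" by simp
    define t where "t = 1 / ((real k - 1) * M)"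
    have t: "0 < t" using M k2 by (simp add: t_def)
    have le: "d_cond k P \<le> ereal d" if d: "t < d" for d
    proof -
      have d0: "0 < d" using t d by (rule less_trans)
      have "1 / (d * (real k - 1)) < M"
      proof -
        have "0 < (real k - 1) * M" "0 < d * (real k - 1)" using d0 M k2 by auto
        then show ?thesis using d unfolding t_def by (simp add: pos_divide_less_eq mult_ac)
      qed
      then obtain y where "y \<in> rayleigh_set" "1 / (d * (real k - 1)) < y"
        using less_cSupE[of _ rayleigh_set] m(1) unfolding M_def by blast
      then obtain x where x: "x \<in> Espace" "norm_t x = 1" "1 / (d * (real k - 1)) < inner_t (apply_Xi k P x) x" by blast
      have "1 < d * (real k - 1) * inner_t (apply_Xi k P x) x" 
      proof -
        have "0 < d * (real k - 1)" using d0 k2 by simp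
        then show ?thesis using x(3) by (simp add: pos_divide_less_eq mult.commute)
      qed
      then show ?thesis using d_cond_le x d0 by blast
    qed
    have "d_cond k P \<le> ereal t"
    proof (rule ereal_le_epsilon2)
      fix \<epsilon> :: real assume "0 < \<epsilon>"
      then show "d_cond k P \<le> ereal t + ereal \<epsilon>" using le[of "t + \<epsilon>"] by simp
    qed
    then show ?thesis using False by (simp add: KS t_def)
  qed (simp add: KS)
qed

end

theorem mainTheorem6:
  fixes P :: "((nat \<Rightarrow> 'a::finite) \<Rightarrow> real) pmf" and k :: nat
  assumes k2: "k \<ge> 2"
    and fin: "finite (set_pmf P)"
    and range01: "\<forall>\<psi>\<in>set_pmf P. \<forall>\<sigma>\<in>Sig k. 0 \<le> \<psi> \<sigma> \<and> \<psi> \<sigma> \<le> 1"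
    and perm_closed: "\<forall>\<psi>\<in>set_pmf P. \<forall>\<theta>. \<theta> permutes {..<k} \<longrightarrow> perm_con k \<theta> \<psi> \<in> set_pmf P"
    and nonconst: "Min {\<psi> \<sigma> | \<psi> \<sigma>. \<psi> \<in> set_pmf P \<and> \<sigma> \<in> Sig k}
                   < Max {\<psi> \<sigma> | \<psi> \<sigma>. \<psi> \<in> set_pmf P \<and> \<sigma> \<in> Sig k}"
    and sym: "SYM k P"
    and bal: "BAL k P"
  shows "d_cond k P \<le> d_KS k P"
proof -
  let ?V = "{\<psi> \<sigma> | \<psi> \<sigma>. \<psi> \<in> set_pmf P \<and> \<sigma> \<in> Sig k}"
  have fV: "finite ?V"
  proof -
    have "?V = (\<lambda>(\<psi>, \<sigma>). \<psi> \<sigma>) ` (set_pmf P \<times> Sig k)" by auto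
    then show ?thesis using fin by simp
  qed
  obtain \<psi>0 where "\<psi>0 \<in> set_pmf P" using set_pmf_not_empty[of P] by blast
  moreover have "(\<lambda>i\<in>{..<k}. undefined) \<in> (Sig k :: (nat \<Rightarrow> 'a) set)" unfolding Sig_def by auto
  ultimately have neV: "?V \<noteq> {}" by blast
  have not_const: "\<not> (\<forall>v\<in>?V. v = c)" for c
  proof
    assume "\<forall>v\<in>?V. v = c"
    then have "Min ?V = c" "Max ?V = c" using Min_in[OF fV neV] Max_in[OF fV neV] by blast+
    with nonconst show False by simp
  qed
  \<comment> \<open>A nonnegative value is at most the sum over the slice containing it, which SYM
    fixes; so \<xi> \<le> 0 would make every constraint vanish.\<close>
  have sub: "\<psi> \<sigma> \<le> real CARD('a) ^ (k - 1) * xi k P" if "\<psi> \<in> set_pmf P" "\<sigma> \<in> Sig k" for \<psi> \<sigma>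
  proof -
    have "\<psi> \<sigma> \<le> (\<Sum>\<tau>\<in>Sig k. if \<tau> 0 = \<sigma> 0 then \<psi> \<tau> else 0)"
      using member_le_sum[of \<sigma> "Sig k" "\<lambda>\<tau>. if \<tau> 0 = \<sigma> 0 then \<psi> \<tau> else 0"] that range01 by auto
    also have "\<dots> = real CARD('a) ^ (k - 1) * xi k P" using sym that(1) k2 unfolding SYM_def by auto
    finally show ?thesis .
  qed
  have xi0: "0 < xi k P"
  proof (rule ccontr)
    assume "\<not> 0 < xi k P"
    then have "real CARD('a) ^ (k - 1) * xi k P \<le> 0" by (intro mult_nonneg_nonpos) auto
    then have "\<forall>v\<in>?V. v = 0" using sub range01 by (force intro: antisym order_trans)
    with not_const show False by blast
  qed
  interpret sym_model P k
    by unfold_locales (use assms xi0 in auto)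
  \<comment> \<open>With a single value there is only one assignment, and SYM forces every
    constraint to equal \<xi> on it, contrary to non-constancy.\<close>
  have q2: "2 \<le> CARD('a)"
  proof (rule ccontr)
    assume "\<not> 2 \<le> CARD('a)"
    moreover have "0 < CARD('a)" by simp
    ultimately have q1: "CARD('a) = 1" by linarith
    then have "card (Sig k :: (nat \<Rightarrow> 'a) set) = 1" by (simp add: card_Sig)
    then obtain \<sigma>0 where s0: "(Sig k :: (nat \<Rightarrow> 'a) set) = {\<sigma>0}" by (rule card_1_singletonE)
    have "\<psi> \<sigma>0 = xi k P" if "\<psi> \<in> set_pmf P" for \<psi>
      using sum_psi[OF that] by (simp add: s0 W_eq q1)
    then have "\<forall>v\<in>?V. v = xi k P" by (auto simp: s0)
    with not_const show False by blast
  qed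
  show ?thesis by (rule d_cond_le_d_KS[OF q2])
qed

end
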